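(* Let $d\in\mathbb{N}$ and let $(T_i)_{i\in\mathbb{N}}\in GL_d(\mathbb{R})^{\mathbb{N}}$ satisfy $\sup_{i\in\mathbb{N}}\|T_i\|<\tfrac12$. Suppose that the singular value function $\varphi^s$ is quasi-multiplicative for all $0\le s\le d$. Then $$\dim_{\mathrm H}(F_{\mathbf a})=\min\{d,\inf\{s:P(\varphi^s)\le0\}\}=\sup\{\dim_{\mathrm H}(\pi_{\mathbf a}(I^{\mathbb{N}})):I\subset\mathbb{N}\text{ is finite}\}$$ for $\mathcal{L}_{\mathbf A}$-almost all $\mathbf a\in\mathbf A$.
   Context: $\mathbb{N}=\{1,2,\ldots\}$, $\Sigma=\mathbb{N}^{\mathbb{N}}$, $\Sigma_n=\mathbb{N}^n$, $\Sigma_*=\bigcup_{n\in\mathbb{N}}\Sigma_n$; juxtaposition denotes concatenation, and $\omega|_n$ is the word of the first $n$ letters of $\omega$. A potential $\varphi\colon\Sigma_*\to(0,\infty)$ is sub-multiplicative if $\varphi(\omega\tau)\le\varphi(\omega)\varphi(\tau)$ for all $\omega,\tau\in\Sigma_*$. A sub-multiplicative potential is quasi-multiplicative if there exist $c\ge1$ and a finite set $\Gamma\subset\Sigma_*$ such that for all $\omega,\tau\in\Sigma_*$ there is $\kappa\in\Gamma$ with $\varphi(\omega)\varphi(\tau)\le c\,\varphi(\omega\kappa\tau)$. The pressure is $P(\varphi)=\lim_{n\to\infty}\frac1n\log\sum_{\omega\in\Sigma_n}\varphi(\omega)$. For $T\in GL_d(\mathbb{R})$ let $\gamma_1(T)\ge\cdots\ge\gamma_d(T)>0$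 be its singular values. For $0<s\le d$ write $s=m+\delta$ with $m\in\mathbb{Z}$, $0<\delta\le1$, and put $\varphi^s(T)=\gamma_1(T)\cdots\gamma_m(T)\gamma_{m+1}(T)^\delta$; put $\varphi^0(T)=1$ and $\varphi^s(T)=|\det T|^{s/d}$ for $s\ge d$. For $\omega=\omega_1\cdots\omega_n\in\Sigma_n$ let $T_\omega=T_{\omega_1}\cdots T_{\omega_n}$ and $\varphi^s(\omega)=\varphi^s(T_\omega)$; this (sub-multiplicative) potential is the singular value function. $\mathbf A=([0,1]^d)^{\mathbb{N}}$ carries the product probability measure $\mathcal{L}_{\mathbf A}=(\mathcal{L}^d|_{[0,1]^d})^{\mathbb{N}}$, where $\mathcal{L}^d$ is Lebesgue measure. For $\mathbf a=(a_i)_{i\in\mathbb{N}}\in\mathbf A$ the projection $\pi_{\mathbf a}\colon\Sigma\to\mathbb{R}^d$ is $\pi_{\mathbf a}(\omega)=\sum_{j=1}^\infty T_{\omega|_{j-1}}a_{\omega_j}$ (with $T_{\omega|_0}$ the identity), and $F_{\mathbf a}=\pi_{\mathbf a}(\Sigma)$. $\dim_{\mathrm H}$ is Hausdorff dimension; $\|\cdot\|$ is the Euclidean operator norm. *)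

theory Defs
  imports "HOL-Analysis.Analysis" "HOL-Computational_Algebra.Polynomial"
begin

text \<open>
  Conventions. The alphabet is \<^typ>\<open>nat\<close>, i.e. letters are numbered from 0. Infinite words are
  functions \<^typ>\<open>nat \<Rightarrow> nat\<close> whose \<open>j\<close>-th letter (\<open>j = 1, 2, \<dots>\<close>) is the value at \<open>j - 1\<close>.
  Finite words are lists, and elements of \<open>\<Sigma>\<^sub>*\<close> are nonempty lists. The dimension \<open>d\<close> is
  \<open>CARD('d)\<close>. Dimensions and pressures are extended reals, so that \<open>inf \<emptyset> = \<infinity>\<close>.
\<close>

section \<open>Hausdorff dimension\<close>

text \<open>The convention for \<open>s = 0\<close> is made explicit because \<open>0 powr 0 = 0\<close>.\<close>

definition diam_power :: "real \<Rightarrow> 'a::metric_space set \<Rightarrow> ennreal" where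
  "diam_power s U =
    (if U = {} then 0 else if s = 0 then 1 else ennreal (diameter U powr s))"

text \<open>Boundedness is required because \<^const>\<open>diameter\<close> is unspecified on unbounded sets. Finite
  covers are included, since members of the sequence may be empty.\<close>

definition hausdorff_pre_measure :: "real \<Rightarrow> real \<Rightarrow> 'a::metric_space set \<Rightarrow> ennreal" where
  "hausdorff_pre_measure s \<delta> A =
    (INF U\<in>{U :: nat \<Rightarrow> 'a set.
        A \<subseteq> (\<Union>i. U i) \<and> (\<forall>i. bounded (U i) \<and> diameter (U i) \<le> \<delta>)}.
      \<Sum>i. diam_power s (U i))"

definition hausdorff_measure :: "real \<Rightarrow> 'a::metric_space set \<Rightarrow> ennreal" where
  "hausdorff_measure s A = (SUP \<delta>\<in>{0<..}. hausdorff_pre_measure s \<delta> A)"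

definition hausdorff_dim :: "'a::metric_space set \<Rightarrow> ereal" where
  "hausdorff_dim A = (INF s\<in>{s. 0 \<le> s \<and> hausdorff_measure s A = 0}. ereal s)"

section \<open>Singular value function\<close>

definition charpoly :: "real^'n^'n \<Rightarrow> real poly" where
  "charpoly A = det (\<chi> i j. (if i = j then [:0, 1:] else 0) - [:A $ i $ j:])"

text \<open>Singular values with multiplicity in decreasing order: the square roots of the eigenvalues of
  \<open>T\<^sup>T T\<close>. As lists are indexed from 0, \<open>\<gamma>\<^sub>k(T)\<close> is \<open>singular_values T ! (k - 1)\<close>.\<close>

definition singular_values :: "real^'n^'n \<Rightarrow> real list" where
  "singular_values T =
    rev (sorted_list_of_multiset (image_mset sqrt (proots (charpoly (transpose T ** T)))))"

text \<open>For \<open>0 < s \<le> d\<close>, the decomposition \<open>s = m + \<delta>\<close> with \<open>m\<close> an integer and \<open>0 < \<delta> \<le> 1\<close> has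
  \<open>m = \<lceil>s\<rceil> - 1\<close>. Only \<open>s \<ge> 0\<close> is meaningful.\<close>

definition singular_value_function :: "real \<Rightarrow> real^'d^'d \<Rightarrow> real" where
  "singular_value_function s T =
    (if s = 0 then 1
     else if s \<le> real CARD('d) then
       (let m = nat (\<lceil>s\<rceil> - 1)
        in prod_list (take m (singular_values T)) * (singular_values T ! m) powr (s - real m))
     else \<bar>det T\<bar> powr (s / real CARD('d)))"

definition word_matrix :: "(nat \<Rightarrow> real^'d^'d) \<Rightarrow> nat list \<Rightarrow> real^'d^'d" where
  "word_matrix T w = foldr (**) (map T w) (mat 1)"

definition sv_potential :: "(nat \<Rightarrow> real^'d^'d) \<Rightarrow> real \<Rightarrow> nat list \<Rightarrow> real" where
  "sv_potential T s w = singular_value_function s (word_matrix T w)"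

section \<open>Potentials and pressure\<close>

text \<open>The notion is meant for positive sub-multiplicative potentials. These properties are not made
  part of the definition, as the singular value function of invertible matrices has them anyway.\<close>

definition quasi_multiplicative :: "(nat list \<Rightarrow> real) \<Rightarrow> bool" where
  "quasi_multiplicative \<phi> \<longleftrightarrow>
    (\<exists>c\<ge>1. \<exists>\<Gamma>. finite \<Gamma> \<and> [] \<notin> \<Gamma> \<and>
      (\<forall>\<omega> \<tau>. \<omega> \<noteq> [] \<longrightarrow> \<tau> \<noteq> [] \<longrightarrow> (\<exists>\<kappa>\<in>\<Gamma>. \<phi> \<omega> * \<phi> \<tau> \<le> c * \<phi> (\<omega> @ \<kappa> @ \<tau>))))"

definition extended_ln :: "ennreal \<Rightarrow> ereal" where
  "extended_ln x = (if x = 0 then -\<infinity> else if x = \<infinity> then \<infinity> else ereal (ln (enn2real x)))"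

text \<open>The sum over the infinitely many words of length \<open>n\<close> may be infinite, in which case the
  pressure is \<open>\<infinity>\<close>.\<close>

definition pressure :: "(nat list \<Rightarrow> real) \<Rightarrow> ereal" where
  "pressure \<phi> =
    lim (\<lambda>n. extended_ln (\<Sum>\<^sub>\<infinity>\<omega>\<in>{\<omega>. length \<omega> = n}. ennreal (\<phi> \<omega>)) / ereal (real n))"

section \<open>Self-affine sets\<close>

definition projection ::
    "(nat \<Rightarrow> real^'d^'d) \<Rightarrow> (nat \<Rightarrow> real^'d) \<Rightarrow> (nat \<Rightarrow> nat) \<Rightarrow> real^'d" where
  "projection T a \<omega> = (\<Sum>j. word_matrix T (map \<omega> [0..<j]) *v a (\<omega> j))"

definition translation_measure :: "(nat \<Rightarrow> real^'d) measure" where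
  "translation_measure = (\<Pi>\<^sub>M i\<in>UNIV. restrict_space lborel {x. \<forall>k. 0 \<le> x $ k \<and> x $ k \<le> 1})"

end

theory Submission
  imports Defs "HOL-Probability.Probability" "HOL-Library.Sublist"
begin

text \<open>
  Write \<open>P(s)\<close> for the pressure of \<open>\<phi>\<^sup>s\<close>, \<open>d\<close> for the dimension, and let \<open>m\<close> be the minimum of \<open>d\<close> and
  \<open>inf {s. P(s) \<le> 0}\<close>. Since \<open>\<pi>\<^sub>a(I\<^sup>\<nat>)\<close> is contained in \<open>F\<^sub>a\<close>, it suffices that the dimension of \<open>F\<^sub>a\<close> is
  at most \<open>m\<close> for every \<open>a\<close>, and that for every \<open>s < m\<close> some finite \<open>I\<close> satisfies
  \<open>dim \<pi>\<^sub>a(I\<^sup>\<nat>) \<ge> s\<close> for almost every \<open>a\<close>; rational \<open>s\<close> then give a single null set.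

  Let \<open>Z\<^sub>n(s)\<close> be the sum of \<open>\<phi>\<^sup>s\<close> over the words of length \<open>n\<close>. Quasi-multiplicativity makes \<open>Z\<^sub>n(s)\<close>
  super-multiplicative up to a constant and a bounded shift of the index, so that Fekete's argument
  shows that the limit \<open>P(s)\<close> exists, and more precisely (\<open>pressure_dichotomy\<close>): if \<open>P(s) \<le> 0\<close>, then
  \<open>Z\<^sub>n(s)\<close> is bounded in \<open>n\<close>; otherwise it is unbounded.

  Upper bound. If \<open>P(s') \<le> 0\<close> and \<open>s' < s \<le> d\<close>, then \<open>Z\<^sub>n(s)\<close> tends to \<open>0\<close>, because
  \<open>\<phi>\<^sup>s \<le> \<alpha>\<^bsup>n(s-s')\<^esup> \<phi>\<^bsup>s'\<^esup>\<close> on words of length \<open>n\<close>, where \<open>\<alpha> < 1/2\<close> bounds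
  the norms of all \<open>T\<^sub>i\<close>. The set \<open>F\<^sub>a\<close> is covered by translates of
  the ellipsoids \<open>T\<^sub>\<omega>(B)\<close> with \<open>\<omega>\<close> of length \<open>n\<close>, and each of them can be cut into almost cubical pieces
  whose diameters to the power \<open>s\<close> sum up to at most a constant times \<open>\<phi>\<^sup>s(\<omega>)\<close>
  (\<open>singular_value_function_cover\<close>).

  Lower bound. Suppose that \<open>P(t) > 0\<close> and fix \<open>0 < \<epsilon> < 1\<close>. As \<open>Z\<^sub>n(t)\<close> is unbounded, finitely many
  words of one length carry a large part of it. Choosing such words independently at random, with
  probabilities proportional to \<open>\<phi>\<^sup>t\<close>, and inserting between them the connecting words supplied by
  quasi-multiplicativity gives a probability measure \<open>\<mu>\<close> on \<open>I\<^sup>\<nat>\<close> with \<open>\<mu>[v] \<le> C \<phi>\<^sup>t(v)\<close> for every cylinder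
  (\<open>exists_word_measure\<close>). By transversality, the average over \<open>a\<close> of
  \<open>|\<pi>\<^sub>a(\<omega>) - \<pi>\<^sub>a(\<tau>)|\<^bsup>-(1-\<epsilon>)t\<^esup>\<close> is at most \<open>C \<phi>\<^sup>t(\<rho>)\<^bsup>-(1-\<epsilon>)\<^esup>\<close>, where \<open>\<rho>\<close> is the common prefix of \<open>\<omega>\<close>
  and \<open>\<tau>\<close>. Integrating over \<open>\<tau>\<close> leaves \<open>\<Sum>\<^sub>n \<phi>\<^sup>t(\<omega>|\<^sub>n)\<^sup>\<epsilon>\<close>, which is dominated by a geometric series.
  Hence the \<open>(1-\<epsilon>)t\<close>-energy of the projection of \<open>\<mu>\<close> is finite for almost every \<open>a\<close>, which bounds the
  dimension from below by \<open>(1-\<epsilon>)t\<close> (\<open>hausdorff_dim_ge_energy\<close>).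

  Transversality rests on two points. First, the contraction bound \<open>\<alpha> < 1/2\<close> is enough because the
  coefficient of \<open>a\<^sub>i\<close> or that of \<open>a\<^sub>j\<close>, where \<open>i\<close> and \<open>j\<close> are the first different letters of \<open>\<omega>\<close> and
  \<open>\<tau>\<close>, differs from plus or minus the identity by at most \<open>\<alpha>/(1-\<alpha>) < 1\<close> (\<open>letter_weight_choice\<close>).
  Secondly, passing from \<open>t\<close> to \<open>(1-\<epsilon>)t\<close> multiplies the exponents of all singular values in \<open>\<phi>\<^sup>t\<close> by
  \<open>1-\<epsilon>\<close>. They become smaller than \<open>1\<close>, so the remaining integral is bounded by a product of convergent
  one-dimensional integrals in the directions of the singular vectors
  (\<open>nn_integral_matrix_singularity\<close>).
\<close>

section \<open>Singular values and the singular value function\<close>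

text \<open>
  A maximiser \<open>v\<close> of the quadratic form \<open>x \<bullet> f x\<close> on the unit sphere of \<open>S\<close> is an eigenvector: with
  \<open>l\<close> the maximum, the form \<open>l (x \<bullet> x) - x \<bullet> f x\<close> is nonnegative on \<open>S\<close> and vanishes at \<open>v\<close>, so its
  first variation at \<open>v\<close> in the direction \<open>w = l v - f v\<close>, which equals \<open>2 (w \<bullet> w)\<close>, is zero.
\<close>

lemma self_adjoint_eigenvector_in_subspace:
  fixes f :: "'a::euclidean_space \<Rightarrow> 'a"
  assumes f: "linear f" and sym: "\<And>x y. f x \<bullet> y = x \<bullet> f y"
    and S: "subspace S" "f ` S \<subseteq> S" "S \<noteq> {0}"
  obtains v l where "v \<in> S" "norm v = 1" "f v = l *\<^sub>R v"
proof -
  interpret linear f by (rule f)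
  let ?K = "{x\<in>S. norm x = 1}"
  have "?K = S \<inter> sphere 0 1" by auto
  then have "compact ?K"
    using closed_subspace[OF S(1)] compact_Int_closed[of "sphere 0 1" S] by (simp add: Int_commute)
  moreover have "?K \<noteq> {}"
  proof -
    obtain x where "x \<in> S" "x \<noteq> 0" using S(3) subspace_0[OF S(1)] by auto
    then have "x /\<^sub>R norm x \<in> ?K" using S(1) by (auto simp: subspace_scale)
    then show ?thesis by blast
  qed
  moreover have "continuous_on ?K (\<lambda>x. x \<bullet> f x)"
    by (intro continuous_intros linear_continuous_on linear_conv_bounded_linear[THEN iffD1] f)
  ultimately obtain v where v: "v \<in> ?K" and max: "\<And>x. x \<in> ?K \<Longrightarrow> x \<bullet> f x \<le> v \<bullet> f v"
    using continuous_attains_sup[of ?K "\<lambda>x. x \<bullet> f x"] by blast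
  define l where "l = v \<bullet> f v"
  have v1: "v \<bullet> v = 1" using v by (simp add: dot_square_norm)
  have q: "x \<bullet> f x \<le> l * (x \<bullet> x)" if "x \<in> S" for x
  proof (cases "x = 0")
    case False
    have "x /\<^sub>R norm x \<in> ?K" using that False S(1) by (auto simp: subspace_scale)
    from max[OF this] have "(x \<bullet> f x) / (norm x)^2 \<le> l"
      by (simp add: l_def scale power2_eq_square field_simps)
    then show ?thesis using False by (simp add: dot_square_norm field_simps)
  qed (simp add: zero)
  define w where "w = l *\<^sub>R v - f v"
  have wS: "w \<in> S" using v S by (auto simp: w_def subspace_scale subspace_diff)
  (* The nonnegative form l (x . x) - x . f x at x = v + t w, expanded in t. *)
  have ineq: "0 \<le> 2 * t * (w \<bullet> w) + t\<^sup>2 * (l * (w \<bullet> w) - w \<bullet> f w)" for t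
  proof -
    have "v + t *\<^sub>R w \<in> S" using v wS S(1) by (auto simp: subspace_add subspace_scale)
    note q[OF this]
    also have "(v + t *\<^sub>R w) \<bullet> (v + t *\<^sub>R w) = 1 + 2 * t * (w \<bullet> v) + t\<^sup>2 * (w \<bullet> w)"
      using v1 inner_commute[of v w]
      by (simp add: inner_add_left inner_add_right power2_eq_square distrib_left)
    also have "(v + t *\<^sub>R w) \<bullet> f (v + t *\<^sub>R w)
        = l + 2 * t * (w \<bullet> f v) + t\<^sup>2 * (w \<bullet> f w)"
    proof -
      have "v \<bullet> f w = w \<bullet> f v" using sym[of v w] by (simp add: inner_commute)
      then show ?thesis
        by (simp add: add scale inner_add_left inner_add_right power2_eq_square distrib_left l_def)
    qed
    also have "w \<bullet> f v = l * (w \<bullet> v) - w \<bullet> w"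
      by (simp add: w_def inner_diff_right)
    finally show ?thesis
      by (simp add: algebra_simps)
  qed
  have "w \<bullet> w = 0"
  proof (rule ccontr)
    assume "w \<bullet> w \<noteq> 0"
    then have p: "w \<bullet> w > 0" by simp
    define c where "c = \<bar>l * (w \<bullet> w) - w \<bullet> f w\<bar> + 1"
    have c: "c > 0" "l * (w \<bullet> w) - w \<bullet> f w < c" by (auto simp: c_def)
    define t where "t = - (w \<bullet> w) / c"
    have "t\<^sup>2 * (l * (w \<bullet> w) - w \<bullet> f w) \<le> t\<^sup>2 * c" using c by (intro mult_left_mono) auto
    also have "\<dots> = - t * (w \<bullet> w)" using c by (simp add: t_def power2_eq_square)
    finally have "0 \<le> t * (w \<bullet> w)" using ineq[of t] by simp
    moreover have "t < 0" using p c by (simp add: t_def)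
    ultimately show False using p by (simp add: zero_le_mult_iff)
  qed
  then have "f v = l *\<^sub>R v" by (simp add: w_def)
  then show thesis using v that by auto
qed

text \<open>
  Induction on the dimension: self-adjointness makes the orthogonal complement of an eigenvector in
  \<open>S\<close> invariant.
\<close>

lemma self_adjoint_orthonormal_eigenbasis:
  fixes f :: "'a::euclidean_space \<Rightarrow> 'a"
  assumes f: "linear f" and sym: "\<And>x y. f x \<bullet> y = x \<bullet> f y"
    and S: "subspace S" "f ` S \<subseteq> S"
  shows "\<exists>B\<subseteq>S. pairwise orthogonal B \<and> (\<forall>b\<in>B. norm b = 1 \<and> (\<exists>l. f b = l *\<^sub>R b)) \<and> span B = S"
  using S
proof (induction "dim S" arbitrary: S rule: less_induct)
  case less
  interpret linear f by (rule f)
  show ?case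
  proof (cases "S = {0}")
    case True
    then show ?thesis by (intro exI[of _ "{}"]) auto
  next
    case False
    obtain v l where v: "v \<in> S" "norm v = 1" "f v = l *\<^sub>R v"
      using self_adjoint_eigenvector_in_subspace[OF f sym less.prems False] by metis
    have v1: "v \<bullet> v = 1" using v by (simp add: dot_square_norm)
    define S' where "S' = {x\<in>S. x \<bullet> v = 0}"
    have sub: "subspace S'"
      using less.prems(1) by (auto simp: S'_def subspace_def inner_add_left)
    have inv: "f ` S' \<subseteq> S'"
      using less.prems(2) v by (auto simp: S'_def sym)
    have "v \<notin> S'" using v1 by (simp add: S'_def)
    moreover have "S' \<subseteq> S" by (auto simp: S'_def)
    ultimately have "S' \<subset> S" using v(1) by blast
    then have "dim S' < dim S"
      using dim_psubset[of S' S] sub less.prems(1) span_eq_iff by metis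
    from less.hyps[OF this sub inv] obtain B where B: "B \<subseteq> S'" "pairwise orthogonal B"
      "\<forall>b\<in>B. norm b = 1 \<and> (\<exists>l. f b = l *\<^sub>R b)" "span B = S'" by blast
    have "span (insert v B) = S"
    proof
      show "span (insert v B) \<subseteq> S"
        using B(1) v(1) less.prems(1) by (intro span_minimal) (auto simp: S'_def)
      show "S \<subseteq> span (insert v B)"
      proof
        fix x assume x: "x \<in> S"
        have "x - (x \<bullet> v) *\<^sub>R v \<in> S'"
          using x v(1) less.prems(1) v1
          by (auto simp: S'_def subspace_diff subspace_scale inner_diff_left)
        then show "x \<in> span (insert v B)"
          using B(4) by (auto simp: span_insert)
      qed
    qed
    moreover have "pairwise orthogonal (insert v B)"
      using B(1,2) by (auto simp: pairwise_insert orthogonal_def S'_def inner_commute)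
    ultimately show ?thesis
      using B v by (intro exI[of _ "insert v B"]) (auto simp: S'_def)
  qed
qed

text \<open>
  This links the definition of the singular values through roots of the characteristic polynomial
  to eigenvectors. The diagonalising orthogonal matrix and its transpose, read as matrices of
  constant polynomials, conjugate \<open>x I - A\<close> to a diagonal matrix, and their determinants cancel.
\<close>

lemma charpoly_orthonormal_eigenbasis:
  fixes A :: "real^'d^'d" and h :: "'d \<Rightarrow> real^'d"
  assumes h: "\<And>i j. h i \<bullet> h j = (if i = j then 1 else 0)"
    and ev: "\<And>j. A *v h j = lam j *\<^sub>R h j"
  shows "charpoly A = (\<Prod>j\<in>UNIV. [:- lam j, 1:])"
proof -
  define V :: "real^'d^'d" where "V = (\<chi> i j. h j $ i)"
  (* C embeds real matrices into matrices over the polynomial ring, and X is the indeterminate times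
     the identity, so that charpoly M = det (X - C M). *)
  define C :: "real^'d^'d \<Rightarrow> real poly^'d^'d" where "C M = (\<chi> i j. [:M $ i $ j:])" for M
  define X :: "real poly^'d^'d" where "X = (\<chi> i j. if i = j then [:0, 1:] else 0)"
  have VV: "transpose V ** V = mat 1"
  proof -
    have "(transpose V ** V) $ i $ j = h i \<bullet> h j" for i j
      by (simp add: matrix_matrix_mult_def transpose_def V_def inner_vec_def)
    then show ?thesis by (simp add: vec_eq_iff mat_def h)
  qed
  have AV: "A ** V = V ** (\<chi> i j. if i = j then lam j else 0)"
  proof -
    have "(A ** V) $ i $ j = (A *v h j) $ i" for i j
      by (simp add: matrix_matrix_mult_def matrix_vector_mult_def V_def)
    then show ?thesis
      by (auto simp: vec_eq_iff ev matrix_matrix_mult_def V_def if_distrib cong: if_cong)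
  qed
  have sum_const: "(\<Sum>k\<in>K. [:g k:]) = [:\<Sum>k\<in>K. g k:]" for g :: "'d \<Rightarrow> real" and K
    by (induction K rule: infinite_finite_induct) auto
  have C_mult: "C (M ** N) = C M ** C N" for M N
    by (simp add: C_def vec_eq_iff matrix_matrix_mult_def sum_const mult_ac)
  have X_comm: "X ** M = M ** X" for M
    by (auto simp: X_def vec_eq_iff matrix_matrix_mult_def if_distrib if_distribR mult_ac cong: if_cong)
  have C1: "C (mat 1) = mat 1"
    by (auto simp: C_def vec_eq_iff mat_def one_pCons)
  have cp: "charpoly M = det (X - C M)" for M
    unfolding charpoly_def by (rule arg_cong[of _ _ det]) (auto simp: X_def C_def vec_eq_iff)
  have diff_l: "M ** (N - P) = M ** N - M ** P" for M N P :: "real poly^'d^'d"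
    by (simp add: vec_eq_iff matrix_matrix_mult_def algebra_simps sum_subtractf)
  have diff_r: "(N - P) ** M = N ** M - P ** M" for M N P :: "real poly^'d^'d"
    by (simp add: vec_eq_iff matrix_matrix_mult_def algebra_simps sum_subtractf)
  let ?D = "(\<chi> i j. if i = j then lam j else 0) :: real^'d^'d"
  have "C (transpose V) ** (X - C A) ** C V = X - C ?D"
  proof -
    have "C (transpose V) ** X ** C V = X ** C (transpose V ** V)"
    proof -
      have "C (transpose V) ** X ** C V = X ** C (transpose V) ** C V"
        by (simp only: X_comm)
      then show ?thesis by (simp only: C_mult matrix_mul_assoc)
    qed
    moreover have "C (transpose V) ** C A ** C V = C (transpose V ** V ** ?D)"
    proof -
      have "C (transpose V) ** C A ** C V = C (transpose V ** (A ** V))"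
        by (simp only: C_mult matrix_mul_assoc)
      then show ?thesis by (simp only: AV matrix_mul_assoc)
    qed
    ultimately show ?thesis
      by (simp add: diff_l diff_r VV C1)
  qed
  then have "det (C (transpose V)) * charpoly A * det (C V) = det (X - C ?D)"
    by (simp only: cp flip: det_mul)
  moreover have "det (C (transpose V)) * det (C V) = 1"
    using det_mul[of "C (transpose V)" "C V"] by (simp add: C1 VV flip: C_mult)
  moreover have "det (C (transpose V)) * charpoly A * det (C V)
      = (det (C (transpose V)) * det (C V)) * charpoly A"
    by (simp only: mult.assoc mult.commute mult.left_commute)
  ultimately have "charpoly A = det (X - C ?D)"
    by simp
  also have "\<dots> = (\<Prod>j\<in>UNIV. (X - C ?D) $ j $ j)"
    by (rule det_diagonal) (auto simp: X_def C_def)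
  also have "\<dots> = (\<Prod>j\<in>UNIV. [:- lam j, 1:])"
    by (rule prod.cong) (auto simp: X_def C_def)
  finally show ?thesis .
qed

text \<open>
  Right singular vectors, listed in the order of the singular values. For \<open>i = j\<close> the second
  equation says that \<open>T\<close> stretches the \<open>i\<close>-th vector by the \<open>i\<close>-th singular value.
\<close>

definition singular_basis :: "real^'d^'d \<Rightarrow> (nat \<Rightarrow> real^'d) \<Rightarrow> bool" where
  "singular_basis T v \<longleftrightarrow> (\<forall>i<CARD('d). \<forall>j<CARD('d).
     v i \<bullet> v j = (if i = j then 1 else 0) \<and>
     (T *v v i) \<bullet> (T *v v j) = (if i = j then (singular_values T ! i)\<^sup>2 else 0))"

text \<open>The basis consists of eigenvectors of the transpose of \<open>T\<close> times \<open>T\<close>, sorted by eigenvalue.\<close>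

lemma singular_basis_exists:
  fixes T :: "real^'d^'d"
  obtains v where "singular_basis T v"
    and "length (singular_values T) = CARD('d)"
    and "sorted_wrt (\<ge>) (singular_values T)"
    and "\<And>i. i < CARD('d) \<Longrightarrow> 0 \<le> singular_values T ! i"
proof -
  define A where "A = transpose T ** T"
  have A_inner: "x \<bullet> (A *v y) = (T *v x) \<bullet> (T *v y)" for x y
    unfolding A_def by (metis dot_lmul_matrix matrix_vector_mul_assoc vector_transpose_matrix transpose_matrix_vector)
  have "linear ((*v) A)" by simp
  moreover have "(A *v x) \<bullet> y = x \<bullet> (A *v y)" for x y
    by (metis A_inner inner_commute)
  ultimately obtain B where B: "pairwise orthogonal B" "\<And>b. b \<in> B \<Longrightarrow> norm b = 1"
    "\<And>b. b \<in> B \<Longrightarrow> \<exists>l. A *v b = l *\<^sub>R b" "span B = UNIV"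
    using self_adjoint_orthonormal_eigenbasis[of "(*v) A" UNIV] by auto
  define lam where "lam b = (T *v b) \<bullet> (T *v b)" for b
  have bb: "b \<bullet> b = 1" if "b \<in> B" for b using B(2)[OF that] by (simp add: dot_square_norm)
  have ev: "A *v b = lam b *\<^sub>R b" if b: "b \<in> B" for b
  proof -
    obtain l where l: "A *v b = l *\<^sub>R b" using B(3)[OF b] by blast
    have "lam b = l" using A_inner[of b b] bb[OF b] by (simp add: lam_def l)
    then show ?thesis using l by simp
  qed
  have indep: "independent B"
    by (rule pairwise_orthogonal_independent) (use B(1) B(2)[of 0] in auto)
  have fin: "finite B" using indep finiteI_independent by blast
  have card: "card B = CARD('d)"
    using dim_eq_card_independent[OF indep] dim_span[of B] B(4) by (simp add: dim_UNIV)
  obtain xs where xs: "set xs = B" "distinct xs" using finite_distinct_list[OF fin] by blast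
  (* The definition of singular_values lists them in decreasing order. *)
  define bs where "bs = rev (sort_key lam xs)"
  have bs: "set bs = B" "distinct bs" "length bs = CARD('d)"
    using xs card distinct_card[of xs] by (auto simp: bs_def)
  have sv: "singular_values T = map (\<lambda>b. sqrt (lam b)) bs"
  proof -
    obtain h :: "'d \<Rightarrow> real^'d" where h: "bij_betw h UNIV B"
      using finite_same_card_bij[of "UNIV :: 'd set" B] fin card by auto
    have hB: "h j \<in> B" for j using h by (auto simp: bij_betw_def)
    have hinj: "h i = h j \<longleftrightarrow> i = j" for i j using h by (auto simp: bij_betw_def inj_def)
    have "h i \<bullet> h j = (if i = j then 1 else 0)" for i j
      using B(1) hB[of i] hB[of j] hinj[of i j] bb
      by (auto simp: pairwise_def orthogonal_def)
    then have "charpoly A = (\<Prod>j\<in>UNIV. [:- lam (h j), 1:])"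
      by (rule charpoly_orthonormal_eigenbasis) (use ev hB in auto)
    also have "\<dots> = (\<Prod>b\<in>B. [:- lam b, 1:])"
      by (rule prod.reindex_bij_betw[OF h])
    finally have "proots (charpoly A) = (\<Sum>b\<in>B. {#lam b#})"
      by (simp add: proots_prod)
    also have "\<dots> = image_mset lam (mset_set B)"
      using fin by (induction B rule: finite_induct) auto
    also have "mset_set B = mset bs"
      using bs by (metis mset_set_set)
    finally have "image_mset sqrt (proots (charpoly A)) = mset (map (\<lambda>b. sqrt (lam b)) (rev bs))"
      by (simp add: image_mset.compositionality o_def)
    moreover have "sorted (map (\<lambda>b. sqrt (lam b)) (rev bs))"
      unfolding sorted_map bs_def rev_rev_ident
      using sorted_sort_key[of lam xs, unfolded sorted_map] by simp
    ultimately have "sorted_list_of_multiset (image_mset sqrt (proots (charpoly A)))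
        = map (\<lambda>b. sqrt (lam b)) (rev bs)"
      by (metis sorted_list_of_multiset_mset sorted_sort_id)
    then show ?thesis
      by (simp add: singular_values_def A_def[symmetric] rev_map)
  qed
  have svi: "singular_values T ! i = sqrt (lam (bs ! i))" if "i < CARD('d)" for i
    using that bs by (simp add: sv)
  have lam0: "0 \<le> lam b" for b by (simp add: lam_def)
  have inner_bs: "bs ! i \<bullet> bs ! j = (if i = j then 1 else 0)" if "i < CARD('d)" "j < CARD('d)" for i j
    using B(1) bb that bs nth_mem[of i bs] nth_mem[of j bs] nth_eq_iff_index_eq[of bs i j]
    by (auto simp: pairwise_def orthogonal_def)
  show thesis
  proof (rule that[of "(!) bs"])
    have "(T *v bs ! i) \<bullet> (T *v bs ! j) = (if i = j then (singular_values T ! i)\<^sup>2 else 0)"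
      if ij: "i < CARD('d)" "j < CARD('d)" for i j
    proof -
      have "(T *v bs ! i) \<bullet> (T *v bs ! j) = bs ! i \<bullet> (lam (bs ! j) *\<^sub>R bs ! j)"
        using ev[of "bs ! j"] ij bs by (metis A_inner nth_mem)
      then show ?thesis using ij lam0 by (simp add: inner_bs svi)
    qed
    then show "singular_basis T ((!) bs)"
      using inner_bs by (simp add: singular_basis_def)
  next
    show "length (singular_values T) = CARD('d)" by (simp add: sv bs)
    have "sorted (rev (map (\<lambda>b. sqrt (lam b)) bs))"
      unfolding rev_map sorted_map bs_def rev_rev_ident
      using sorted_sort_key[of lam xs, unfolded sorted_map] by simp
    then show "sorted_wrt (\<ge>) (singular_values T)" by (simp add: sv sorted_wrt_rev)
    show "0 \<le> singular_values T ! i" if "i < CARD('d)" for i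
      by (simp add: svi[OF that] lam0)
  qed
qed

lemma singular_basisD:
  fixes T :: "real^'d^'d"
  assumes "singular_basis T v" "i < CARD('d)" "j < CARD('d)"
  shows "v i \<bullet> v j = (if i = j then 1 else 0)"
    and "(T *v v i) \<bullet> (T *v v j) = (if i = j then (singular_values T ! i)\<^sup>2 else 0)"
  using assms by (auto simp: singular_basis_def)

lemma length_singular_values: "length (singular_values (T :: real^'d^'d)) = CARD('d)"
  by (rule singular_basis_exists[of T])

lemma singular_value_nonneg: "k < CARD('d) \<Longrightarrow> 0 \<le> singular_values (T :: real^'d^'d) ! k"
  by (rule singular_basis_exists[of T])

lemma singular_value_decreasing:
  assumes "i \<le> k" "k < CARD('d)"
  shows "singular_values (T :: real^'d^'d) ! k \<le> singular_values T ! i"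
proof -
  have "sorted_wrt (\<ge>) (singular_values T)" by (rule singular_basis_exists[of T])
  then show ?thesis
    using assms length_singular_values[of T]
    by (cases "i = k") (auto simp: sorted_wrt_iff_nth_less)
qed

lemma norm_singular_basis:
  fixes T :: "real^'d^'d"
  assumes "singular_basis T v" "k < CARD('d)"
  shows "norm (v k) = 1" "norm (T *v v k) = singular_values T ! k"
  using singular_basisD[OF assms assms(2)] singular_value_nonneg[OF assms(2)]
  by (simp_all add: norm_eq_sqrt_inner)

lemma inj_on_singular_basis:
  fixes T :: "real^'d^'d"
  assumes "singular_basis T v"
  shows "inj_on v {..<CARD('d)}"
proof (rule inj_onI)
  fix i j assume ij: "i \<in> {..<CARD('d)}" "j \<in> {..<CARD('d)}" "v i = v j"
  then show "i = j"
    using singular_basisD(1)[OF assms, of i j] singular_basisD(1)[OF assms, of i i]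
    by (auto split: if_splits)
qed

lemma dim_span_singular_basis:
  fixes T :: "real^'d^'d"
  assumes v: "singular_basis T v" and K: "K \<subseteq> {..<CARD('d)}"
  shows "dim (span (v ` K)) = card K"
proof -
  have inj: "inj_on v K" using inj_on_singular_basis[OF v] K inj_on_subset by blast
  have "pairwise orthogonal (v ` K)"
  proof (rule pairwiseI)
    fix x y assume "x \<in> v ` K" "y \<in> v ` K" "x \<noteq> y"
    then obtain i j where "i \<in> K" "j \<in> K" "x = v i" "y = v j" "i \<noteq> j" by blast
    then show "orthogonal x y"
      using singular_basisD(1)[OF v, of i j] K by (auto simp: orthogonal_def)
  qed
  moreover have "0 \<notin> v ` K" using norm_singular_basis(1)[OF v] K by fastforce
  ultimately have "independent (v ` K)" by (rule pairwise_orthogonal_independent)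
  then show ?thesis using dim_eq_card_independent[of "v ` K"] card_image[OF inj] by simp
qed

lemma inner_span_singular_basis:
  fixes T :: "real^'d^'d"
  assumes v: "singular_basis T v" and K: "K \<subseteq> {..<CARD('d)}"
    and x: "x \<in> span (v ` K)" and i: "i < CARD('d)" "i \<notin> K"
  shows "x \<bullet> v i = 0"
proof -
  have "orthogonal (v i) y" if "y \<in> v ` K" for y
    using that i K singular_basisD(1)[OF v, of i] by (force simp: orthogonal_def)
  then have "orthogonal (v i) x" by (rule orthogonal_to_span[OF x])
  then show ?thesis by (simp add: orthogonal_def inner_commute)
qed

lemma singular_basis_expansion:
  fixes T :: "real^'d^'d"
  assumes v: "singular_basis T v"
  shows "y = (\<Sum>k<CARD('d). (y \<bullet> v k) *\<^sub>R v k)"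
proof -
  define z where "z = y - (\<Sum>k<CARD('d). (y \<bullet> v k) *\<^sub>R v k)"
  have zv: "z \<bullet> v j = 0" if "j < CARD('d)" for j
    using that
    by (simp add: z_def inner_diff_left inner_sum_left singular_basisD(1)[OF v] if_distrib cong: if_cong)
  have "span (v ` {..<CARD('d)}) = UNIV"
    using dim_span_singular_basis[OF v, of "{..<CARD('d)}"] dim_eq_full
    by (metis DIM_cart DIM_real card_lessThan mult.right_neutral span_span subset_refl)
  then have "orthogonal z z"
    using orthogonal_to_span[of z "v ` {..<CARD('d)}" z] zv by (auto simp: orthogonal_def)
  then show ?thesis by (simp add: z_def orthogonal_def)
qed

lemma norm_singular_basis_expansion:
  fixes T :: "real^'d^'d"
  assumes v: "singular_basis T v"
  shows "(norm x)\<^sup>2 = (\<Sum>i<CARD('d). (x \<bullet> v i)\<^sup>2)"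
proof -
  have "x \<bullet> x = x \<bullet> (\<Sum>k<CARD('d). (x \<bullet> v k) *\<^sub>R v k)"
    using singular_basis_expansion[OF v, of x] by simp
  then show ?thesis
    by (simp add: power2_norm_eq_inner inner_sum_right power2_eq_square[of "x \<bullet> _"])
qed

lemma norm_matrix_vector_singular_values:
  fixes T :: "real^'d^'d"
  assumes v: "singular_basis T v"
  shows "(norm (T *v y))\<^sup>2 = (\<Sum>k<CARD('d). (singular_values T ! k)\<^sup>2 * (y \<bullet> v k)\<^sup>2)"
proof -
  have "T *v y = T *v (\<Sum>k<CARD('d). (y \<bullet> v k) *\<^sub>R v k)"
    using singular_basis_expansion[OF v, of y] by simp
  also have "\<dots> = (\<Sum>k<CARD('d). (y \<bullet> v k) *\<^sub>R (T *v v k))"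
    by (simp add: linear_sum[OF matrix_vector_mul_linear] matrix_vector_mult_scaleR)
  finally have "(norm (T *v y))\<^sup>2
      = (\<Sum>i<CARD('d). (y \<bullet> v i) * (\<Sum>k<CARD('d). (y \<bullet> v k) * ((T *v v k) \<bullet> (T *v v i))))"
    by (simp add: power2_norm_eq_inner inner_sum_left inner_sum_right)
  also have "\<dots> = (\<Sum>i<CARD('d). (y \<bullet> v i) * (\<Sum>k<CARD('d).
      if k = i then (singular_values T ! i)\<^sup>2 * (y \<bullet> v i) else 0))"
    by (intro sum.cong refl arg_cong2[where f="(*)"]) (simp add: singular_basisD(2)[OF v])
  also have "\<dots> = (\<Sum>k<CARD('d). (singular_values T ! k)\<^sup>2 * (y \<bullet> v k)\<^sup>2)"
    by (simp add: power2_eq_square mult_ac)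
  finally show ?thesis .
qed

lemma singular_value_le:
  fixes T :: "real^'d^'d"
  assumes "\<And>x. norm (T *v x) \<le> a * norm x" and k: "k < CARD('d)"
  shows "singular_values T ! k \<le> a"
proof -
  obtain v where v: "singular_basis T v" by (rule singular_basis_exists)
  show ?thesis using norm_singular_basis[OF v k] assms(1)[of "v k"] by simp
qed

lemma singular_value_pos:
  fixes T :: "real^'d^'d"
  assumes "invertible T" and k: "k < CARD('d)"
  shows "0 < singular_values T ! k"
proof -
  obtain v where v: "singular_basis T v" by (rule singular_basis_exists)
  have "v k \<noteq> 0" using norm_singular_basis(1)[OF v k] by auto
  then have "T *v v k \<noteq> 0"
    using assms(1) by (metis invertible_def matrix_vector_mul_assoc matrix_vector_mul_lid matrix_vector_mult_0_right)
  then show ?thesis using norm_singular_basis(2)[OF v k] by (metis zero_less_norm_iff)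
qed

text \<open>
  One half of the min-max principle of Courant and Fischer: for dimension reasons \<open>V\<close> meets the span
  of the singular vectors with index at least \<open>k\<close>, on which \<open>T\<close> stretches by at most the \<open>k\<close>-th
  singular value.
\<close>

lemma singular_value_ge:
  fixes T :: "real^'d^'d"
  assumes V: "subspace V" "k < dim V" and r: "\<And>x. x \<in> V \<Longrightarrow> r * norm x \<le> norm (T *v x)"
  shows "r \<le> singular_values T ! k"
proof -
  obtain v where v: "singular_basis T v" by (rule singular_basis_exists)
  have k: "k < CARD('d)" using V(2) dim_subset_UNIV[of V] by simp
  let ?K = "{k..<CARD('d)}"
  have K: "?K \<subseteq> {..<CARD('d)}" by auto
  (* The dimensions add up to more than d. *)
  have "dim (V \<inter> span (v ` ?K)) > 0"
    using dim_sums_Int[OF V(1) subspace_span[of "v ` ?K"]] dim_span_singular_basis[OF v K] V(2) k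
      dim_subset_UNIV[of "{x + y |x y. x \<in> V \<and> y \<in> span (v ` ?K)}"] by simp
  then obtain x where x: "x \<in> V" "x \<in> span (v ` ?K)" "x \<noteq> 0"
    by (metis IntE dim_eq_0 gr_implies_not0 subsetI singletonI)
  have "(norm (T *v x))\<^sup>2 = (\<Sum>i<CARD('d). (singular_values T ! i)\<^sup>2 * (x \<bullet> v i)\<^sup>2)"
    by (rule norm_matrix_vector_singular_values[OF v])
  also have "\<dots> \<le> (\<Sum>i<CARD('d). (singular_values T ! k)\<^sup>2 * (x \<bullet> v i)\<^sup>2)"
  proof (rule sum_mono)
    fix i assume i: "i \<in> {..<CARD('d)}"
    show "(singular_values T ! i)\<^sup>2 * (x \<bullet> v i)\<^sup>2 \<le> (singular_values T ! k)\<^sup>2 * (x \<bullet> v i)\<^sup>2"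
    proof (cases "i < k")
      case True
      then have "x \<bullet> v i = 0" using inner_span_singular_basis[OF v K x(2)] i by auto
      then show ?thesis by simp
    next
      case False
      then show ?thesis
        using singular_value_decreasing[of k i T] singular_value_nonneg[of i T] i
        by (intro mult_right_mono power_mono) auto
    qed
  qed
  also have "\<dots> = (singular_values T ! k * norm x)\<^sup>2"
    by (simp add: norm_singular_basis_expansion[OF v] power_mult_distrib sum_distrib_left)
  finally have "norm (T *v x) \<le> singular_values T ! k * norm x"
    by (rule power2_le_imp_le) (use singular_value_nonneg[OF k] in simp)
  then have "r * norm x \<le> singular_values T ! k * norm x"
    using r[OF x(1)] by linarith
  then show ?thesis using x(3) by simp
qed

text \<open>
  Apply the min-max principle to the preimage under \<open>T\<close> of the span of the singular vectors of \<open>S\<close>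
  with index at most \<open>k\<close>, which \<open>S\<close> stretches at least by its \<open>k\<close>-th singular value.
\<close>

lemma singular_value_mult_ge:
  fixes S T :: "real^'d^'d"
  assumes T: "invertible T" and b: "\<And>x. b * norm x \<le> norm (T *v x)"
    and k: "k < CARD('d)"
  shows "singular_values S ! k * b \<le> singular_values (S ** T) ! k"
proof -
  obtain v where v: "singular_basis S v" by (rule singular_basis_exists)
  obtain T' where T': "T ** T' = mat 1" "T' ** T = mat 1" using T by (auto simp: invertible_def)
  have K: "{..k} \<subseteq> {..<CARD('d)}" using k by auto
  let ?V = "(*v) T' ` span (v ` {..k})"
  have "inj ((*v) T')" by (metis T'(1) injI matrix_vector_mul_assoc matrix_vector_mul_lid)
  then have "dim ?V = Suc k"
    using dim_image_eq[of "(*v) T'" "span (v ` {..k})"] dim_span_singular_basis[OF v K]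
    by (simp add: inj_on_subset)
  moreover have "singular_values S ! k * b * norm x \<le> norm ((S ** T) *v x)" if x: "x \<in> ?V" for x
  proof -
    obtain y where y: "y \<in> span (v ` {..k})" "x = T' *v y" using x by blast
    have Tx: "T *v x = y" by (simp add: y matrix_vector_mul_assoc T')
    have "(singular_values S ! k * norm y)\<^sup>2 = (\<Sum>i<CARD('d). (singular_values S ! k)\<^sup>2 * (y \<bullet> v i)\<^sup>2)"
      by (simp add: norm_singular_basis_expansion[OF v] power_mult_distrib sum_distrib_left)
    also have "\<dots> \<le> (\<Sum>i<CARD('d). (singular_values S ! i)\<^sup>2 * (y \<bullet> v i)\<^sup>2)"
    proof (rule sum_mono)
      fix i assume i: "i \<in> {..<CARD('d)}"
      show "(singular_values S ! k)\<^sup>2 * (y \<bullet> v i)\<^sup>2 \<le> (singular_values S ! i)\<^sup>2 * (y \<bullet> v i)\<^sup>2"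
      proof (cases "k < i")
        case True
        then have "y \<bullet> v i = 0" using inner_span_singular_basis[OF v K y(1)] i by auto
        then show ?thesis by simp
      next
        case False
        then show ?thesis
          using singular_value_decreasing[of i k S] singular_value_nonneg[OF k, of S] k
          by (intro mult_right_mono power_mono) auto
      qed
    qed
    also have "\<dots> = (norm (S *v y))\<^sup>2"
      by (rule norm_matrix_vector_singular_values[OF v, symmetric])
    finally have "singular_values S ! k * norm y \<le> norm (S *v y)"
      by (rule power2_le_imp_le) simp
    moreover have "singular_values S ! k * (b * norm x) \<le> singular_values S ! k * norm y"
      using b[of x] singular_value_nonneg[OF k, of S] by (simp add: Tx mult_left_mono)
    moreover have "(S ** T) *v x = S *v y" by (simp add: Tx flip: matrix_vector_mul_assoc)
    ultimately show ?thesis by simp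
  qed
  ultimately show ?thesis
    by (intro singular_value_ge[of ?V]) (auto intro: linear_subspace_image)
qed

text \<open>
  The exponent of \<open>\<gamma>\<^sub>k\<^sub>+\<^sub>1\<close> in \<open>\<phi>\<^sup>s\<close>: it is \<open>1\<close> for \<open>k < m\<close>, \<open>\<delta>\<close> for \<open>k = m\<close> and \<open>0\<close> for \<open>k > m\<close>, where
  \<open>s = m + \<delta>\<close>. Changes of \<open>s\<close> can then be treated in each factor separately.
\<close>

definition sv_exponent :: "real \<Rightarrow> nat \<Rightarrow> real" where
  "sv_exponent s k = max 0 (min 1 (s - real k))"

lemma sv_exponent_bounds: "0 \<le> sv_exponent s k" "sv_exponent s k \<le> 1"
  by (auto simp: sv_exponent_def)

lemma sv_exponent_mono: "s \<le> t \<Longrightarrow> sv_exponent s k \<le> sv_exponent t k"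
  by (auto simp: sv_exponent_def)

lemma sum_sv_exponent: "0 \<le> s \<Longrightarrow> s \<le> real n \<Longrightarrow> (\<Sum>k<n. sv_exponent s k) = s"
proof -
  have "0 \<le> s \<Longrightarrow> (\<Sum>k<n. sv_exponent s k) = min s (real n)"
    by (induction n) (auto simp: sv_exponent_def min_def max_def)
  then show "0 \<le> s \<Longrightarrow> s \<le> real n \<Longrightarrow> (\<Sum>k<n. sv_exponent s k) = s" by simp
qed

lemma singular_value_function_eq_prod:
  fixes T :: "real^'d^'d"
  assumes T: "invertible T" and s: "0 \<le> s" "s \<le> real CARD('d)"
  shows "singular_value_function s T = (\<Prod>k<CARD('d). (singular_values T ! k) powr sv_exponent s k)"
proof (cases "s = 0")
  case True
  have "sv_exponent s k = 0" for k by (simp add: True sv_exponent_def)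
  moreover have "singular_values T ! k \<noteq> 0" if "k < CARD('d)" for k
    using singular_value_pos[OF T that] by simp
  ultimately show ?thesis by (simp add: singular_value_function_def True)
next
  case False
  define m where "m = nat (\<lceil>s\<rceil> - 1)"
  have m: "real m < s" "s \<le> real m + 1" "m < CARD('d)"
    using s False unfolding m_def by linarith+
  let ?g = "\<lambda>k. singular_values T ! k"
  have split: "{..<CARD('d)} = {..<m} \<union> {m} \<union> {m<..<CARD('d)}" using m(3) by auto
  have "(\<Prod>k<CARD('d). ?g k powr sv_exponent s k)
      = (\<Prod>k<m. ?g k powr sv_exponent s k) * (?g m powr sv_exponent s m)
        * (\<Prod>k\<in>{m<..<CARD('d)}. ?g k powr sv_exponent s k)"
    unfolding split by (subst prod.union_disjoint; auto)+
  also have "(\<Prod>k<m. ?g k powr sv_exponent s k) = (\<Prod>k<m. ?g k)"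
  proof (intro prod.cong refl)
    fix k assume "k \<in> {..<m}"
    then have "real k + 1 \<le> real m" by simp
    then have "sv_exponent s k = 1" using m by (simp add: sv_exponent_def)
    then show "?g k powr sv_exponent s k = ?g k"
      using singular_value_pos[OF T, of k] \<open>k \<in> {..<m}\<close> m(3) by simp
  qed
  also have "sv_exponent s m = s - real m" using m by (simp add: sv_exponent_def)
  also have "(\<Prod>k\<in>{m<..<CARD('d)}. ?g k powr sv_exponent s k) = 1"
  proof (rule prod.neutral, rule ballI)
    fix k assume k: "k \<in> {m<..<CARD('d)}"
    then have "real m + 1 \<le> real k" by auto
    then have "sv_exponent s k = 0" using m by (simp add: sv_exponent_def)
    then show "?g k powr sv_exponent s k = 1"
      using singular_value_pos[OF T, of k] k by simp
  qed
  also have "(\<Prod>k<m. ?g k) = prod_list (take m (singular_values T))"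
    using m(3) by (simp add: prod.list_conv_set_nth length_singular_values atLeast0LessThan min_def)
  finally show ?thesis
    using False s by (simp add: singular_value_function_def m_def[symmetric] Let_def)
qed

lemma singular_value_function_pos:
  fixes T :: "real^'d^'d"
  assumes "invertible T" "0 \<le> s" "s \<le> real CARD('d)"
  shows "0 < singular_value_function s T"
  using singular_value_pos[OF assms(1)]
  by (auto simp: singular_value_function_eq_prod[OF assms] less_imp_neq[THEN not_sym] intro!: prod_pos)

lemma singular_value_function_mat_1:
  assumes "0 \<le> s" "s \<le> real CARD('d)"
  shows "singular_value_function s (mat 1 :: real^'d^'d) = 1"
proof -
  have "singular_values (mat 1 :: real^'d^'d) ! k = 1" if k: "k < CARD('d)" for k
  proof -
    have "singular_values (mat 1 :: real^'d^'d) ! k \<le> 1"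
      by (rule singular_value_le[OF _ k]) simp
    moreover have "1 \<le> singular_values (mat 1 :: real^'d^'d) ! k"
      by (rule singular_value_ge[of UNIV]) (use k in auto)
    ultimately show ?thesis by simp
  qed
  moreover have "invertible (mat 1 :: real^'d^'d)" by (auto simp: invertible_def intro: exI[of _ "mat 1"])
  ultimately show ?thesis by (simp add: singular_value_function_eq_prod assms)
qed

text \<open>
  Each exponent grows with \<open>s\<close>, the exponents sum up to \<open>s\<close>, and each singular value is at most
  \<open>a\<close>.
\<close>

lemma singular_value_function_antimono:
  fixes T :: "real^'d^'d"
  assumes T: "invertible T" and a: "\<And>x. norm (T *v x) \<le> a * norm x"
    and s: "0 \<le> s" "s \<le> t" "t \<le> real CARD('d)"
  shows "singular_value_function t T \<le> singular_value_function s T * a powr (t - s)"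
proof -
  have a0: "0 < a" using singular_value_le[OF a, of 0] singular_value_pos[OF T, of 0] by simp
  let ?g = "\<lambda>k. singular_values T ! k"
  have "singular_value_function t T = (\<Prod>k<CARD('d). ?g k powr sv_exponent t k)"
    using s by (intro singular_value_function_eq_prod[OF T]) auto
  also have "\<dots> \<le> (\<Prod>k<CARD('d). ?g k powr sv_exponent s k * a powr (sv_exponent t k - sv_exponent s k))"
  proof (rule prod_mono)
    fix k assume k: "k \<in> {..<CARD('d)}"
    have "?g k powr sv_exponent t k
        = ?g k powr sv_exponent s k * ?g k powr (sv_exponent t k - sv_exponent s k)"
      by (simp flip: powr_add)
    also have "\<dots> \<le> ?g k powr sv_exponent s k * a powr (sv_exponent t k - sv_exponent s k)"
      using singular_value_le[OF a, of k] singular_value_pos[OF T, of k] k sv_exponent_mono[OF s(2)]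
      by (intro mult_left_mono powr_mono2) auto
    finally show "0 \<le> ?g k powr sv_exponent t k \<and> ?g k powr sv_exponent t k
        \<le> ?g k powr sv_exponent s k * a powr (sv_exponent t k - sv_exponent s k)" by simp
  qed
  also have "\<dots> = (\<Prod>k<CARD('d). ?g k powr sv_exponent s k)
      * a powr (\<Sum>k<CARD('d). sv_exponent t k - sv_exponent s k)"
    using a0 by (simp add: prod.distrib powr_sum)
  also have "(\<Sum>k<CARD('d). sv_exponent t k - sv_exponent s k) = t - s"
    using s by (simp add: sum_subtractf sum_sv_exponent)
  also have "(\<Prod>k<CARD('d). ?g k powr sv_exponent s k) = singular_value_function s T"
    using s by (intro singular_value_function_eq_prod[OF T, symmetric]) auto
  finally show ?thesis .
qed

lemma singular_value_function_mult_ge: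
  fixes S T :: "real^'d^'d"
  assumes S: "invertible S" and T: "invertible T" and b: "0 < b" "\<And>x. b * norm x \<le> norm (T *v x)"
    and s: "0 \<le> s" "s \<le> real CARD('d)"
  shows "singular_value_function s S * b powr s \<le> singular_value_function s (S ** T)"
proof -
  have ST: "invertible (S ** T)" using S T by (simp add: invertible_mult)
  have "singular_value_function s S * b powr s
      = (\<Prod>k<CARD('d). (singular_values S ! k) powr sv_exponent s k)
        * b powr (\<Sum>k<CARD('d). sv_exponent s k)"
    using s by (simp add: singular_value_function_eq_prod[OF S s] sum_sv_exponent)
  also have "\<dots> = (\<Prod>k<CARD('d). (singular_values S ! k * b) powr sv_exponent s k)"
    using b(1) singular_value_pos[OF S]
    by (simp add: powr_sum prod.distrib[symmetric] powr_mult less_imp_le)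
  also have "\<dots> \<le> (\<Prod>k<CARD('d). (singular_values (S ** T) ! k) powr sv_exponent s k)"
    using singular_value_mult_ge[OF T b(2)] singular_value_pos[OF S] b(1)
    by (intro prod_mono conjI powr_mono2) (auto simp: sv_exponent_bounds less_imp_le)
  also have "\<dots> = singular_value_function s (S ** T)"
    by (simp add: singular_value_function_eq_prod[OF ST s])
  finally show ?thesis .
qed

section \<open>Pressure of quasi-multiplicative potentials\<close>

text \<open>
  Fekete's lemma for sequences that are superadditive up to an index shift by \<open>l\<close>. An index \<open>n\<close> is
  divided into blocks of length \<open>m + l\<close>, each of which contributes \<open>u m\<close>; the rest, of bounded length,
  is absorbed by the lower bound on the increments. The constant \<open>k\<close> serves the passage between
  \<open>ln Z\<^sub>n\<close> and \<open>ln (e Z\<^sub>n)\<close> below.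
\<close>

lemma fekete_shifted:
  fixes u :: "nat \<Rightarrow> real" and l :: nat and k :: real
  assumes super: "\<And>n m. 1 \<le> n \<Longrightarrow> 1 \<le> m \<Longrightarrow> u n + u m \<le> u (n + m + l)"
    and step: "\<And>n. 1 \<le> n \<Longrightarrow> u n - \<beta> \<le> u (n + 1)" and \<beta>: "0 \<le> \<beta>"
  shows "(\<lambda>n. ereal ((u n + k) / real n)) \<longlonglongrightarrow> (SUP m\<in>{1..}. ereal (u m / real (m + l)))"
proof (rule order_tendstoI)
  fix a :: ereal
  assume "a < (SUP m\<in>{1..}. ereal (u m / real (m + l)))"
  then obtain m where m: "1 \<le> m" "a < ereal (u m / real (m + l))"
    by (auto simp: less_SUP_iff)
  define p where "p = m + l"
  have p: "1 \<le> p" "l < p" using m(1) by (auto simp: p_def)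
  (* q blocks of length p end with a gap of length l, which the last block does without. *)
  have blocks: "real q * u m \<le> u (q * p - l)" if "1 \<le> q" for q
    using that
  proof (induction q rule: nat_induct_at_least)
    case base
    then show ?case by (simp add: p_def)
  next
    case (Suc q)
    have "p \<le> q * p" using Suc.hyps by simp
    then have lq: "l < q * p" using p by linarith
    have "real (Suc q) * u m = real q * u m + u m" by (simp add: distrib_right)
    also have "\<dots> \<le> u (q * p - l) + u m" using Suc.IH by simp
    also have "\<dots> \<le> u (q * p - l + m + l)" using lq m(1) by (intro super) auto
    also have "q * p - l + m + l = Suc q * p - l" using lq by (simp add: p_def)
    finally show ?case .
  qed
  have steps: "u n - real j * \<beta> \<le> u (n + j)" if "1 \<le> n" for n j
  proof (induction j)
    case (Suc j)
    then show ?case using step[of "n + j"] that by (simp add: algebra_simps)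
  qed simp
  define C where "C = \<bar>u m\<bar> + real (p + l) * \<beta> + \<bar>k\<bar>"
  have lower: "u m / real p - C / real n \<le> (u n + k) / real n" if n: "p \<le> n" for n
  proof -
    define q r where "q = n div p" and "r = n mod p"
    have nqr: "n = q * p + r" by (simp add: q_def r_def)
    have q: "1 \<le> q" using n p by (simp add: q_def div_greater_zero_iff Suc_le_eq)
    have r: "r < p" using p by (simp add: r_def)
    have "p \<le> q * p" using q by simp
    then have lq: "l < q * p" using p by linarith
    have "u (q * p - l) - real (r + l) * \<beta> \<le> u (q * p - l + (r + l))"
      using lq by (intro steps) auto
    also have "q * p - l + (r + l) = n" using lq nqr by simp
    finally have 1: "real q * u m - real (r + l) * \<beta> \<le> u n" using blocks[OF q] by simp
    have 2: "real (r + l) * \<beta> \<le> real (p + l) * \<beta>" using r \<beta> by (intro mult_right_mono) auto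
    have "real n = real q * real p + real r" using nqr by simp
    then have "real n * (u m / real p) = real q * u m + (real r / real p) * u m"
      using p by (simp add: field_simps)
    moreover have "(real r / real p) * u m \<le> \<bar>u m\<bar>"
    proof -
      have "(real r / real p) * u m \<le> (real r / real p) * \<bar>u m\<bar>" by (intro mult_left_mono) auto
      also have "\<dots> \<le> 1 * \<bar>u m\<bar>" using r p by (intro mult_right_mono) auto
      finally show ?thesis by simp
    qed
    ultimately have "real n * (u m / real p) - C \<le> u n + k"
      using 1 2 unfolding C_def by linarith
    moreover have n0: "0 < real n" using n p by simp
    ultimately have "(real n * (u m / real p) - C) / real n \<le> (u n + k) / real n"
      by (intro divide_right_mono) auto
    then show ?thesis using n0 by (simp add: diff_divide_distrib)
  qed
  have "(\<lambda>n. ereal (u m / real p - C / real n)) \<longlonglongrightarrow> ereal (u m / real p - 0)"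
    by (intro tendsto_intros lim_const_over_n)
  then have "\<forall>\<^sub>F n in sequentially. a < ereal (u m / real p - C / real n)"
    using m(2) by (intro order_tendstoD(1)) (auto simp: p_def)
  then show "\<forall>\<^sub>F n in sequentially. a < ereal ((u n + k) / real n)"
    using eventually_ge_at_top[of p]
  proof eventually_elim
    case (elim n)
    have "ereal (u m / real p - C / real n) \<le> ereal ((u n + k) / real n)"
      using lower[OF elim(2)] by simp
    with elim(1) show ?case by (rule less_le_trans)
  qed
next
  fix a :: ereal
  assume "(SUP m\<in>{1..}. ereal (u m / real (m + l))) < a"
  then obtain b where b: "(SUP m\<in>{1..}. ereal (u m / real (m + l))) < ereal b" "ereal b < a"
    using ereal_dense2 by blast
  have upper: "(u n + k) / real n \<le> b + (b * real l + k) / real n" if n: "1 \<le> n" for n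
  proof -
    have "ereal (u n / real (n + l)) \<le> (SUP m\<in>{1..}. ereal (u m / real (m + l)))"
      using n by (intro SUP_upper) auto
    then have "ereal (u n / real (n + l)) < ereal b" using b(1) by (rule le_less_trans)
    then have "u n \<le> b * real (n + l)" using n by (simp add: divide_less_eq)
    then have "(u n + k) / real n \<le> (b * real n + (b * real l + k)) / real n"
      by (intro divide_right_mono) (auto simp: distrib_left)
    then show ?thesis using n by (simp add: add_divide_distrib)
  qed
  have "(\<lambda>n. ereal (b + (b * real l + k) / real n)) \<longlonglongrightarrow> ereal (b + 0)"
    by (intro tendsto_intros lim_const_over_n)
  then have "\<forall>\<^sub>F n in sequentially. ereal (b + (b * real l + k) / real n) < a"
    using b(2) by (intro order_tendstoD(2)) auto
  then show "\<forall>\<^sub>F n in sequentially. ereal ((u n + k) / real n) < a"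
    using eventually_ge_at_top[of 1]
  proof eventually_elim
    case (elim n)
    have "ereal ((u n + k) / real n) \<le> ereal (b + (b * real l + k) / real n)"
      using upper[OF elim(2)] by simp
    then show ?case using elim(1) by (rule le_less_trans)
  qed
qed

definition word_sum :: "(nat list \<Rightarrow> real) \<Rightarrow> nat \<Rightarrow> ennreal" where
  "word_sum \<phi> n = (\<Sum>\<^sub>\<infinity>\<omega>\<in>{\<omega>. length \<omega> = n}. ennreal (\<phi> \<omega>))"

lemma sum_le_word_sum:
  assumes "finite F" "F \<subseteq> {\<omega>. length \<omega> = n}"
  shows "(\<Sum>\<omega>\<in>F. ennreal (\<phi> \<omega>)) \<le> word_sum \<phi> n"
  unfolding word_sum_def nonneg_infsum_complete[OF zero_le]
  using assms by (intro SUP_upper) auto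

lemma word_sum_greaterE:
  assumes "B < word_sum \<phi> n"
  obtains F :: "nat list set" where "finite F" "F \<subseteq> {\<omega>. length \<omega> = n}" "B < (\<Sum>\<omega>\<in>F. ennreal (\<phi> \<omega>))"
proof -
  obtain F where "F \<in> {F. finite F \<and> F \<subseteq> {\<omega>. length \<omega> = n}}" "B < (\<Sum>\<omega>\<in>F. ennreal (\<phi> \<omega>))"
    using assms unfolding word_sum_def nonneg_infsum_complete[OF zero_le] less_SUP_iff ..
  then show thesis using that by blast
qed

lemma word_sum_reindex_le:
  fixes \<phi> \<psi> :: "nat list \<Rightarrow> real" and g :: "nat list \<Rightarrow> nat list"
  assumes inj: "inj_on g {\<omega>. length \<omega> = n}" and g: "\<And>\<omega>. length \<omega> = n \<Longrightarrow> length (g \<omega>) = m"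
    and b: "0 \<le> b" "\<And>\<omega>. length \<omega> = n \<Longrightarrow> \<phi> \<omega> * b \<le> \<psi> (g \<omega>)"
    and \<phi>: "\<And>\<omega>. 0 \<le> \<phi> \<omega>"
  shows "word_sum \<phi> n * ennreal b \<le> word_sum \<psi> m"
proof -
  have "word_sum \<phi> n * ennreal b
      = (SUP F\<in>{F. finite F \<and> F \<subseteq> {\<omega>. length \<omega> = n}}. (\<Sum>\<omega>\<in>F. ennreal (\<phi> \<omega>)) * ennreal b)"
    unfolding word_sum_def nonneg_infsum_complete[OF zero_le]
    by (intro SUP_mult_right_ennreal)
  also have "\<dots> \<le> word_sum \<psi> m"
  proof (rule SUP_least)
    fix F :: "nat list set" assume F: "F \<in> {F. finite F \<and> F \<subseteq> {\<omega>. length \<omega> = n}}"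
    have "(\<Sum>\<omega>\<in>F. ennreal (\<phi> \<omega>)) * ennreal b = (\<Sum>\<omega>\<in>F. ennreal (\<phi> \<omega> * b))"
      by (simp add: sum_distrib_right ennreal_mult' b \<phi> del: sum_ennreal)
    also have "\<dots> \<le> (\<Sum>\<omega>\<in>F. ennreal (\<psi> (g \<omega>)))"
      using F b(2) by (intro sum_mono ennreal_leI) auto
    also have "\<dots> = (\<Sum>\<omega>\<in>g ` F. ennreal (\<psi> \<omega>))"
      using inj F by (subst sum.reindex) (auto intro: inj_on_subset)
    also have "\<dots> \<le> word_sum \<psi> m"
      using F g by (intro sum_le_word_sum) auto
    finally show "(\<Sum>\<omega>\<in>F. ennreal (\<phi> \<omega>)) * ennreal b \<le> word_sum \<psi> m" .
  qed
  finally show ?thesis .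
qed

text \<open>
  Sum the quasi-multiplicativity inequality over all pairs of words; for a fixed connecting word,
  a word of length \<open>n + length \<kappa> + m\<close> arises from only one pair.
\<close>

lemma word_sum_mult_le:
  fixes \<phi> :: "nat list \<Rightarrow> real"
  assumes quasi: "\<And>\<omega> \<tau>. \<omega> \<noteq> [] \<Longrightarrow> \<tau> \<noteq> [] \<Longrightarrow> \<exists>\<kappa>\<in>\<Gamma>. \<phi> \<omega> * \<phi> \<tau> \<le> c * \<phi> (\<omega> @ \<kappa> @ \<tau>)"
    and \<Gamma>: "finite \<Gamma>" and c: "0 \<le> c" and \<phi>: "\<And>\<omega>. 0 \<le> \<phi> \<omega>"
    and nm: "1 \<le> n" "1 \<le> m"
  shows "word_sum \<phi> n * word_sum \<phi> m \<le> ennreal c * (\<Sum>\<kappa>\<in>\<Gamma>. word_sum \<phi> (n + length \<kappa> + m))"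
proof -
  let ?R = "ennreal c * (\<Sum>\<kappa>\<in>\<Gamma>. word_sum \<phi> (n + length \<kappa> + m))"
  have fin: "(\<Sum>\<omega>\<in>F. ennreal (\<phi> \<omega>)) * (\<Sum>\<tau>\<in>G. ennreal (\<phi> \<tau>)) \<le> ?R"
    if F: "finite F" "F \<subseteq> {\<omega>. length \<omega> = n}" and G: "finite G" "G \<subseteq> {\<omega>. length \<omega> = m}" for F G
  proof -
    have "(\<Sum>\<omega>\<in>F. ennreal (\<phi> \<omega>)) * (\<Sum>\<tau>\<in>G. ennreal (\<phi> \<tau>)) = (\<Sum>\<omega>\<in>F. \<Sum>\<tau>\<in>G. ennreal (\<phi> \<omega> * \<phi> \<tau>))"
      by (simp only: sum_product ennreal_mult' \<phi>)
    also have "\<dots> \<le> (\<Sum>\<omega>\<in>F. \<Sum>\<tau>\<in>G. \<Sum>\<kappa>\<in>\<Gamma>. ennreal (c * \<phi> (\<omega> @ \<kappa> @ \<tau>)))"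
    proof (intro sum_mono)
      fix \<omega> \<tau> assume "\<omega> \<in> F" "\<tau> \<in> G"
      then have "\<omega> \<noteq> []" "\<tau> \<noteq> []" using F G nm by auto
      from quasi[OF this] obtain \<kappa> where \<kappa>: "\<kappa> \<in> \<Gamma>" "\<phi> \<omega> * \<phi> \<tau> \<le> c * \<phi> (\<omega> @ \<kappa> @ \<tau>)" by blast
      have "ennreal (\<phi> \<omega> * \<phi> \<tau>) \<le> ennreal (c * \<phi> (\<omega> @ \<kappa> @ \<tau>))" using \<kappa>(2) by (rule ennreal_leI)
      also have "\<dots> \<le> (\<Sum>\<kappa>\<in>\<Gamma>. ennreal (c * \<phi> (\<omega> @ \<kappa> @ \<tau>)))"
        using \<Gamma> \<kappa>(1) member_le_sum[of \<kappa> \<Gamma> "\<lambda>\<kappa>. ennreal (c * \<phi> (\<omega> @ \<kappa> @ \<tau>))"] by simp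
      finally show "ennreal (\<phi> \<omega> * \<phi> \<tau>) \<le> (\<Sum>\<kappa>\<in>\<Gamma>. ennreal (c * \<phi> (\<omega> @ \<kappa> @ \<tau>)))" .
    qed
    also have "\<dots> = (\<Sum>\<kappa>\<in>\<Gamma>. \<Sum>\<omega>\<in>F. \<Sum>\<tau>\<in>G. ennreal (c * \<phi> (\<omega> @ \<kappa> @ \<tau>)))"
      by (simp add: sum.swap[of _ \<Gamma> G] sum.swap[of _ \<Gamma> F])
    also have "\<dots> = (\<Sum>\<kappa>\<in>\<Gamma>. ennreal c * (\<Sum>x\<in>F \<times> G. ennreal (\<phi> (fst x @ \<kappa> @ snd x))))"
      by (simp add: sum.cartesian_product' c \<phi> ennreal_mult' sum_distrib_left del: sum_ennreal)
    also have "\<dots> \<le> (\<Sum>\<kappa>\<in>\<Gamma>. ennreal c * word_sum \<phi> (n + length \<kappa> + m))"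
    proof (intro sum_mono mult_left_mono)
      fix \<kappa> assume "\<kappa> \<in> \<Gamma>"
      let ?h = "\<lambda>x. fst x @ \<kappa> @ snd x"
      have "inj_on ?h (F \<times> G)"
        using F G by (intro inj_onI) (auto simp: subset_iff)
      then have "(\<Sum>x\<in>F \<times> G. ennreal (\<phi> (?h x))) = (\<Sum>w\<in>?h ` (F \<times> G). ennreal (\<phi> w))"
        by (simp add: sum.reindex)
      also have "\<dots> \<le> word_sum \<phi> (n + length \<kappa> + m)"
        using F G by (intro sum_le_word_sum) (auto simp: subset_iff)
      finally show "(\<Sum>x\<in>F \<times> G. ennreal (\<phi> (?h x))) \<le> word_sum \<phi> (n + length \<kappa> + m)" .
    qed simp
    finally show ?thesis by (simp add: sum_distrib_left)
  qed
  have "word_sum \<phi> n * word_sum \<phi> m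
     = (SUP F\<in>{F. finite F \<and> F \<subseteq> {\<omega>. length \<omega> = n}}. (\<Sum>\<omega>\<in>F. ennreal (\<phi> \<omega>)) * word_sum \<phi> m)"
    unfolding word_sum_def[of _ n] nonneg_infsum_complete[OF zero_le]
    by (intro SUP_mult_right_ennreal)
  also have "\<dots> = (SUP F\<in>{F. finite F \<and> F \<subseteq> {\<omega>. length \<omega> = n}}.
      SUP G\<in>{G. finite G \<and> G \<subseteq> {\<omega>. length \<omega> = m}}. (\<Sum>\<omega>\<in>F. ennreal (\<phi> \<omega>)) * (\<Sum>\<omega>\<in>G. ennreal (\<phi> \<omega>)))"
    unfolding word_sum_def[of _ m] nonneg_infsum_complete[OF zero_le]
    by (intro SUP_cong refl SUP_mult_left_ennreal)
  also have "\<dots> \<le> ?R" using fin by (intro SUP_least) auto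
  finally show ?thesis .
qed

text \<open>
  The shifted Fekete lemma identifies the pressure with the supremum of
  \<open>ln (e Z\<^sub>m) / (m + l)\<close> over \<open>m \<ge> 1\<close>. If it is nonpositive, then every \<open>Z\<^sub>m\<close> is at most \<open>1/e\<close>; if it
  is positive, then some \<open>e Z\<^sub>m\<close> exceeds \<open>1\<close> and concatenating \<open>q\<close> blocks of this kind makes the sums
  grow exponentially in \<open>q\<close>. The bound \<open>b\<close> for appending the letter \<open>0\<close> compares sums over words of
  different lengths; in particular, one infinite sum makes all later ones infinite, and then the
  pressure is infinite as well.
\<close>

lemma pressure_dichotomy:
  assumes quasi: "quasi_multiplicative \<phi>" and \<phi>: "\<And>\<omega>. 0 < \<phi> \<omega>"
    and b: "0 < b" "\<And>\<omega>. \<phi> \<omega> * b \<le> \<phi> (\<omega> @ [0])"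
  shows "(pressure \<phi> \<le> 0 \<and> (\<exists>K. \<forall>n\<ge>1. word_sum \<phi> n \<le> ennreal K)) \<or>
         (\<not> pressure \<phi> \<le> 0 \<and> (\<forall>K. \<exists>n\<ge>1. ennreal K < word_sum \<phi> n))"
proof -
  have \<phi>0: "0 \<le> \<phi> \<omega>" for \<omega> using \<phi>[of \<omega>] by simp
  obtain c \<Gamma> where c: "1 \<le> c" and \<Gamma>: "finite \<Gamma>"
    and qm: "\<And>\<omega> \<tau>. \<omega> \<noteq> [] \<Longrightarrow> \<tau> \<noteq> [] \<Longrightarrow> \<exists>\<kappa>\<in>\<Gamma>. \<phi> \<omega> * \<phi> \<tau> \<le> c * \<phi> (\<omega> @ \<kappa> @ \<tau>)"
    using quasi unfolding quasi_multiplicative_def by blast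
  define b' where "b' = min b 1"
  have b': "0 < b'" "b' \<le> 1" "\<And>\<omega>. \<phi> \<omega> * b' \<le> \<phi> (\<omega> @ [0])"
  proof -
    show "0 < b'" "b' \<le> 1" using b by (auto simp: b'_def)
    fix \<omega> show "\<phi> \<omega> * b' \<le> \<phi> (\<omega> @ [0])"
      using b(2)[of \<omega>] \<phi>0[of \<omega>] mult_left_mono[of b' b "\<phi> \<omega>"] by (simp add: b'_def)
  qed
  let ?Z = "word_sum \<phi>"
  have press: "pressure \<phi> = lim (\<lambda>n. extended_ln (?Z n) / ereal (real n))"
    by (simp add: pressure_def word_sum_def)
  have Z_step: "?Z n * ennreal b' \<le> ?Z (n + 1)" for n
    by (rule word_sum_reindex_le[where g="\<lambda>\<omega>. \<omega> @ [0]"]) (use b' \<phi>0 in \<open>auto simp: inj_on_def\<close>)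
  have Z_steps: "?Z n * ennreal (b' ^ j) \<le> ?Z (n + j)" for n j
  proof (induction j)
    case (Suc j)
    have "?Z n * ennreal (b' ^ Suc j) = ?Z n * ennreal (b' ^ j) * ennreal b'"
      using b'(1) by (simp add: ennreal_mult' mult_ac)
    also have "\<dots> \<le> ?Z (n + j) * ennreal b'" using Suc by (intro mult_right_mono) auto
    also have "\<dots> \<le> ?Z (n + Suc j)" using Z_step[of "n + j"] by simp
    finally show ?case .
  qed simp
  have Z_pos: "0 < ?Z n" for n
  proof -
    have "0 < (\<Sum>\<omega>\<in>{replicate n 0}. ennreal (\<phi> \<omega>))" using \<phi> by simp
    also have "\<dots> \<le> ?Z n" by (rule sum_le_word_sum) auto
    finally show ?thesis .
  qed
  show ?thesis
  proof (cases "\<exists>n\<ge>1. ?Z n = \<infinity>")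
    case True
    then obtain n0 where n0: "?Z n0 = \<infinity>" "1 \<le> n0" by auto
    have inf: "?Z n = \<infinity>" if "n0 \<le> n" for n
      using Z_steps[of n0 "n - n0"] n0 b'(1) that by (auto simp: ennreal_top_mult top_unique)
    have "\<forall>\<^sub>F n in sequentially. \<infinity> = extended_ln (?Z n) / ereal (real n)"
      using eventually_ge_at_top[of "max n0 1"]
      by eventually_elim (simp add: inf extended_ln_def)
    then have "(\<lambda>n. extended_ln (?Z n) / ereal (real n)) \<longlonglongrightarrow> \<infinity>"
      by (rule Lim_transform_eventually[OF tendsto_const])
    then have "pressure \<phi> = \<infinity>" unfolding press by (rule limI)
    then show ?thesis using n0 by auto
  next
    case False
    define z where "z n = enn2real (?Z n)" for n
    have Zz: "?Z n = ennreal (z n)" if "1 \<le> n" for n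
      using False that by (auto simp: z_def less_top)
    have z_pos: "0 < z n" if "1 \<le> n" for n
      using Z_pos[of n] Zz[OF that] by simp
    have z_steps: "z n * b' ^ j \<le> z (n + j)" if "1 \<le> n" for n j
    proof -
      have "ennreal (z n * b' ^ j) \<le> ennreal (z (n + j))"
        using Z_steps[of n j] Zz[OF that] Zz[of "n + j"] that z_pos[OF that]
        by (simp add: ennreal_mult' b'(1))
      then show ?thesis using z_pos[of "n + j"] that by simp
    qed
    define l where "l = Max (insert 0 (length ` \<Gamma>))"
    have l: "length \<kappa> \<le> l" if "\<kappa> \<in> \<Gamma>" for \<kappa> using that \<Gamma> by (simp add: l_def)
    (* Chosen so that e * z n * z m <= z (n + m + l), i.e. e * z n is super-multiplicative up to the
     shift by l; b' ^ l accounts for connecting words shorter than l. *)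
  define e where "e = b' ^ l / (c * (real (card \<Gamma>) + 1))"
    have e: "0 < e" using b' c by (simp add: e_def)
    have z_super: "e * z n * z m \<le> z (n + m + l)" if nm: "1 \<le> n" "1 \<le> m" for n m
    proof -
      have le: "ennreal (z n * z m) \<le> ennreal (c * (\<Sum>\<kappa>\<in>\<Gamma>. z (n + length \<kappa> + m)))"
        using word_sum_mult_le[OF qm \<Gamma> _ \<phi>0 nm] c nm
        by (simp add: Zz ennreal_mult' sum_ennreal z_pos less_imp_le)
      then have "z n * z m \<le> c * (\<Sum>\<kappa>\<in>\<Gamma>. z (n + length \<kappa> + m))"
      proof -
        have "0 \<le> z (n + length \<kappa> + m)" for \<kappa> using z_pos[of "n + length \<kappa> + m"] nm by simp
        then have "0 \<le> c * (\<Sum>\<kappa>\<in>\<Gamma>. z (n + length \<kappa> + m))"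
          using c by (intro mult_nonneg_nonneg sum_nonneg) auto
        with le show ?thesis by (simp add: ennreal_le_iff)
      qed
      also have "\<dots> \<le> c * (\<Sum>\<kappa>\<in>\<Gamma>. z (n + m + l) / b' ^ l)"
      proof (intro mult_left_mono sum_mono)
        fix \<kappa> assume \<kappa>: "\<kappa> \<in> \<Gamma>"
        let ?j = "l - length \<kappa>"
        have "z (n + length \<kappa> + m) * b' ^ l \<le> z (n + length \<kappa> + m) * b' ^ ?j"
          using b' z_pos[of "n + length \<kappa> + m"] nm
          by (intro mult_left_mono power_decreasing) auto
        also have "\<dots> \<le> z (n + length \<kappa> + m + ?j)" using nm by (intro z_steps) auto
        also have "n + length \<kappa> + m + ?j = n + m + l" using l[OF \<kappa>] by simp
        finally show "z (n + length \<kappa> + m) \<le> z (n + m + l) / b' ^ l"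
          using b' by (simp add: field_simps)
      qed (use c in simp)
      also have "\<dots> = (c * real (card \<Gamma>) / b' ^ l) * z (n + m + l)" by simp
      also have "\<dots> \<le> (1 / e) * z (n + m + l)"
        using c b' z_pos[of "n + m + l"] nm
        by (intro mult_right_mono) (auto simp: e_def divide_right_mono)
      finally show ?thesis using e by (simp add: field_simps)
    qed
    define u where "u n = ln (e * z n)" for n
    have u_super: "u n + u m \<le> u (n + m + l)" if nm: "1 \<le> n" "1 \<le> m" for n m
    proof -
      have "u n + u m = ln (e * (e * z n * z m))"
        using e z_pos[OF nm(1)] z_pos[OF nm(2)] ln_mult[of "e * z n" "e * z m"]
        by (simp add: u_def mult_ac)
      also have "\<dots> \<le> u (n + m + l)"
        unfolding u_def using e z_pos nm z_super[OF nm]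
        by (intro ln_mono) (auto intro!: mult_pos_pos mult_left_mono)
      finally show ?thesis .
    qed
    have u_step: "u n - (- ln b') \<le> u (n + 1)" if n: "1 \<le> n" for n
    proof -
      have "u n - (- ln b') = ln (e * (z n * b'))"
        using e z_pos[OF n] b'(1) by (simp add: u_def ln_mult)
      also have "\<dots> \<le> u (n + 1)"
        unfolding u_def using e z_pos n b'(1) z_steps[OF n, of 1]
        by (intro ln_mono) (auto intro!: mult_pos_pos mult_left_mono)
      finally show ?thesis .
    qed
    define L where "L = (SUP m\<in>{1..}. ereal (u m / real (m + l)))"
    have "(\<lambda>n. ereal ((u n + (- ln e)) / real n)) \<longlonglongrightarrow> L"
      unfolding L_def by (rule fekete_shifted[OF u_super u_step]) (use b' in auto)
    moreover have "\<forall>\<^sub>F n in sequentially.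
        ereal ((u n + (- ln e)) / real n) = extended_ln (?Z n) / ereal (real n)"
      using eventually_ge_at_top[of 1]
    proof eventually_elim
      case (elim n)
      then show ?case
        using e z_pos[of n] by (simp add: Zz extended_ln_def u_def ln_mult ennreal_eq_0_iff not_le)
    qed
    ultimately have "(\<lambda>n. extended_ln (?Z n) / ereal (real n)) \<longlonglongrightarrow> L"
      by (rule Lim_transform_eventually)
    then have PL: "pressure \<phi> = L" unfolding press by (rule limI)
    show ?thesis
    proof (cases "L \<le> 0")
      case True
      have "?Z n \<le> ennreal (1 / e)" if n: "1 \<le> n" for n
      proof -
        have "ereal (u n / real (n + l)) \<le> L" unfolding L_def using n by (intro SUP_upper) auto
        then have "ereal (u n / real (n + l)) \<le> 0" using True by (rule order_trans)
        then have "u n \<le> 0" using n by (simp add: divide_le_0_iff)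
        then have "e * z n \<le> 1" using e z_pos[OF n] by (simp add: u_def)
        then show ?thesis using e by (simp add: Zz[OF n] ennreal_leI field_simps)
      qed
      then show ?thesis using True PL by auto
    next
      case False
      then obtain m where m: "1 \<le> m" "0 < u m / real (m + l)"
        by (auto simp: L_def not_le less_SUP_iff)
      then have um: "0 < u m" by (simp add: zero_less_divide_iff)
      have "\<exists>n\<ge>1. ennreal K < ?Z n" for K
      proof -
        have grow: "\<exists>n\<ge>1. real q * u m \<le> u n" if "1 \<le> q" for q
          using that
        proof (induction q rule: nat_induct_at_least)
          case base
          then show ?case using m by auto
        next
          case (Suc q)
          then obtain n where "n \<ge> 1" "real q * u m \<le> u n" by blast
          then show ?case using u_super[of n m] m(1)
            by (intro exI[of _ "n + m + l"]) (auto simp: distrib_right)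
        qed
        define K' where "K' = max K 1"
        obtain q :: nat where q: "ln (e * K') < real q * u m" using ex_less_of_nat_mult[OF um] by blast
        then have "ln (e * K') < real (Suc q) * u m" using um by (simp add: distrib_right)
        moreover obtain n where "1 \<le> n" "real (Suc q) * u m \<le> u n"
          using grow[of "Suc q"] by auto
        ultimately have n: "1 \<le> n" "ln (e * K') < u n" by linarith+
        have "e * K' < e * z n"
          using n(2) e z_pos[OF n(1)] unfolding u_def
          by (subst (asm) ln_less_cancel_iff) (auto simp: K'_def)
        then have "K < z n" using e by (simp add: K'_def)
        then show ?thesis using n(1) z_pos[OF n(1)] by (auto simp: Zz ennreal_lessI)
      qed
      then show ?thesis using False PL by auto
    qed
  qed
qed

section \<open>Hausdorff dimension: covers and energies\<close>

lemma hausdorff_pre_measure_mono: "A \<subseteq> B \<Longrightarrow> hausdorff_pre_measure s \<delta> A \<le> hausdorff_pre_measure s \<delta> B"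
  unfolding hausdorff_pre_measure_def by (rule INF_superset_mono) auto

lemma hausdorff_measure_mono: "A \<subseteq> B \<Longrightarrow> hausdorff_measure s A \<le> hausdorff_measure s B"
  unfolding hausdorff_measure_def by (intro SUP_mono') (auto intro: hausdorff_pre_measure_mono)

lemma hausdorff_dim_mono:
  assumes "A \<subseteq> B" shows "hausdorff_dim A \<le> hausdorff_dim B"
  unfolding hausdorff_dim_def
proof (rule INF_superset_mono)
  show "{s. 0 \<le> s \<and> hausdorff_measure s B = 0} \<subseteq> {s. 0 \<le> s \<and> hausdorff_measure s A = 0}"
    using hausdorff_measure_mono[OF assms] by (metis (mono_tags, lifting) Collect_mono le_zero_eq)
qed simp

lemma hausdorff_dim_nonneg: "0 \<le> hausdorff_dim A"
  unfolding hausdorff_dim_def by (intro INF_greatest) auto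

lemma hausdorff_dim_le:
  assumes s: "0 \<le> s" and small: "\<And>\<delta> e. 0 < \<delta> \<Longrightarrow> 0 < e \<Longrightarrow> hausdorff_pre_measure s \<delta> A \<le> ennreal e"
  shows "hausdorff_dim A \<le> ereal s"
proof -
  have "hausdorff_pre_measure s \<delta> A = 0" if "0 < \<delta>" for \<delta>
    using small[OF that] by (metis ennreal_0 ennreal_le_epsilon add.left_neutral le_zero_eq)
  then have "hausdorff_measure s A = 0"
    unfolding hausdorff_measure_def by (auto simp: SUP_eq_iff)
  then show ?thesis
    unfolding hausdorff_dim_def using s by (intro INF_lower) auto
qed

lemma hausdorff_pre_measure_le_countable_cover:
  fixes U :: "'i::countable \<Rightarrow> 'a::metric_space set"
  assumes cover: "A \<subseteq> (\<Union>i\<in>I. U i)" and \<delta>: "0 \<le> \<delta>"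
    and U: "\<And>i. i \<in> I \<Longrightarrow> bounded (U i) \<and> diameter (U i) \<le> \<delta>"
    and sums: "\<And>F. finite F \<Longrightarrow> F \<subseteq> I \<Longrightarrow> (\<Sum>i\<in>F. diam_power s (U i)) \<le> B"
  shows "hausdorff_pre_measure s \<delta> A \<le> B"
proof -
  (* Enumerate the index set; numbers that code no index of I get the empty set. *)
  define V where "V n = (if n \<in> to_nat ` I then U (from_nat n) else {})" for n
  have "hausdorff_pre_measure s \<delta> A \<le> (\<Sum>n. diam_power s (V n))"
    unfolding hausdorff_pre_measure_def
  proof (rule INF_lower, safe)
    fix x assume "x \<in> A"
    then obtain i where "i \<in> I" "x \<in> U i" using cover by blast
    then show "x \<in> (\<Union>n. V n)" by (auto simp: V_def intro!: exI[of _ "to_nat i"])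
  next
    fix n show "bounded (V n)" "diameter (V n) \<le> \<delta>"
      using U \<delta> by (auto simp: V_def)
  qed
  also have "\<dots> = (SUP N. \<Sum>n<N. diam_power s (V n))" by (rule suminf_eq_SUP)
  also have "\<dots> \<le> B"
  proof (rule SUP_least)
    fix N :: nat
    define F where "F = {i\<in>I. to_nat i < N}"
    have toF: "to_nat ` F = {n\<in>{..<N}. n \<in> to_nat ` I}" by (auto simp: F_def)
    have finF: "finite F"
      by (rule finite_imageD[of to_nat]) (auto simp: toF inj_on_def)
    have "(\<Sum>n<N. diam_power s (V n)) = (\<Sum>n\<in>to_nat ` F. diam_power s (V n))"
      unfolding toF by (rule sum.mono_neutral_right) (auto simp: V_def diam_power_def)
    also have "\<dots> = (\<Sum>i\<in>F. diam_power s (V (to_nat i)))"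
      by (subst sum.reindex) (auto simp: inj_on_def)
    also have "\<dots> = (\<Sum>i\<in>F. diam_power s (U i))"
      by (intro sum.cong refl) (auto simp: V_def F_def)
    also have "\<dots> \<le> B" using finF by (intro sums) (auto simp: F_def)
    finally show "(\<Sum>n<N. diam_power s (V n)) \<le> B" .
  qed
  finally show ?thesis .
qed

lemma diam_power_le:
  assumes "0 < s" "bounded U" "diameter U \<le> D"
  shows "diam_power s U \<le> ennreal (D powr s)"
  using assms diameter_ge_0[OF assms(2)]
  by (auto simp: diam_power_def intro!: ennreal_leI powr_mono2)

text \<open>
  Countably many sets, each with its own finite cover, of which only the size and the largest
  diameter matter.
\<close>

lemma hausdorff_pre_measure_le_finite_covers:
  fixes A :: "'i::countable \<Rightarrow> 'a::metric_space set" and \<U> :: "'i \<Rightarrow> 'a set set"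
  assumes s: "0 < s" and \<delta>: "0 \<le> \<delta>"
    and fin: "\<And>i. i \<in> I \<Longrightarrow> finite (\<U> i) \<and> real (card (\<U> i)) \<le> N i"
    and cover: "\<And>i. i \<in> I \<Longrightarrow> A i \<subseteq> \<Union>(\<U> i)"
    and diam: "\<And>i U. i \<in> I \<Longrightarrow> U \<in> \<U> i \<Longrightarrow> bounded U \<and> diameter U \<le> D i" and D: "\<And>i. i \<in> I \<Longrightarrow> D i \<le> \<delta>"
    and sums: "\<And>F. finite F \<Longrightarrow> F \<subseteq> I \<Longrightarrow> (\<Sum>i\<in>F. ennreal (N i * D i powr s)) \<le> B"
  shows "hausdorff_pre_measure s \<delta> (\<Union>i\<in>I. A i) \<le> B"
proof -
  have "\<forall>i\<in>I. \<exists>e. \<U> i = e ` {..<card (\<U> i)}"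
  proof
    fix i assume "i \<in> I"
    then have "finite (\<U> i)" using fin by blast
    then show "\<exists>e. \<U> i = e ` {..<card (\<U> i)}"
      using finite_imp_nat_seg_image_inj_on[of "\<U> i"] ex_bij_betw_nat_finite[of "\<U> i"]
      by (auto simp: bij_betw_def atLeast0LessThan)
  qed
  then obtain e where e: "\<And>i. i \<in> I \<Longrightarrow> \<U> i = e i ` {..<card (\<U> i)}" by metis
  let ?J = "Sigma I (\<lambda>i. {..<card (\<U> i)})"
  have eU: "e i j \<in> \<U> i" if "i \<in> I" "j < card (\<U> i)" for i j using e[OF that(1)] that by blast
  show ?thesis
  proof (rule hausdorff_pre_measure_le_countable_cover[where U="\<lambda>(i, j). e i j" and I="?J"])
    show "(\<Union>i\<in>I. A i) \<subseteq> (\<Union>x\<in>?J. case x of (i, j) \<Rightarrow> e i j)"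
    proof safe
      fix i x assume i: "i \<in> I" "x \<in> A i"
      then obtain U where "U \<in> \<U> i" "x \<in> U" using cover by blast
      then obtain j where "j < card (\<U> i)" "x \<in> e i j" using e[OF i(1)] by auto
      then show "x \<in> (\<Union>x\<in>?J. case x of (i, j) \<Rightarrow> e i j)" using i by force
    qed
    show "0 \<le> \<delta>" by (rule \<delta>)
    fix x assume "x \<in> ?J"
    then show "bounded (case x of (i, j) \<Rightarrow> e i j) \<and> diameter (case x of (i, j) \<Rightarrow> e i j) \<le> \<delta>"
      using diam eU D by (fastforce intro: order_trans)
  next
    fix F assume F: "finite F" "F \<subseteq> ?J"
    let ?G = "fst ` F"
    have G: "finite ?G" "?G \<subseteq> I" using F by auto
    have "(\<Sum>x\<in>F. diam_power s (case x of (i, j) \<Rightarrow> e i j))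
        \<le> (\<Sum>x\<in>Sigma ?G (\<lambda>i. {..<card (\<U> i)}). diam_power s (case x of (i, j) \<Rightarrow> e i j))"
      using F by (intro sum_mono2) force+
    also have "\<dots> = (\<Sum>i\<in>?G. \<Sum>j<card (\<U> i). diam_power s (e i j))"
      using G sum.Sigma[of ?G "\<lambda>i. {..<card (\<U> i)}" "\<lambda>i j. diam_power s (e i j)"]
      by (simp add: split_beta)
    also have "\<dots> \<le> (\<Sum>i\<in>?G. ennreal (N i * D i powr s))"
    proof (rule sum_mono)
      fix i assume "i \<in> ?G"
      then have i: "i \<in> I" using G by blast
      have "(\<Sum>j<card (\<U> i). diam_power s (e i j)) \<le> (\<Sum>j<card (\<U> i). ennreal (D i powr s))"
        using diam[OF i] eU[OF i] by (intro sum_mono diam_power_le s) auto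
      also have "\<dots> = ennreal (real (card (\<U> i)) * D i powr s)"
        by (simp add: ennreal_mult' ennreal_of_nat_eq_real_of_nat)
      also have "\<dots> \<le> ennreal (N i * D i powr s)"
        using fin[OF i] by (intro ennreal_leI mult_right_mono) auto
      finally show "(\<Sum>j<card (\<U> i). diam_power s (e i j)) \<le> ennreal (N i * D i powr s)" .
    qed
    also have "\<dots> \<le> B" by (rule sums[OF G])
    finally show "(\<Sum>x\<in>F. diam_power s (case x of (i, j) \<Rightarrow> e i j)) \<le> B" .
  qed
qed

text \<open>
  The coordinate of \<open>y\<close> along the \<open>k\<close>-th singular vector lies in \<open>[-R, R]\<close>; this interval is cut into
  \<open>N k\<close> equal parts. The matrix stretches the \<open>k\<close>-th coordinate by the \<open>k\<close>-th singular value.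
\<close>

lemma grid_cover_linear_image:
  fixes T :: "real^'d^'d" and N :: "nat \<Rightarrow> nat"
  assumes R: "0 < R" and N': "\<forall>k<CARD('d). 1 \<le> N k"
  shows "\<exists>\<U>. finite \<U> \<and> card \<U> \<le> (\<Prod>k<CARD('d). N k) \<and>
    (\<lambda>y. p + T *v y) ` cball 0 R \<subseteq> \<Union>\<U> \<and>
    (\<forall>U\<in>\<U>. bounded U \<and>
       diameter U \<le> (\<Sum>k<CARD('d). singular_values T ! k * (2 * R / real (N k))))"
proof -
  have N: "1 \<le> N k" if "k < CARD('d)" for k using N' that by blast
  obtain v where v: "singular_basis T v" by (rule singular_basis_exists)
  let ?D = "\<Sum>k<CARD('d). singular_values T ! k * (2 * R / real (N k))"
  define lo where "lo k j = - R + real j * (2 * R / real (N k))" for k j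
  define piece where "piece g = (\<lambda>y. p + T *v y) `
      {y \<in> cball 0 R. \<forall>k<CARD('d). lo k (g k) \<le> y \<bullet> v k \<and> y \<bullet> v k \<le> lo k (g k) + 2 * R / real (N k)}" for g
  let ?G = "PiE {..<CARD('d)} (\<lambda>k. {..<N k})"
  have fin: "finite (piece ` ?G)" by (intro finite_imageI finite_PiE) auto
  have card: "card (piece ` ?G) \<le> (\<Prod>k<CARD('d). N k)"
    using card_image_le[of ?G piece] by (simp add: finite_PiE card_PiE)
  have cover: "(\<lambda>y. p + T *v y) ` cball 0 R \<subseteq> \<Union>(piece ` ?G)"
  proof safe
    fix y :: "real^'d" assume y: "y \<in> cball 0 R"
    (* The minimum puts the right end point y . v k = R into the last interval. *)
    define g where "g k = (if k < CARD('d) then min (N k - 1) (nat \<lfloor>(y \<bullet> v k + R) * real (N k) / (2 * R)\<rfloor>) else undefined)" for k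
    have "g \<in> ?G"
    proof (rule PiE_I)
      show "g k \<in> {..<N k}" if "k \<in> {..<CARD('d)}" for k
        using N[of k] that by (simp add: g_def min_less_iff_disj)
    qed (simp add: g_def)
    moreover have "lo k (g k) \<le> y \<bullet> v k \<and> y \<bullet> v k \<le> lo k (g k) + 2 * R / real (N k)"
      if k: "k < CARD('d)" for k
    proof -
      have yR: "\<bar>y \<bullet> v k\<bar> \<le> R"
        using Cauchy_Schwarz_ineq2[of y "v k"] norm_singular_basis(1)[OF v k] y by simp
      define t where "t = (y \<bullet> v k + R) * real (N k) / (2 * R)"
      have Nk: "1 \<le> real (N k)" using N[OF k] by simp
      have t0: "0 \<le> t" using yR R by (simp add: t_def abs_le_iff)
      have "t \<le> (2 * R) * real (N k) / (2 * R)"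
        unfolding t_def using yR R by (intro divide_right_mono mult_right_mono) (auto simp: abs_le_iff)
      then have t: "0 \<le> t" "t \<le> real (N k)" using R t0 by simp_all
      have yt: "y \<bullet> v k = - R + t * (2 * R / real (N k))"
        using R Nk by (simp add: t_def)
      have gk: "g k = min (N k - 1) (nat \<lfloor>t\<rfloor>)" using k by (simp add: g_def t_def)
      have g1: "real (g k) \<le> t" using t unfolding gk by linarith
      have g2: "t \<le> real (g k) + 1"
      proof (cases "N k - 1 \<le> nat \<lfloor>t\<rfloor>")
        case True
        then have "real (g k) + 1 = real (N k)" using N[OF k] by (simp add: gk min_def of_nat_diff)
        then show ?thesis using t by simp
      next
        case False
        then have "g k = nat \<lfloor>t\<rfloor>" by (simp add: gk min_def)
        then show ?thesis using t(1) by linarith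
      qed
      have w: "0 \<le> 2 * R / real (N k)" using R by simp
      show ?thesis
        using mult_right_mono[OF g1 w] mult_right_mono[OF g2 w]
        by (simp add: yt lo_def distrib_right add_divide_distrib)
    qed
    ultimately show "p + T *v y \<in> \<Union>(piece ` ?G)"
      using y by (auto simp: piece_def)
  qed
  have diam: "bounded U \<and> diameter U \<le> ?D" if U: "U \<in> piece ` ?G" for U
  proof
    obtain g where g: "U = piece g" using U by blast
    have "bounded ((\<lambda>y. p + T *v y) ` cball 0 R)"
      by (intro compact_imp_bounded compact_continuous_image continuous_intros compact_cball
          linear_continuous_on matrix_vector_mul_bounded_linear)
    then show "bounded U" by (rule bounded_subset) (auto simp: g piece_def)
    have D0: "0 \<le> ?D"
      using R by (intro sum_nonneg mult_nonneg_nonneg singular_value_nonneg) auto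
    show "diameter U \<le> ?D"
    proof (rule diameter_le)
      show "U \<noteq> {} \<or> 0 \<le> ?D" using D0 by simp
      fix a b assume "a \<in> U" "b \<in> U"
      then obtain x y where x: "a = p + T *v x" "\<forall>k<CARD('d). lo k (g k) \<le> x \<bullet> v k \<and> x \<bullet> v k \<le> lo k (g k) + 2 * R / real (N k)"
        and y: "b = p + T *v y" "\<forall>k<CARD('d). lo k (g k) \<le> y \<bullet> v k \<and> y \<bullet> v k \<le> lo k (g k) + 2 * R / real (N k)"
        by (auto simp: g piece_def)
      have "a - b = T *v (x - y)" by (simp add: x y matrix_vector_mult_diff_distrib)
      also have "\<dots> = T *v (\<Sum>k<CARD('d). ((x - y) \<bullet> v k) *\<^sub>R v k)"
        using singular_basis_expansion[OF v, of "x - y"] by simp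
      also have "\<dots> = (\<Sum>k<CARD('d). ((x - y) \<bullet> v k) *\<^sub>R (T *v v k))"
        by (simp add: linear_sum[OF matrix_vector_mul_linear] matrix_vector_mult_scaleR)
      finally have "norm (a - b) \<le> (\<Sum>k<CARD('d). \<bar>(x - y) \<bullet> v k\<bar> * norm (T *v v k))"
        using norm_sum[of "\<lambda>k. ((x - y) \<bullet> v k) *\<^sub>R (T *v v k)" "{..<CARD('d)}"] by simp
      also have "\<dots> \<le> ?D"
      proof (rule sum_mono)
        fix k assume k: "k \<in> {..<CARD('d)}"
        have "\<bar>(x - y) \<bullet> v k\<bar> \<le> 2 * R / real (N k)"
          using x(2)[rule_format, of k] y(2)[rule_format, of k] k
          by (simp add: inner_diff_left abs_le_iff)
        then show "\<bar>(x - y) \<bullet> v k\<bar> * norm (T *v v k) \<le> singular_values T ! k * (2 * R / real (N k))"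
          using norm_singular_basis(2)[OF v, of k] singular_value_nonneg[of k T] k
            mult_left_mono[of "\<bar>(x - y) \<bullet> v k\<bar>" "2 * R / real (N k)" "singular_values T ! k"]
          by (simp add: mult.commute)
      qed
      finally show "norm (a - b) \<le> ?D" .
    qed
  qed
  have "\<forall>U\<in>piece ` ?G. bounded U \<and> diameter U \<le> ?D" by (rule ballI) (rule diam)
  then show ?thesis
    by (intro exI[of _ "piece ` ?G"]) (rule conjI[OF fin conjI[OF card conjI[OF cover]]])
qed

text \<open>A ball is covered by \<open>n\<^sup>d\<close> sets of diameter at most \<open>C/n\<close>, and \<open>n\<^sup>d (C/n)\<^sup>s\<close> tends to \<open>0\<close> if \<open>s > d\<close>.\<close>

lemma hausdorff_dim_bounded_le:
  fixes A :: "(real^'d) set"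
  assumes "bounded A"
  shows "hausdorff_dim A \<le> ereal (real CARD('d))"
proof (rule ereal_le_epsilon2)
  fix \<epsilon> :: real assume \<epsilon>: "0 < \<epsilon>"
  let ?d = "CARD('d)"
  define s where "s = real ?d + \<epsilon>"
  obtain R where R: "0 < R" "A \<subseteq> cball 0 R"
    using assms unfolding bounded_pos by (auto simp: subset_iff)
  define C where "C = 2 * R * real ?d"
  have C: "0 < C" using R by (simp add: C_def)
  have "hausdorff_dim A \<le> ereal s"
  proof (rule hausdorff_dim_le)
    show "0 \<le> s" using \<epsilon> by (simp add: s_def)
    fix \<delta> e :: real assume \<delta>: "0 < \<delta>" and e: "0 < e"
    have "(\<lambda>n. C / real n) \<longlonglongrightarrow> 0" by (rule lim_const_over_n)
    moreover have "((\<lambda>n. C powr s * real n powr (- \<epsilon>)) \<longlongrightarrow> C powr s * 0) sequentially"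
      using \<epsilon> by (intro tendsto_intros tendsto_neg_powr filterlim_real_sequentially) auto
    ultimately have "\<forall>\<^sub>F n in sequentially. C / real n < \<delta> \<and> C powr s * real n powr (- \<epsilon>) < e \<and> 1 \<le> n"
      using \<delta> e by (intro eventually_conj order_tendstoD(2) eventually_ge_at_top) auto
    then obtain n where n: "C / real n < \<delta>" "C powr s * real n powr (- \<epsilon>) < e" "1 \<le> n"
      by (auto simp: eventually_sequentially)
    obtain \<U> where \<U>: "finite \<U>" "card \<U> \<le> (\<Prod>k<?d. n)"
      "(\<lambda>y. 0 + (mat 1 :: real^'d^'d) *v y) ` cball 0 R \<subseteq> \<Union>\<U>"
      "\<forall>U\<in>\<U>. bounded U \<and>
         diameter U \<le> (\<Sum>k<?d. singular_values (mat 1 :: real^'d^'d) ! k * (2 * R / real n))"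
      using grid_cover_linear_image[OF R(1), of "\<lambda>_. n" 0 "mat 1 :: real^'d^'d", OF allI[OF impI[OF n(3)]]]
      by (elim exE conjE)
    have sum_le: "(\<Sum>k<?d. singular_values (mat 1 :: real^'d^'d) ! k * (2 * R / real n)) \<le> C / real n"
    proof -
      have "(\<Sum>k<?d. singular_values (mat 1 :: real^'d^'d) ! k * (2 * R / real n)) \<le> (\<Sum>k<?d. 1 * (2 * R / real n))"
        using R by (intro sum_mono mult_right_mono singular_value_le) auto
      then show ?thesis by (simp add: C_def mult_ac)
    qed
    have "hausdorff_pre_measure s \<delta> A \<le> hausdorff_pre_measure s \<delta> (\<Union>i\<in>{()}. cball (0::real^'d) R)"
      by (rule hausdorff_pre_measure_mono) (use R in auto)
    also have "\<dots> \<le> ennreal e"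
    proof (rule hausdorff_pre_measure_le_finite_covers[where \<U>="\<lambda>_. \<U>" and N="\<lambda>_. real (n ^ ?d)" and D="\<lambda>_. C / real n"])
      show "0 < s" using \<epsilon> by (simp add: s_def add_nonneg_pos)
      show "0 \<le> \<delta>" using \<delta> by simp
      show "finite \<U> \<and> real (card \<U>) \<le> real (n ^ ?d)" using \<U>(1,2) by simp
      show "cball 0 R \<subseteq> \<Union>\<U>" using \<U>(3) by simp
      show "bounded U \<and> diameter U \<le> C / real n" if "U \<in> \<U>" for U
        using bspec[OF \<U>(4) that] sum_le by linarith
      show "C / real n \<le> \<delta>" using n by simp
      fix F :: "unit set"
      assume F: "finite F"
      have "real (n ^ ?d) * (C / real n) powr s = C powr s * (real n powr real ?d * real n powr (- s))"
        using n(3) C by (simp add: powr_divide powr_minus powr_realpow)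
          (simp add: divide_inverse)
      also have "\<dots> = C powr s * real n powr (- \<epsilon>)"
        by (simp add: s_def flip: powr_add)
      finally have eq: "real (n ^ ?d) * (C / real n) powr s < e" using n(2) by simp
      have "F = {} \<or> F = {()}" by auto
      then show "(\<Sum>i\<in>F. ennreal (real (n ^ ?d) * (C / real n) powr s)) \<le> ennreal e"
        using eq by (auto intro!: ennreal_leI)
    qed
    finally show "hausdorff_pre_measure s \<delta> A \<le> ennreal e" .
  qed
  then show "hausdorff_dim A \<le> ereal (real ?d) + ereal \<epsilon>" by (simp add: s_def)
qed

text \<open>
  With \<open>s = m + \<delta>\<close> as in the definition of \<open>\<phi>\<^sup>s\<close>, let \<open>\<gamma>\<close> be the singular value with (zero-based)
  index \<open>m\<close>. Cutting the \<open>k\<close>-th direction into about \<open>\<gamma>\<^sub>k/\<gamma>\<close> parts gives pieces of diameter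
  comparable to \<open>\<gamma>\<close>. Their number is comparable to the product of \<open>\<gamma>\<^sub>k/\<gamma>\<close> over \<open>k < m\<close>, and this number
  times \<open>\<gamma>\<^sup>s\<close> is \<open>\<phi>\<^sup>s(T)\<close>.
\<close>

lemma singular_value_function_cover:
  fixes T :: "real^'d^'d"
  assumes T: "invertible T" and R: "0 < R" and s: "0 < s" "s \<le> real CARD('d)"
    and a: "\<And>x. norm (T *v x) \<le> a * norm x"
  shows "\<exists>\<U> N D. finite \<U> \<and> real (card \<U>) \<le> N \<and>
    (\<lambda>y. p + T *v y) ` cball 0 R \<subseteq> \<Union>\<U> \<and>
    (\<forall>U\<in>\<U>. bounded U \<and> diameter U \<le> D) \<and>
    D \<le> 2 * R * real CARD('d) * a \<and>
    N * D powr s \<le> 2 ^ CARD('d) * (2 * R * real CARD('d)) powr s * singular_value_function s T"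
proof -
  define m where "m = nat (\<lceil>s\<rceil> - 1)"
  have m: "real m < s" "s \<le> real m + 1" "m < CARD('d)"
    using s unfolding m_def by linarith+
  let ?g = "\<lambda>k. singular_values T ! k"
  have gpos: "0 < ?g k" if "k < CARD('d)" for k by (rule singular_value_pos[OF T that])
  define N where "N k = nat \<lceil>?g k / ?g m\<rceil>" for k
  have Nge: "?g k / ?g m \<le> real (N k)" for k unfolding N_def by (rule real_nat_ceiling_ge)
  have N1: "1 \<le> N k" if k: "k < CARD('d)" for k
  proof -
    have "0 < ?g k / ?g m" using gpos[OF k] gpos[OF m(3)] by (rule divide_pos_pos)
    then have "0 < real (N k)" using Nge[of k] by (rule less_le_trans)
    then show ?thesis by simp
  qed
  have ceil_le: "real (nat \<lceil>x\<rceil>) \<le> 2 * x" if "1 \<le> x" for x :: real using that by linarith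
  have ceil_1: "nat \<lceil>x\<rceil> = 1" if "0 < x" "x \<le> 1" for x :: real using that by linarith
  have Nle: "real (N k) \<le> 2 * (?g k / ?g m)" if k: "k < m" for k
  proof -
    have "1 \<le> ?g k / ?g m"
      using singular_value_decreasing[of k m T] gpos[OF m(3)] k m(3) by simp
    then show ?thesis unfolding N_def by (rule ceil_le)
  qed
  have Neq: "N k = 1" if k: "m \<le> k" "k < CARD('d)" for k
    unfolding N_def
    using singular_value_decreasing[OF k, of T] gpos[OF m(3)] gpos[OF k(2)] by (intro ceil_1) simp_all
  define C where "C = 2 * R * real CARD('d)"
  have C: "0 < C" using R by (simp add: C_def)
  have "\<forall>k<CARD('d). 1 \<le> N k" using N1 by simp
  note grid = grid_cover_linear_image[OF R this, of p T]
  obtain \<U> where \<U>: "finite \<U>" "card \<U> \<le> (\<Prod>k<CARD('d). N k)"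
    "(\<lambda>y. p + T *v y) ` cball 0 R \<subseteq> \<Union>\<U>"
    "\<forall>U\<in>\<U>. bounded U \<and> diameter U \<le> (\<Sum>k<CARD('d). ?g k * (2 * R / real (N k)))"
    using grid by (elim exE conjE)
  have diam: "(\<Sum>k<CARD('d). ?g k * (2 * R / real (N k))) \<le> C * ?g m"
  proof -
    have "?g k * (2 * R / real (N k)) \<le> 2 * R * ?g m" if k: "k < CARD('d)" for k
    proof -
      have "?g k \<le> real (N k) * ?g m" using Nge[of k] gpos[OF m(3)] by (simp only: pos_divide_le_eq)
      then have "?g k * (2 * R / real (N k)) \<le> real (N k) * ?g m * (2 * R / real (N k))"
        using R by (intro mult_right_mono) simp_all
      also have "\<dots> = 2 * R * ?g m" using N1[OF k] by simp
      finally show ?thesis .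
    qed
    then have "(\<Sum>k<CARD('d). ?g k * (2 * R / real (N k))) \<le> (\<Sum>k<CARD('d). 2 * R * ?g m)"
      by (intro sum_mono) (simp only: lessThan_iff)
    then show ?thesis by (simp add: C_def mult_ac)
  qed
  have prodN: "(\<Prod>k<CARD('d). real (N k)) \<le> 2 ^ CARD('d) * ((\<Prod>k<m. ?g k) / ?g m ^ m)"
  proof -
    have pos: "0 \<le> (\<Prod>k<m. ?g k) / ?g m ^ m"
    proof (rule divide_nonneg_nonneg[OF prod_nonneg])
      show "0 \<le> ?g k" if "k \<in> {..<m}" for k
        using that m(3) by (intro singular_value_nonneg) simp
      show "0 \<le> ?g m ^ m" using gpos[OF m(3)] by simp
    qed
    have "(\<Prod>k<CARD('d). real (N k)) = (\<Prod>k<m. real (N k))"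
    proof (rule prod.mono_neutral_right)
      show "\<forall>i\<in>{..<CARD('d)} - {..<m}. real (N i) = 1"
      proof
        fix i assume "i \<in> {..<CARD('d)} - {..<m}"
        then have "m \<le> i" "i < CARD('d)" by auto
        then have "N i = 1" by (rule Neq)
        then show "real (N i) = 1" by simp
      qed
    qed (use m(3) in auto)
    also have "\<dots> \<le> (\<Prod>k<m. 2 * (?g k / ?g m))"
    proof (rule prod_mono)
      fix k assume "k \<in> {..<m}"
      then have "real (N k) \<le> 2 * (?g k / ?g m)" by (intro Nle) simp
      then show "0 \<le> real (N k) \<and> real (N k) \<le> 2 * (?g k / ?g m)" by (intro conjI of_nat_0_le_iff)
    qed
    also have "\<dots> = 2 ^ m * ((\<Prod>k<m. ?g k) / ?g m ^ m)"
      by (simp only: prod.distrib prod_dividef prod_constant card_lessThan)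
    also have "\<dots> \<le> 2 ^ CARD('d) * ((\<Prod>k<m. ?g k) / ?g m ^ m)"
    proof (rule mult_right_mono[OF _ pos])
      show "(2::real) ^ m \<le> 2 ^ CARD('d)" using m(3) by (intro power_increasing) auto
    qed
    finally show ?thesis .
  qed
  have svf: "singular_value_function s T = (\<Prod>k<m. ?g k) * ?g m powr (s - real m)"
  proof -
    have "(\<Prod>k<m. ?g k) = prod_list (take m (singular_values T))"
      using m(3) by (simp add: prod.list_conv_set_nth length_singular_values atLeast0LessThan min_def)
    then show ?thesis using s by (simp add: singular_value_function_def m_def[symmetric] Let_def)
  qed
  have card: "real (card \<U>) \<le> (\<Prod>k<CARD('d). real (N k))"
    using \<U>(2) by (simp flip: of_nat_prod)
  have diams: "\<forall>U\<in>\<U>. bounded U \<and> diameter U \<le> C * ?g m"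
  proof
    fix U assume "U \<in> \<U>"
    then show "bounded U \<and> diameter U \<le> C * ?g m" using bspec[OF \<U>(4)] diam by (meson order_trans)
  qed
  have small: "C * ?g m \<le> 2 * R * real CARD('d) * a"
    using singular_value_le[OF a m(3)] C unfolding C_def by (intro mult_left_mono) auto
  have "(\<Prod>k<CARD('d). real (N k)) * (C * ?g m) powr s
     \<le> 2 ^ CARD('d) * ((\<Prod>k<m. ?g k) / ?g m ^ m) * (C * ?g m) powr s"
    by (intro mult_right_mono prodN) simp
  also have "\<dots> = 2 ^ CARD('d) * C powr s * ((\<Prod>k<m. ?g k) * (?g m powr s / ?g m ^ m))"
    using C gpos[OF m(3)] by (simp add: powr_mult)
  also have "?g m powr s / ?g m ^ m = ?g m powr (s - real m)"
    using gpos[OF m(3)] by (simp add: powr_diff powr_realpow)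
  finally have total: "(\<Prod>k<CARD('d). real (N k)) * (C * ?g m) powr s
     \<le> 2 ^ CARD('d) * (2 * R * real CARD('d)) powr s * singular_value_function s T"
    by (simp add: svf C_def)
  show ?thesis
    by (rule exI[of _ \<U>], rule exI[of _ "\<Prod>k<CARD('d). real (N k)"], rule exI[of _ "C * ?g m"])
      (rule conjI[OF \<U>(1) conjI[OF card conjI[OF \<U>(3) conjI[OF diams conjI[OF small total]]]]])
qed

lemma ennreal_inverse_antimono:
  fixes a b :: ennreal
  assumes "a \<le> b" shows "inverse b \<le> inverse a"
proof (cases "b = \<infinity> \<or> a = 0")
  case False
  then obtain y where y: "b = ennreal y" "0 \<le> y" by (cases b) auto
  then obtain x where x: "a = ennreal x" "0 \<le> x" using assms by (cases a) (auto simp: top_unique)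
  have "0 < x" "x \<le> y" using False assms x y by auto
  then show ?thesis by (simp add: x y inverse_ennreal ennreal_leI le_imp_inverse_le)
qed auto

text \<open>
  Markov's inequality for the kernel of the energy. For \<open>r = 0\<close> it says that \<open>B\<close> is a null set,
  since the kernel is infinite on \<open>B\<close>.
\<close>

lemma emeasure_le_of_energy_bound:
  assumes B: "B \<in> sets M" and f: "f \<in> borel_measurable M"
    and r: "0 \<le> r" and s: "0 < s" and le: "\<And>y. y \<in> B \<Longrightarrow> 0 \<le> f y \<and> f y \<le> r"
    and energy: "(\<integral>\<^sup>+y. inverse (ennreal (f y powr s)) \<partial>M) \<le> ennreal K"
  shows "emeasure M B \<le> ennreal K * ennreal (r powr s)"
proof -
  have "inverse (ennreal (r powr s)) * emeasure M B = (\<integral>\<^sup>+y. inverse (ennreal (r powr s)) * indicator B y \<partial>M)"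
    using B by (simp add: nn_integral_cmult_indicator)
  also have "\<dots> \<le> (\<integral>\<^sup>+y. inverse (ennreal (f y powr s)) \<partial>M)"
  proof (rule nn_integral_mono)
    fix y assume "y \<in> space M"
    show "inverse (ennreal (r powr s)) * indicator B y \<le> inverse (ennreal (f y powr s))"
    proof (cases "y \<in> B")
      case True
      then have "ennreal (f y powr s) \<le> ennreal (r powr s)"
        using le[OF True] s by (intro ennreal_leI powr_mono2) auto
      then have "inverse (ennreal (r powr s)) \<le> inverse (ennreal (f y powr s))"
        by (rule ennreal_inverse_antimono)
      then show ?thesis using True by simp
    qed simp
  qed
  also note energy
  finally have *: "inverse (ennreal (r powr s)) * emeasure M B \<le> ennreal K" .
  show ?thesis
  proof (cases "r = 0")
    case True
    have "emeasure M B = 0"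
    proof (rule ccontr)
      assume "emeasure M B \<noteq> 0"
      then have "inverse (ennreal (r powr s)) * emeasure M B = \<infinity>"
        using True by (simp add: ennreal_top_mult)
      with * show False by (simp add: top_unique)
    qed
    then show ?thesis by simp
  next
    case False
    then have p: "0 < r powr s" using r by simp
    have "emeasure M B = ennreal (r powr s) * (inverse (ennreal (r powr s)) * emeasure M B)"
      using p by (simp add: mult.assoc[symmetric] inverse_ennreal ennreal_mult'[symmetric])
    also have "\<dots> \<le> ennreal (r powr s) * ennreal K" by (intro mult_left_mono *) simp
    finally show ?thesis by (simp add: mult.commute)
  qed
qed

text \<open>
  The potential of the image measure is finite almost everywhere, hence bounded by some \<open>n\<close> on a set
  \<open>A n\<close> of positive measure. If a set \<open>U\<close> of diameter \<open>r \<le> 1\<close> contains the image of a point of \<open>A n\<close>,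
  then \<open>U\<close> lies in the closed ball of radius \<open>r\<close> about this image, whose mass is at most \<open>n r\<^sup>s\<close>. For
  \<open>u < s\<close>, every cover by sets of diameter at most \<open>1\<close> therefore has a diameter sum to the power \<open>u\<close> of
  at least the measure of \<open>A n\<close> divided by \<open>n\<close>.
\<close>

lemma hausdorff_dim_ge_energy:
  fixes g :: "'b \<Rightarrow> 'a::euclidean_space"
  assumes "prob_space M" and g[measurable]: "g \<in> borel_measurable M" and s: "0 < s"
    and energy: "(\<integral>\<^sup>+x. \<integral>\<^sup>+y. inverse (ennreal (dist (g x) (g y) powr s)) \<partial>M \<partial>M) < \<infinity>"
    and G: "AE x in M. x \<in> G"
  shows "ereal s \<le> hausdorff_dim (g ` G)"
proof -
  interpret prob_space M by fact
  define pot where "pot x = (\<integral>\<^sup>+y. inverse (ennreal (dist (g x) (g y) powr s)) \<partial>M)" for x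
  have pot_meas[measurable]: "pot \<in> borel_measurable M" unfolding pot_def by measurable
  have "AE x in M. pot x \<noteq> \<infinity>"
    using energy pot_meas unfolding pot_def[symmetric] by (intro nn_integral_noteq_infinite) auto
  define A where "A n = {x\<in>space M. pot x \<le> ennreal (real n)}" for n :: nat
  have A_sets[measurable]: "A n \<in> sets M" for n unfolding A_def by measurable
  have "\<exists>n. emeasure M (A n) \<noteq> 0"
  proof (rule ccontr)
    assume "\<not> ?thesis"
    then have "(\<Union>n. A n) \<in> null_sets M" by (intro null_sets_UN) auto
    then have "AE x in M. x \<notin> (\<Union>n. A n)" by (rule AE_not_in)
    then have "AE x in M. False"
      using \<open>AE x in M. pot x \<noteq> \<infinity>\<close> AE_space
    proof eventually_elim
      case (elim x)
      then obtain n :: nat where "pot x < of_nat n"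
        using ennreal_Ex_less_of_nat[of "pot x"] by (auto simp: less_top)
      then have "x \<in> A n" using elim(3) by (simp add: A_def ennreal_of_nat_eq_real_of_nat less_imp_le)
      then show False using elim(1) by blast
    qed
    then show False by simp
  qed
  then obtain n where n: "emeasure M (A n) \<noteq> 0" by blast
  have lower: "hausdorff_measure u (g ` G) \<noteq> 0" if u: "0 \<le> u" "u < s" for u
  proof
    assume "hausdorff_measure u (g ` G) = 0"
    then have pre0: "hausdorff_pre_measure u 1 (g ` G) = 0"
      unfolding hausdorff_measure_def by (metis SUP_upper greaterThan_iff le_zero_eq zero_less_one)
    have "emeasure M (A n) \<le> 0"
    proof (rule ennreal_le_epsilon)
      fix \<epsilon> :: real assume \<epsilon>: "0 < \<epsilon>"
      define e where "e = \<epsilon> / (real n + 1)"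
      have e: "0 < e" "real n * e \<le> \<epsilon>" using \<epsilon> by (auto simp: e_def field_simps)
      have "hausdorff_pre_measure u 1 (g ` G) < ennreal e" using pre0 e by simp
      then obtain U where U: "g ` G \<subseteq> (\<Union>i. U i)" "\<And>i. bounded (U i)" "\<And>i. diameter (U i) \<le> 1"
        "(\<Sum>i. diam_power u (U i)) < ennreal e"
        unfolding hausdorff_pre_measure_def INF_less_iff by blast
      have "\<exists>B\<in>sets M. {x\<in>A n. g x \<in> U i} \<subseteq> B \<and> emeasure M B \<le> ennreal (real n) * diam_power u (U i)" for i
      proof (cases "{x\<in>A n. g x \<in> U i} = {}")
        case True
        then show ?thesis by (intro bexI[of _ "{}"]) auto
      next
        case False
        then obtain x0 where x0: "x0 \<in> A n" "g x0 \<in> U i" by blast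
        define r where "r = diameter (U i)"
        have r: "0 \<le> r" "r \<le> 1" using U(2,3) diameter_ge_0 by (auto simp: r_def)
        define B where "B = {y\<in>space M. dist (g x0) (g y) \<le> r}"
        have B_sets: "B \<in> sets M" unfolding B_def by measurable
        have sub: "{x\<in>A n. g x \<in> U i} \<subseteq> B"
          using x0 U(2) by (auto simp: B_def A_def r_def intro: diameter_bounded_bound)
        have mass: "emeasure M B \<le> ennreal (real n) * ennreal (r powr s)"
        proof (rule emeasure_le_of_energy_bound[where f="\<lambda>y. dist (g x0) (g y)"])
          show "(\<integral>\<^sup>+ y. inverse (ennreal (dist (g x0) (g y) powr s)) \<partial>M) \<le> ennreal (real n)"
            using x0(1) by (simp add: A_def pot_def)
        qed (use B_sets r s in \<open>auto simp: B_def\<close>)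
        have dp: "ennreal (r powr s) \<le> diam_power u (U i)"
        proof (cases "u = 0")
          case True
          have "r powr s \<le> 1" using r s by (simp add: powr_le1)
          then show ?thesis using True x0 by (auto simp: diam_power_def)
        next
          case False
          have "r powr s \<le> r powr u" using r u by (cases "r = 0") (auto intro: powr_mono')
          then show ?thesis using False x0 by (auto simp: diam_power_def r_def ennreal_leI)
        qed
        have "emeasure M B \<le> ennreal (real n) * diam_power u (U i)"
          by (rule order_trans[OF mass mult_left_mono[OF dp]]) simp
        with B_sets sub show ?thesis by blast
      qed
      then obtain B where B: "\<And>i. B i \<in> sets M" "\<And>i. {x\<in>A n. g x \<in> U i} \<subseteq> B i"
        "\<And>i. emeasure M (B i) \<le> ennreal (real n) * diam_power u (U i)" by metis
      have "emeasure M (A n) \<le> emeasure M (\<Union>i. B i)"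
      proof (rule emeasure_mono_AE)
        show "AE x in M. x \<in> A n \<longrightarrow> x \<in> (\<Union>i. B i)"
          using G
        proof eventually_elim
          case (elim x)
          then have "\<exists>i. g x \<in> U i" using U(1) by blast
          then show ?case using B(2) by blast
        qed
      qed (use B(1) in auto)
      also have "\<dots> \<le> (\<Sum>i. emeasure M (B i))"
        using B(1) by (intro emeasure_subadditive_countably) auto
      also have "\<dots> \<le> (\<Sum>i. ennreal (real n) * diam_power u (U i))"
        by (intro suminf_le B(3)) auto
      also have "\<dots> = ennreal (real n) * (\<Sum>i. diam_power u (U i))" by simp
      also have "\<dots> \<le> ennreal (real n) * ennreal e" using U(4) by (intro mult_left_mono) auto
      also have "\<dots> \<le> ennreal \<epsilon>" using e by (simp add: ennreal_mult'[symmetric] ennreal_leI)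
      finally show "emeasure M (A n) \<le> 0 + ennreal \<epsilon>" by simp
    qed
    then show False using n by simp
  qed
  show ?thesis
    unfolding hausdorff_dim_def
  proof (rule INF_greatest)
    fix u assume "u \<in> {u. 0 \<le> u \<and> hausdorff_measure u (g ` G) = 0}"
    then show "ereal s \<le> ereal u" using lower[of u] by (cases "u < s") auto
  qed
qed

section \<open>A Frostman measure on words over a finite alphabet\<close>

text \<open>
  The word \<open>u \<kappa>\<^sub>0 x\<^sub>0 \<kappa>\<^sub>1 x\<^sub>1 \<dots> \<kappa>\<^sub>k\<^sub>-\<^sub>1 x\<^sub>k\<^sub>-\<^sub>1\<close>, where the connecting word \<open>\<kappa>\<^sub>i\<close> may depend on the word built
  so far and on the block \<open>x\<^sub>i\<close>.
\<close>

primrec block_word :: "(nat list \<Rightarrow> nat list \<Rightarrow> nat list) \<Rightarrow> nat list \<Rightarrow> (nat \<Rightarrow> nat list) \<Rightarrow> nat \<Rightarrow> nat list" where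
  "block_word \<kappa> u x 0 = u"
| "block_word \<kappa> u x (Suc k) = block_word \<kappa> u x k @ \<kappa> (block_word \<kappa> u x k) (x k) @ x k"

text \<open>The Markov property of the construction.\<close>

lemma block_word_case_nat:
  "block_word \<kappa> u (case_nat w x) (Suc k) = block_word \<kappa> (u @ \<kappa> u w @ w) x k"
  by (induction k) auto

lemma prefix_block_word: "j \<le> k \<Longrightarrow> prefix (block_word \<kappa> u x j) (block_word \<kappa> u x k)"
proof (induction k)
  case (Suc k)
  then show ?case
    by (cases "j = Suc k") (auto intro: prefix_order.trans)
qed simp

lemma length_block_word:
  assumes "\<And>i. x i \<noteq> []" shows "k \<le> length (block_word \<kappa> u x k)"
proof (induction k)
  case (Suc k)
  then show ?case using assms[of k] by (cases "x k") auto
qed simp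

lemma set_block_word: "set (block_word \<kappa> u x k) \<subseteq> set u \<union> (\<Union>i<k. set (x i) \<union> set (\<kappa> (block_word \<kappa> u x i) (x i)))"
proof (induction k)
  case (Suc k)
  then show ?case by (auto simp: lessThan_Suc)
qed simp

text \<open>
  The measure is the distribution of the infinite word built from independent blocks in a finite set
  \<open>W\<close> of words of one length, a block \<open>w\<close> having probability \<open>\<phi> w / S\<close>, where \<open>S\<close> is the sum of \<open>\<phi>\<close>
  over \<open>W\<close>. Let \<open>R u v\<close> be the probability that the word built from the initial word \<open>u\<close> begins with
  \<open>v\<close>. Then \<open>R u v \<le> C \<phi> v / \<phi> u\<close> for every prefix \<open>u\<close> of \<open>v\<close>, by induction on
  \<open>length v - length u\<close>, distinguishing how the first block \<open>w\<close> and its connecting word continue \<open>u\<close>: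

  \<^item> They stay inside \<open>v\<close>. Then \<open>v\<close> and the connecting word determine \<open>w\<close>, so there are at most as many
    blocks of this kind as connecting words. Each contributes at most \<open>(c/S) C \<phi> v / \<phi> u\<close> by induction
    and quasi-multiplicativity, and \<open>S\<close> is so large that this adds up to at most half of the bound.

  \<^item> They extend beyond \<open>v\<close>. Then \<open>v\<close> arises from \<open>u\<close> by appending one of finitely many words, so
    \<open>\<phi> v / \<phi> u\<close> is bounded from below, and the total probability \<open>1\<close> is at most the other half.
\<close>

lemma exists_word_measure:
  fixes \<phi> :: "nat list \<Rightarrow> real"
  assumes quasi: "quasi_multiplicative \<phi>" and \<phi>: "\<And>\<omega>. 0 < \<phi> \<omega>" and \<phi>_Nil: "\<phi> [] = 1"
    and ext: "\<And>w. \<exists>b>0. \<forall>u. \<phi> u * b \<le> \<phi> (u @ w)"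
    and large: "\<And>K. \<exists>n\<ge>1. ennreal K < word_sum \<phi> n"
  shows "\<exists>I \<mu> C. finite I \<and> prob_space \<mu> \<and> sets \<mu> = sets (PiM UNIV (\<lambda>_::nat. count_space (UNIV :: nat set))) \<and>
    (AE \<omega> in \<mu>. range \<omega> \<subseteq> I) \<and> 0 < C \<and>
    (\<forall>v. emeasure \<mu> {\<omega>. map \<omega> [0..<length v] = v} \<le> ennreal (C * \<phi> v))"
proof -
  obtain c \<Gamma> where c: "1 \<le> c" and \<Gamma>: "finite \<Gamma>" and qm':
    "\<forall>\<omega> \<tau>. \<omega> \<noteq> [] \<longrightarrow> \<tau> \<noteq> [] \<longrightarrow> (\<exists>\<kappa>\<in>\<Gamma>. \<phi> \<omega> * \<phi> \<tau> \<le> c * \<phi> (\<omega> @ \<kappa> @ \<tau>))"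
    using quasi unfolding quasi_multiplicative_def by (elim exE conjE)
  have qm: "\<exists>\<kappa>\<in>\<Gamma>. \<phi> \<omega> * \<phi> \<tau> \<le> c * \<phi> (\<omega> @ \<kappa> @ \<tau>)" if "\<omega> \<noteq> []" "\<tau> \<noteq> []" for \<omega> \<tau>
    using qm' that by simp
  (* With the empty connecting word, the construction can start from the empty word. *)
  define \<Gamma>' where "\<Gamma>' = insert [] \<Gamma>"
  have \<Gamma>': "finite \<Gamma>'" using \<Gamma> by (simp add: \<Gamma>'_def)
  have "\<exists>k\<in>\<Gamma>'. w \<noteq> [] \<longrightarrow> \<phi> u * \<phi> w \<le> c * \<phi> (u @ k @ w)" for u w
  proof (cases "u = []")
    case True
    have "1 * \<phi> w \<le> c * \<phi> w" using c \<phi>[of w] by (intro mult_right_mono) auto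
    then show ?thesis using True by (intro bexI[of _ "[]"]) (auto simp: \<phi>_Nil \<Gamma>'_def)
  next
    case False
    then show ?thesis using qm[OF False, of w] by (auto simp: \<Gamma>'_def)
  qed
  then have ex: "\<exists>k. k \<in> \<Gamma>' \<and> (w \<noteq> [] \<longrightarrow> \<phi> u * \<phi> w \<le> c * \<phi> (u @ k @ w))" for u w
    by blast
  define \<kappa> where "\<kappa> u w = (SOME k. k \<in> \<Gamma>' \<and> (w \<noteq> [] \<longrightarrow> \<phi> u * \<phi> w \<le> c * \<phi> (u @ k @ w)))" for u w
  have \<kappa>: "\<kappa> u w \<in> \<Gamma>'" "w \<noteq> [] \<Longrightarrow> \<phi> u * \<phi> w \<le> c * \<phi> (u @ \<kappa> u w @ w)" for u w
    using someI_ex[OF ex[of w u]] unfolding \<kappa>_def[symmetric] by blast+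
  obtain n where n: "1 \<le> n" "ennreal (2 * c * real (card \<Gamma>')) < word_sum \<phi> n"
    using large[of "2 * c * real (card \<Gamma>')"] by (elim exE conjE)
  obtain W where W: "finite W" "W \<subseteq> {\<omega>. length \<omega> = n}"
    "ennreal (2 * c * real (card \<Gamma>')) < (\<Sum>\<omega>\<in>W. ennreal (\<phi> \<omega>))"
    using word_sum_greaterE[OF n(2)] by blast
  define S where "S = (\<Sum>\<omega>\<in>W. \<phi> \<omega>)"
  have \<phi>0: "0 \<le> \<phi> w" for w using \<phi>[of w] by simp
  have cardG: "1 \<le> card \<Gamma>'" using \<Gamma>' by (simp add: Suc_le_eq card_gt_0_iff \<Gamma>'_def)
  have S_large: "2 * c * real (card \<Gamma>') < S"
  proof -
    have "(\<Sum>\<omega>\<in>W. ennreal (\<phi> \<omega>)) = ennreal S" unfolding S_def by (rule sum_ennreal) (rule \<phi>0)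
    moreover have "0 \<le> 2 * c * real (card \<Gamma>')" using c by simp
    ultimately show ?thesis using W(3) by (simp only: ennreal_less_iff)
  qed
  have S0: "0 < S" 
  proof -
    have "0 \<le> 2 * c * real (card \<Gamma>')" using c by simp
    then show ?thesis using S_large by linarith
  qed
  define p where "p w = \<phi> w / S" for w
  have p0: "0 \<le> p w" for w using \<phi>0[of w] S0 by (simp add: p_def)
  have p_sum: "(\<Sum>w\<in>W. p w) = 1" using S0 by (simp add: p_def S_def flip: sum_divide_distrib)
  define M where "M = point_measure W (\<lambda>w. ennreal (p w))"
  have spM: "space M = W" by (simp add: M_def space_point_measure)
  interpret M: prob_space M
    by (rule prob_spaceI) (simp add: spM, simp add: M_def W emeasure_point_measure_finite p0 p_sum)
  interpret seq: sequence_space M by standard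
  let ?S = "PiM (UNIV :: nat set) (\<lambda>_. M)"
  have Wne: "w \<noteq> []" "length w = n" if "w \<in> W" for w using that W n by auto
  have xW: "x i \<in> W" if "x \<in> space ?S" for x i
    using that by (auto simp: space_PiM spM PiE_iff)
  let ?node = "block_word \<kappa>"
  have node_meas: "(\<lambda>x. ?node u x k) \<in> measurable ?S (count_space UNIV)" for u k
  proof (induction k)
    case (Suc k)
    show ?case
    proof (simp, rule measurable_compose_countable[OF _ Suc, of "\<lambda>l x. l @ \<kappa> l (x k) @ x k"])
      fix l :: "nat list"
      have "(\<lambda>w. l @ \<kappa> l w @ w) \<in> measurable M (count_space UNIV)" by (simp add: M_def)
      then show "(\<lambda>x. l @ \<kappa> l (x k) @ x k) \<in> measurable ?S (count_space UNIV)"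
        by (rule measurable_compose[OF measurable_component_singleton, rotated]) simp
    qed
  qed simp
  (* Quantifying over all stages, instead of fixing one long enough to cover v, makes the event
     compatible with dropping the first block. *)
  define E where "E u v = {x\<in>space ?S. \<exists>k. prefix v (?node u x k)}" for u v
  have E_sets: "E u v \<in> sets ?S" for u v
  proof -
    have "E u v = (\<Union>k. (\<lambda>x. ?node u x k) -` {l. prefix v l} \<inter> space ?S)" by (auto simp: E_def)
    also have "\<dots> \<in> sets ?S"
      by (intro sets.countable_UN image_subsetI measurable_sets[OF node_meas]) auto
    finally show ?thesis .
  qed
  define R where "R u v = emeasure ?S (E u v)" for u v
  have R_le_1: "R u v \<le> 1" for u v unfolding R_def by (rule seq.P.emeasure_le_1)
  have R_step: "R u v = (\<Sum>w\<in>W. ennreal (p w) * R (u @ \<kappa> u w @ w) v)" for u v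
  proof -
    let ?h = "\<lambda>(w, x). case_nat w x :: nat \<Rightarrow> nat list"
    have h_meas: "?h \<in> measurable (M \<Otimes>\<^sub>M ?S) ?S" by measurable
    have "R u v = emeasure (distr (M \<Otimes>\<^sub>M ?S) ?S ?h) (E u v)"
      by (simp add: R_def seq.PiM_iter)
    also have "\<dots> = emeasure (M \<Otimes>\<^sub>M ?S) (?h -` E u v \<inter> space (M \<Otimes>\<^sub>M ?S))"
      by (rule emeasure_distr[OF h_meas E_sets])
    also have "\<dots> = (\<integral>\<^sup>+w. emeasure ?S (Pair w -` (?h -` E u v \<inter> space (M \<Otimes>\<^sub>M ?S))) \<partial>M)"
      by (rule seq.P.emeasure_pair_measure_alt) (rule measurable_sets[OF h_meas E_sets])
    also have "\<dots> = (\<integral>\<^sup>+w. R (u @ \<kappa> u w @ w) v \<partial>M)"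
    proof (rule nn_integral_cong)
      fix w assume w: "w \<in> space M"
      have "case_nat w x \<in> E u v \<longleftrightarrow> x \<in> E (u @ \<kappa> u w @ w) v" if x: "x \<in> space ?S" for x
      proof -
        have sp: "case_nat w x \<in> space ?S"
          using w x by (auto simp: space_PiM PiE_iff split: nat.split)
        have "(\<exists>k. prefix v (?node u (case_nat w x) k)) \<longleftrightarrow> (\<exists>k. prefix v (?node u (case_nat w x) (Suc k)))"
          using prefix_block_word[of _ "Suc _" \<kappa> u "case_nat w x"] prefix_order.trans
          by (metis le_SucI order_refl)
        then show ?thesis using sp x by (simp only: E_def mem_Collect_eq block_word_case_nat simp_thms)
      qed
      then have "Pair w -` (?h -` E u v \<inter> space (M \<Otimes>\<^sub>M ?S)) = E (u @ \<kappa> u w @ w) v"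
        using w by (auto simp: space_pair_measure E_def)
      then show "emeasure ?S (Pair w -` (?h -` E u v \<inter> space (M \<Otimes>\<^sub>M ?S))) = R (u @ \<kappa> u w @ w) v"
        by (simp add: R_def)
    qed
    also have "\<dots> = (\<Sum>w\<in>W. ennreal (p w) * R (u @ \<kappa> u w @ w) v)"
      unfolding M_def by (rule nn_integral_point_measure_finite[OF W(1)])
    finally show ?thesis .
  qed
  have R_0: "R u v = 0" if "\<not> prefix u v" "\<not> prefix v u" for u v
  proof -
    have "E u v = {}"
    proof (rule ccontr)
      assume "E u v \<noteq> {}"
      then obtain x k where "prefix v (?node u x k)" by (auto simp: E_def)
      moreover have "prefix u (?node u x k)" using prefix_block_word[of 0 k \<kappa> u x] by simp
      ultimately show False using that prefix_same_cases by blast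
    qed
    then show ?thesis by (simp add: R_def)
  qed
  (* The words by which v can extend u if the first step already leads beyond v. *)
  define X where "X = (\<Union>k\<in>\<Gamma>'. \<Union>w\<in>W. set (prefixes (k @ w)))"
  have X: "finite X" using \<Gamma>' W(1) by (simp add: X_def)
  obtain b where b: "\<And>w. 0 < b w" "\<And>w u. \<phi> u * b w \<le> \<phi> (u @ w)" using ext by metis
  define \<beta> where "\<beta> = Min (insert 1 (b ` X))"
  have \<beta>: "0 < \<beta>" "\<beta> \<le> 1" "\<And>x. x \<in> X \<Longrightarrow> \<beta> \<le> b x"
    using X b(1) by (auto simp: \<beta>_def Min_gr_iff)
  define C where "C = 2 / \<beta>"
  have C: "0 < C" "1 \<le> C" "1 / \<beta> = C / 2" using \<beta> by (auto simp: C_def)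
  have bound: "R u v \<le> ennreal (C * \<phi> v / \<phi> u)" if "prefix u v" for u v
    using that
  proof (induction "length v - length u" arbitrary: u rule: less_induct)
    case less
    show ?case
    proof (cases "u = v")
      case True
      have "R u v \<le> ennreal 1" using R_le_1 by simp
      also have "\<dots> \<le> ennreal (C * \<phi> v / \<phi> u)" using C \<phi>[of v] True by (intro ennreal_leI) simp
      finally show ?thesis .
    next
      case False
      then have len: "length u < length v" using less.prems
        by (meson linorder_neqE_nat not_less_iff_gr_or_eq prefix_length_less strict_prefix_def)
      let ?st = "\<lambda>w. u @ \<kappa> u w @ w"
      let ?q = "\<phi> v / \<phi> u"
      have q: "0 < ?q" using \<phi> by simp
      (* W1: the first step stays inside v; W2: it leads beyond v; otherwise v is not reached. *)
      define W1 where "W1 = {w\<in>W. prefix (?st w) v}"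
      define W2 where "W2 = {w\<in>W. \<not> prefix (?st w) v \<and> prefix v (?st w)}"
      have fin: "finite W1" "finite W2" using W(1) by (auto simp: W1_def W2_def)
      have "R u v = (\<Sum>w\<in>W. ennreal (p w) * R (?st w) v)" by (rule R_step)
      also have "\<dots> = (\<Sum>w\<in>W1 \<union> W2. ennreal (p w) * R (?st w) v)"
        by (rule sum.mono_neutral_right) (use W(1) R_0 in \<open>auto simp: W1_def W2_def\<close>)
      also have "\<dots> = (\<Sum>w\<in>W1. ennreal (p w) * R (?st w) v) + (\<Sum>w\<in>W2. ennreal (p w) * R (?st w) v)"
        by (rule sum.union_disjoint[OF fin]) (auto simp: W1_def W2_def)
      also have "(\<Sum>w\<in>W1. ennreal (p w) * R (?st w) v) \<le> ennreal (C / 2 * ?q)"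
      proof -
        have each: "ennreal (p w) * R (?st w) v \<le> ennreal (C * c / S * ?q)" if w: "w \<in> W1" for w
        proof -
          have wW: "w \<in> W" "prefix (?st w) v" using w by (auto simp: W1_def)
          have "length v - length (?st w) < length v - length u"
            using Wne[OF wW(1)] n(1) len by simp
          then have "R (?st w) v \<le> ennreal (C * \<phi> v / \<phi> (?st w))"
            using less.hyps wW(2) by blast
          then have "ennreal (p w) * R (?st w) v \<le> ennreal (p w) * ennreal (C * \<phi> v / \<phi> (?st w))"
            by (rule mult_left_mono) simp
          also have "\<dots> = ennreal (p w * (C * \<phi> v / \<phi> (?st w)))"
            by (rule ennreal_mult'[OF p0, symmetric])
          also have "\<dots> \<le> ennreal (C * c / S * ?q)"
          proof (rule ennreal_leI)
            have "\<phi> w / \<phi> (?st w) \<le> c / \<phi> u"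
              using \<kappa>(2)[OF Wne(1)[OF wW(1)], of u] \<phi>[of u] \<phi>[of "?st w"] by (simp add: field_simps)
            then have "(C * \<phi> v / S) * (\<phi> w / \<phi> (?st w)) \<le> (C * \<phi> v / S) * (c / \<phi> u)"
              using C(1) \<phi>0[of v] S0 by (intro mult_left_mono) auto
            then show "p w * (C * \<phi> v / \<phi> (?st w)) \<le> C * c / S * ?q"
              by (simp add: p_def mult_ac)
          qed
          finally show ?thesis .
        qed
        have "card W1 \<le> card \<Gamma>'"
        proof (rule card_inj_on_le[of "\<lambda>w. \<kappa> u w"])
          show "inj_on (\<lambda>w. \<kappa> u w) W1"
          proof (rule inj_onI)
            fix w w' assume a: "w \<in> W1" "w' \<in> W1" "\<kappa> u w = \<kappa> u w'"
            then have "prefix (?st w) v" "prefix (?st w') v" "length w = n" "length w' = n"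
              using Wne by (auto simp: W1_def)
            then show "w = w'" using a(3) by (auto simp: prefix_def)
          qed
        qed (use \<kappa>(1) \<Gamma>' in auto)
        then have card: "real (card W1) \<le> real (card \<Gamma>')" by simp
        have "(\<Sum>w\<in>W1. ennreal (p w) * R (?st w) v) \<le> (\<Sum>w\<in>W1. ennreal (C * c / S * ?q))"
          by (rule sum_mono) (rule each)
        also have "\<dots> = ennreal (real (card W1) * (C * c / S * ?q))"
          by (simp only: sum_constant ennreal_of_nat_eq_real_of_nat ennreal_mult'[OF of_nat_0_le_iff])
        also have "\<dots> \<le> ennreal (C / 2 * ?q)"
        proof (rule ennreal_leI)
          have "real (card W1) * c / S \<le> real (card \<Gamma>') * c / S"
            using card c S0 by (intro divide_right_mono mult_right_mono) auto
          also have "\<dots> \<le> 1 / 2" using S_large S0 by (simp add: divide_le_eq mult_ac)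
          finally have "(real (card W1) * c / S) * (C * ?q) \<le> (1 / 2) * (C * ?q)"
            by (rule mult_right_mono[OF _ less_imp_le[OF mult_pos_pos[OF C(1) q]]])
          then show "real (card W1) * (C * c / S * ?q) \<le> C / 2 * ?q" by (simp add: mult_ac)
        qed
        finally show ?thesis .
      qed
      also have "(\<Sum>w\<in>W2. ennreal (p w) * R (?st w) v) \<le> ennreal (C / 2 * ?q)"
      proof (cases "W2 = {}")
        case False
        then obtain w where w: "w \<in> W" "prefix v (?st w)" by (auto simp: W2_def)
        obtain x where x: "v = u @ x" using less.prems by (auto simp: prefix_def)
        then have "prefix x (\<kappa> u w @ w)" using w(2) by simp
        then have "x \<in> X" using w(1) \<kappa>(1)[of u w] by (auto simp: X_def)
        then have "\<phi> u * \<beta> \<le> \<phi> u * b x" using \<beta>(3) \<phi>0[of u] by (intro mult_left_mono) auto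
        also have "\<dots> \<le> \<phi> v" using b(2)[of u x] x by simp
        finally have one: "1 \<le> C / 2 * ?q"
          unfolding C(3)[symmetric] using \<phi>[of u] \<beta>(1) by (simp add: field_simps)
        have "(\<Sum>w\<in>W2. ennreal (p w) * R (?st w) v) \<le> (\<Sum>w\<in>W2. ennreal (p w) * 1)"
          by (intro sum_mono mult_left_mono R_le_1) simp
        also have "\<dots> \<le> (\<Sum>w\<in>W. ennreal (p w))"
          using W(1) by (simp del: sum_ennreal) (intro sum_mono2, auto simp: W2_def)
        also have "\<dots> = 1" using p0 p_sum by simp
        also have "\<dots> \<le> ennreal (C / 2 * ?q)" using one by simp
        finally show ?thesis .
      qed simp
      also have "ennreal (C / 2 * ?q) + ennreal (C / 2 * ?q) = ennreal (C * \<phi> v / \<phi> u)"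
      proof -
        have X0: "0 \<le> C / 2 * ?q"
          by (intro mult_nonneg_nonneg less_imp_le[OF q]) (use C(1) in simp)
        have "C / 2 * ?q + C / 2 * ?q = C * \<phi> v / \<phi> u" by simp
        then show ?thesis using ennreal_plus[OF X0 X0] by (simp only:)
      qed
      finally show ?thesis by (simp add: add_mono)
    qed
  qed
  define word where "word x j = ?node [] x (Suc j) ! j" for x j
  let ?P = "PiM UNIV (\<lambda>_::nat. count_space (UNIV :: nat set))"
  have word_meas: "word \<in> measurable ?S ?P"
  proof (rule measurable_PiM_single')
    show "(\<lambda>x. word x j) \<in> measurable ?S (count_space UNIV)" for j
      unfolding word_def by (rule measurable_compose[OF node_meas]) simp
  qed simp
  define I where "I = (\<Union>k\<in>\<Gamma>'. set k) \<union> (\<Union>w\<in>W. set w)"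
  have take_node: "map (word x) [0..<k] = take k (?node [] x k)" if x: "x \<in> space ?S" for x k
  proof (rule nth_equalityI)
    have len: "j \<le> length (?node [] x j)" for j
      using Wne(1)[OF xW[OF x]] by (intro length_block_word) 
    show "length (map (word x) [0..<k]) = length (take k (?node [] x k))" using len[of k] by simp
    fix j assume "j < length (map (word x) [0..<k])"
    then have j: "j < k" by simp
    obtain z where "?node [] x k = ?node [] x (Suc j) @ z"
      using prefix_block_word[of "Suc j" k \<kappa> "[]" x] j by (auto simp: prefix_def Suc_le_eq simp del: block_word.simps)
    then show "map (word x) [0..<k] ! j = take k (?node [] x k) ! j"
      using j len[of "Suc j"] by (simp add: word_def nth_append del: block_word.simps)
  qed
  have range: "range (word x) \<subseteq> I" if x: "x \<in> space ?S" for x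
  proof safe
    fix j
    have "j < length (?node [] x (Suc j))"
      using length_block_word[of x "Suc j" \<kappa> "[]"] Wne(1)[OF xW[OF x]] by (simp del: block_word.simps)
    then have "word x j \<in> set (?node [] x (Suc j))" unfolding word_def by (rule nth_mem)
    then have "word x j \<in> set [] \<union> (\<Union>i<Suc j. set (x i) \<union> set (\<kappa> (?node [] x i) (x i)))"
      using set_block_word by blast
    then show "word x j \<in> I" using xW[OF x] \<kappa>(1) by (fastforce simp: I_def)
  qed
  define \<mu> where "\<mu> = distr ?S ?P word"
  have "finite I" using \<Gamma>' W(1) by (simp add: I_def)
  moreover have "prob_space \<mu>" unfolding \<mu>_def by (rule seq.P.prob_space_distr[OF word_meas])
  moreover have "sets \<mu> = sets ?P" by (simp add: \<mu>_def)
  moreover have "AE \<omega> in \<mu>. range \<omega> \<subseteq> I"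
  proof -
    have "{\<omega>\<in>space ?P. range \<omega> \<subseteq> I} = (\<Inter>j. {\<omega>\<in>space ?P. \<omega> j \<in> I})" by auto
    also have "\<dots> \<in> sets ?P" by measurable
    finally show ?thesis
      unfolding \<mu>_def using range by (subst AE_distr_iff[OF word_meas]) auto
  qed
  moreover have "emeasure \<mu> {\<omega>. map \<omega> [0..<length v] = v} \<le> ennreal (C * \<phi> v)" for v
  proof -
    have "map \<omega> [0..<length v] = v \<longleftrightarrow> (\<forall>j\<in>{..<length v}. \<omega> j = v ! j)" for \<omega>
      by (subst list_eq_iff_nth_eq) (simp add: Ball_def)
    then have "{\<omega>. map \<omega> [0..<length v] = v} = {\<omega>\<in>space ?P. \<forall>j\<in>{..<length v}. \<omega> j = v ! j}"
      by (simp add: space_PiM)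
    also have "\<dots> \<in> sets ?P" by measurable
    finally have "emeasure \<mu> {\<omega>. map \<omega> [0..<length v] = v}
        = emeasure ?S (word -` {\<omega>. map \<omega> [0..<length v] = v} \<inter> space ?S)"
      unfolding \<mu>_def by (rule emeasure_distr[OF word_meas])
    also have "\<dots> \<le> emeasure ?S (E [] v)"
    proof (rule emeasure_mono[OF _ E_sets], safe)
      fix x assume x: "x \<in> space ?S" and "map (word x) [0..<length v] = v"
      then have "take (length v) (?node [] x (length v)) = v" using take_node[OF x] by simp
      then have "prefix v (?node [] x (length v))"
        using take_is_prefix[of "length v" "?node [] x (length v)"] by simp
      then show "x \<in> E [] v" using x unfolding E_def by blast
    qed
    also have "\<dots> \<le> ennreal (C * \<phi> v)" using bound[of "[]" v] by (simp add: R_def \<phi>_Nil)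
    finally show ?thesis .
  qed
  ultimately show ?thesis using C(1) by blast
qed

section \<open>Integrals of negative powers of linear maps\<close>

text \<open>
  Both sides are the integral of \<open>indicator A x * indicator B (x + y)\<close> over \<open>x\<close> with respect to \<open>N\<close>
  and \<open>y\<close> with respect to Lebesgue measure: shift \<open>y\<close> for the left-hand side, and shift \<open>x\<close> and
  reflect \<open>y\<close> for the right-hand side.
\<close>

lemma emeasure_translation_invariant_unique:
  fixes N :: "'a::euclidean_space measure"
  assumes sets: "sets N = sets borel" and fin: "sigma_finite_measure N"
    and inv: "\<And>a. distr N borel (\<lambda>x. x + a) = N"
    and A: "A \<in> sets borel" and B: "B \<in> sets borel"
  shows "emeasure N A * emeasure lborel B = emeasure lborel A * emeasure N B"
proof -
  interpret N: sigma_finite_measure N by (rule fin)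
  interpret P: pair_sigma_finite N lborel by standard
  note [measurable_cong] = sets
  note [measurable] = A B
  have shiftN: "(\<integral>\<^sup>+x. f (x + a) \<partial>N) = (\<integral>\<^sup>+x. f x \<partial>N)" if [measurable]: "f \<in> borel_measurable borel"
    for f :: "'a \<Rightarrow> ennreal" and a
    by (subst (2) inv[of a, symmetric]) (simp add: nn_integral_distr)
  have shiftL: "(\<integral>\<^sup>+y. f (x + y) \<partial>lborel) = (\<integral>\<^sup>+y. f y \<partial>lborel)" if [measurable]: "f \<in> borel_measurable borel"
    for f :: "'a \<Rightarrow> ennreal" and x
    by (subst (2) lborel_distr_plus[of x, symmetric]) (simp add: nn_integral_distr)
  have reflL: "(\<integral>\<^sup>+y. f (- y) \<partial>lborel) = (\<integral>\<^sup>+y. f y \<partial>lborel)" if [measurable]: "f \<in> borel_measurable borel"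
    for f :: "'a \<Rightarrow> ennreal"
    by (subst (2) lborel_affine[of "-1" 0]) (simp_all add: nn_integral_distr nn_integral_density)
  have "emeasure N A * emeasure lborel B = (\<integral>\<^sup>+x. indicator A x * (\<integral>\<^sup>+y. indicator B y \<partial>lborel) \<partial>N)"
    by (simp add: nn_integral_multc sets)
  also have "\<dots> = (\<integral>\<^sup>+x. \<integral>\<^sup>+y. indicator A x * indicator B (x + y) \<partial>lborel \<partial>N)"
    by (simp add: nn_integral_cmult shiftL)
  also have "\<dots> = (\<integral>\<^sup>+y. \<integral>\<^sup>+x. indicator A x * indicator B (x + y) \<partial>N \<partial>lborel)"
    by (rule P.Fubini'[symmetric]) measurable
  also have "\<dots> = (\<integral>\<^sup>+y. \<integral>\<^sup>+x. indicator A (x - y) * indicator B x \<partial>N \<partial>lborel)"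
  proof (rule nn_integral_cong)
    fix y :: 'a
    show "(\<integral>\<^sup>+x. indicator A x * indicator B (x + y) \<partial>N) = (\<integral>\<^sup>+x. indicator A (x - y) * indicator B x \<partial>N)"
      using shiftN[of "\<lambda>x. indicator A (x - y) * indicator B x" y] by simp
  qed
  also have "\<dots> = (\<integral>\<^sup>+x. \<integral>\<^sup>+y. indicator A (x - y) * indicator B x \<partial>lborel \<partial>N)"
    by (rule P.Fubini') measurable
  also have "\<dots> = (\<integral>\<^sup>+x. emeasure lborel A * indicator B x \<partial>N)"
  proof (rule nn_integral_cong)
    fix x :: 'a
    have "(\<integral>\<^sup>+y. indicator A (x - y) \<partial>lborel) = (\<integral>\<^sup>+y. indicator A (x + y) \<partial>lborel)"
      using reflL[of "\<lambda>y. indicator A (x + y)"] by simp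
    also have "\<dots> = emeasure lborel A" by (simp add: shiftL)
    finally show "(\<integral>\<^sup>+y. indicator A (x - y) * indicator B x \<partial>lborel) = emeasure lborel A * indicator B x"
      by (simp add: nn_integral_multc)
  qed
  also have "\<dots> = emeasure lborel A * emeasure N B"
    by (simp add: nn_integral_cmult sets)
  finally show ?thesis .
qed

text \<open>
  The image of Lebesgue measure is translation invariant, hence a multiple of Lebesgue measure, and
  the two agree on the unit ball.
\<close>

lemma lborel_distr_orthogonal:
  fixes f :: "'a::euclidean_space \<Rightarrow> 'a"
  assumes "orthogonal_transformation f"
  shows "distr lborel borel f = lborel"
proof -
  have lin: "linear f" and nf: "norm (f x) = norm x" for x
    using assms by (auto simp: orthogonal_transformation)
  interpret linear f by (rule lin)
  have f[measurable]: "f \<in> borel_measurable borel"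
    by (intro borel_measurable_continuous_onI linear_continuous_on linear_conv_bounded_linear[THEN iffD1] lin)
  let ?N = "distr lborel borel f"
  have f_inv: "\<exists>b. f b = a" for a
    using orthogonal_transformation_surj[OF assms] by (metis surjD)
  have inv: "distr ?N borel (\<lambda>x. x + a) = ?N" for a
  proof -
    obtain b where b: "f b = a" using f_inv by blast
    have "distr ?N borel (\<lambda>x. x + a) = distr lborel borel (\<lambda>x. f x + a)"
      by (simp add: distr_distr comp_def)
    also have "\<dots> = distr lborel borel (\<lambda>x. f (b + x))"
      by (simp add: add b add.commute)
    also have "\<dots> = distr (distr lborel borel ((+) b)) borel f"
      by (simp add: distr_distr comp_def)
    finally show ?thesis by (simp add: lborel_distr_plus)
  qed
  have ball: "emeasure ?N (ball 0 r) = emeasure lborel (ball (0::'a) r)" for r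
  proof -
    have "f -` ball 0 r = ball 0 r" by (auto simp: nf)
    then show ?thesis by (simp add: emeasure_distr)
  qed
  have fin: "sigma_finite_measure ?N"
  proof
    let ?B = "range (\<lambda>n::nat. ball (0::'a) (real n))"
    have "\<Union>?B = UNIV" using reals_Archimedean2 by (auto simp: )
    moreover have "emeasure ?N (ball 0 (real n)) \<noteq> \<infinity>" for n :: nat
      unfolding ball using emeasure_bounded_finite[of "ball (0::'a) (real n)"] by simp
    ultimately show "\<exists>A. countable A \<and> A \<subseteq> sets ?N \<and> \<Union>A = space ?N \<and> (\<forall>a\<in>A. emeasure ?N a \<noteq> \<infinity>)"
      by (intro exI[of _ ?B]) auto
  qed
  show ?thesis
  proof (rule measure_eqI)
    fix A assume "A \<in> sets ?N"
    then have A: "A \<in> sets borel" by simp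
    have "emeasure ?N A * emeasure lborel (ball (0::'a) 1) = emeasure lborel A * emeasure lborel (ball (0::'a) 1)"
      using emeasure_translation_invariant_unique[OF _ fin inv A, of "ball 0 1"] by (simp add: ball)
    moreover have "emeasure lborel (ball (0::'a) 1) \<noteq> \<infinity>"
      using emeasure_bounded_finite[of "ball (0::'a) 1"] by simp
    moreover have "emeasure lborel (ball (0::'a) 1) \<noteq> 0"
    proof -
      have "0 < measure lborel (ball (0::'a) 1)" by (rule content_ball_pos) simp
      then show ?thesis by (auto simp: measure_def)
    qed
    ultimately show "emeasure ?N A = emeasure lborel A"
      by (metis ennreal_mult_cancel_left infinity_ennreal_def mult.commute)
  qed simp
qed

text \<open>
  The bound is uniform in the position \<open>-c\<close> of the singularity: within distance \<open>1\<close> of it the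
  integrand is bounded by the integrable power, and elsewhere by \<open>1\<close> (up to the factor from \<open>g\<close>).
\<close>

lemma nn_integral_power_singularity:
  fixes c :: real
  assumes \<theta>: "0 \<le> \<theta>" "\<theta> < 1" and R: "0 \<le> R" and g: "0 < g"
  shows "(\<integral>\<^sup>+x. indicator {-R..R} x * inverse (ennreal ((g * \<bar>x + c\<bar>) powr \<theta>)) \<partial>lborel)
    \<le> ennreal ((2 / (1 - \<theta>) + 2 * R) * g powr (- \<theta>))"
proof -
  (* The singular power on one side of its singularity; the other side is a reflection. *)
  let ?h = "\<lambda>x::real. ennreal (x powr (- \<theta>)) * indicator {0..1} x"
  have h: "(\<integral>\<^sup>+x. ?h x \<partial>lborel) = ennreal (1 / (1 - \<theta>))"
    using has_integral_powr_from_0[of "- \<theta>" 1] \<theta>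
    by (intro nn_integral_has_integral_lebesgue') auto
  have h1: "(\<integral>\<^sup>+x. ?h (c + x) \<partial>lborel) = ennreal (1 / (1 - \<theta>))"
    using nn_integral_real_affine[of ?h 1 c] h by simp
  have h2: "(\<integral>\<^sup>+x. ?h (- c - x) \<partial>lborel) = ennreal (1 / (1 - \<theta>))"
    using nn_integral_real_affine[of ?h "-1" "- c"] h by simp
  have "AE x in lborel. x \<noteq> - c" by (rule AE_lborel_singleton)
  then have "(\<integral>\<^sup>+x. indicator {-R..R} x * inverse (ennreal ((g * \<bar>x + c\<bar>) powr \<theta>)) \<partial>lborel)
    \<le> (\<integral>\<^sup>+x. ennreal (g powr (- \<theta>)) * (?h (c + x) + ?h (- c - x) + indicator {-R..R} x) \<partial>lborel)"
  proof (intro nn_integral_mono_AE, eventually_elim)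
    case (elim x)
    define z where "z = \<bar>x + c\<bar>"
    have z: "0 < z" using elim by (simp add: z_def)
    have "inverse (ennreal ((g * z) powr \<theta>)) = ennreal (g powr (- \<theta>)) * ennreal (z powr (- \<theta>))"
      using g z by (simp add: inverse_ennreal powr_mult powr_minus ennreal_mult'[symmetric])
    moreover have "indicator {-R..R} x * ennreal (z powr (- \<theta>)) \<le> ?h (c + x) + ?h (- c - x) + indicator {-R..R} x"
    proof (cases "z \<le> 1")
      case True
      have "ennreal (z powr (- \<theta>)) \<le> ?h (c + x) + ?h (- c - x)"
        using True by (cases "x + c \<ge> 0") (auto simp: z_def add.commute)
      then have "indicator {-R..R} x * ennreal (z powr (- \<theta>)) \<le> ?h (c + x) + ?h (- c - x)"
        by (auto split: split_indicator)
      then show ?thesis by (rule order_trans) simp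
    next
      case False
      then have "z powr (- \<theta>) \<le> 1" using \<theta> powr_mono[of "- \<theta>" 0 z] by simp
      then have "ennreal (z powr (- \<theta>)) \<le> 1" by simp
      then have "indicator {-R..R} x * ennreal (z powr (- \<theta>)) \<le> indicator {-R..R} x"
        by (auto split: split_indicator)
      then show ?thesis by (rule order_trans) simp
    qed
    ultimately show ?case
      unfolding z_def[symmetric] by (metis mult.left_commute mult_left_mono zero_le)
  qed
  also have "\<dots> = ennreal (g powr (- \<theta>)) * (ennreal (1 / (1 - \<theta>)) + ennreal (1 / (1 - \<theta>)) + ennreal (2 * R))"
    using R by (simp add: nn_integral_cmult nn_integral_add h1 h2)
  also have "\<dots> = ennreal ((2 / (1 - \<theta>) + 2 * R) * g powr (- \<theta>))"
    using R \<theta> by (simp add: ennreal_plus[symmetric] ennreal_mult'[symmetric] mult.commute del: ennreal_plus)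
  finally show ?thesis .
qed

lemma inverse_ennreal_prod_le:
  assumes "finite I" "\<And>i. i \<in> I \<Longrightarrow> 0 \<le> x i"
  shows "inverse (ennreal (\<Prod>i\<in>I. x i)) \<le> (\<Prod>i\<in>I. inverse (ennreal (x i)))"
  using assms
proof (induction I rule: finite_induct)
  case (insert j I)
  let ?p = "\<Prod>i\<in>I. x i"
  have p: "0 \<le> ?p" using insert.prems by (intro prod_nonneg) auto
  have "inverse (ennreal (x j * ?p)) \<le> inverse (ennreal (x j)) * inverse (ennreal ?p)"
  proof (cases "x j = 0 \<or> ?p = 0")
    case True
    then have "inverse (ennreal (x j)) * inverse (ennreal ?p) = \<top>"
      by (auto simp: ennreal_top_mult ennreal_mult_top)
    then show ?thesis by simp
  next
    case False
    then have "0 < x j" "0 < ?p" using p insert.prems by (auto simp: less_le)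
    then show ?thesis by (simp add: inverse_ennreal ennreal_mult'[symmetric])
  qed
  also have "\<dots> \<le> inverse (ennreal (x j)) * (\<Prod>i\<in>I. inverse (ennreal (x i)))"
    using insert by (intro mult_left_mono) auto
  finally show ?case using insert by simp
qed simp

text \<open>
  For every \<open>k\<close> the norm of \<open>A y + e = A (y + w)\<close> is at least the \<open>k\<close>-th singular value times
  \<open>|(y + w) \<bullet> v\<^sub>k|\<close>. Distributing the exponent as \<open>\<theta>\<^sub>0 + \<theta>\<^sub>1 + \<dots>\<close> over these bounds majorises the
  integrand by a product of functions of the single coordinates with respect to the singular basis.
  By rotation invariance it is integrated coordinatewise, and \<open>\<theta>\<^sub>k < 1\<close> makes the factors finite.
\<close>

lemma nn_integral_matrix_singularity:
  fixes A :: "real^'d^'d" and e :: "real^'d"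
  assumes A: "invertible A" and \<theta>: "\<And>k. k < CARD('d) \<Longrightarrow> 0 \<le> \<theta> k \<and> \<theta> k < 1" and R: "0 \<le> R"
  shows "(\<integral>\<^sup>+y. indicator (cball 0 R) y * inverse (ennreal (norm (A *v y + e) powr (\<Sum>k<CARD('d). \<theta> k))) \<partial>lborel)
    \<le> ennreal (\<Prod>k<CARD('d). (2 / (1 - \<theta> k) + 2 * R) * (singular_values A ! k) powr (- \<theta> k))"
proof -
  obtain v where v: "singular_basis A v" by (rule singular_basis_exists)
  let ?\<gamma> = "\<lambda>k. singular_values A ! k"
  obtain A' where "A ** A' = mat 1" using A by (auto simp: invertible_def)
  define w where "w = A' *v e"
  have Ae: "A *v y + e = A *v (y + w)" for y
    by (simp add: w_def matrix_vector_right_distrib matrix_vector_mul_assoc \<open>A ** A' = mat 1\<close>)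
  obtain g :: "'d \<Rightarrow> nat" where g: "bij_betw g UNIV {..<CARD('d)}"
    using ex_bij_betw_finite_nat[of "UNIV :: 'd set"] by (auto simp: atLeast0LessThan)
  have gk: "g i < CARD('d)" for i using g by (auto simp: bij_betw_def)
  (* The coordinates with respect to the singular basis: an orthogonal map. *)
  define f :: "real^'d \<Rightarrow> real^'d" where "f y = (\<chi> i. y \<bullet> v (g i))" for y
  have f_orth: "orthogonal_transformation f"
    unfolding orthogonal_transformation
  proof
    show "linear f"
      by (rule linearI) (simp_all add: f_def vec_eq_iff inner_add_left)
    show "\<forall>y. norm (f y) = norm y"
    proof
      fix y
      have "(norm (f y))\<^sup>2 = (\<Sum>i\<in>UNIV. (y \<bullet> v (g i))\<^sup>2)"
        by (simp add: f_def norm_vec_def L2_set_def sum_nonneg)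
      also have "\<dots> = (\<Sum>k<CARD('d). (y \<bullet> v k)\<^sup>2)"
        by (rule sum.reindex_bij_betw[OF g])
      also have "\<dots> = (norm y)\<^sup>2" by (simp add: norm_singular_basis_expansion[OF v])
      finally show "norm (f y) = norm y" by (simp add: power2_eq_iff_nonneg)
    qed
  qed
  define F where "F i x = indicator {-R..R} x * inverse (ennreal ((?\<gamma> (g i) * \<bar>x + w \<bullet> v (g i)\<bar>) powr \<theta> (g i)))" for i :: 'd and x :: real
  have F[measurable]: "F i \<in> borel_measurable borel" for i unfolding F_def by measurable
  have lower: "?\<gamma> k * \<bar>y \<bullet> v k + w \<bullet> v k\<bar> \<le> norm (A *v y + e)" if k: "k < CARD('d)" for k y
  proof -
    have "(?\<gamma> k * \<bar>y \<bullet> v k + w \<bullet> v k\<bar>)\<^sup>2 = (?\<gamma> k)\<^sup>2 * ((y + w) \<bullet> v k)\<^sup>2"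
      by (simp add: power_mult_distrib inner_add_left)
    also have "\<dots> \<le> (\<Sum>k<CARD('d). (?\<gamma> k)\<^sup>2 * ((y + w) \<bullet> v k)\<^sup>2)"
      using k by (intro member_le_sum) auto
    also have "\<dots> = (norm (A *v (y + w)))\<^sup>2"
      by (rule norm_matrix_vector_singular_values[OF v, symmetric])
    finally show ?thesis unfolding Ae by (rule power2_le_imp_le) simp
  qed
  have pointwise: "indicator (cball 0 R) y * inverse (ennreal (norm (A *v y + e) powr (\<Sum>k<CARD('d). \<theta> k)))
      \<le> (\<Prod>i\<in>UNIV. F i (f y $ i))" for y
  proof (cases "y \<in> cball 0 R")
    case True
    let ?x = "\<lambda>i. (?\<gamma> (g i) * \<bar>y \<bullet> v (g i) + w \<bullet> v (g i)\<bar>) powr \<theta> (g i)"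
    have "(\<Prod>i\<in>UNIV. ?x i) \<le> norm (A *v y + e) powr (\<Sum>k<CARD('d). \<theta> k)"
    proof (cases "norm (A *v y + e) = 0")
      (* All factors are then zero, also those with exponent zero, since 0 powr 0 = 0. *)
      case True
      then have "?x i = 0" for i
        using lower[OF gk, of i y] singular_value_pos[OF A gk, of i]
        by (simp add: mult_le_0_iff)
      then have z: "(\<Prod>i\<in>UNIV. ?x i) = 0" by (intro prod_zero) auto
      show ?thesis by (rule order_trans[OF eq_refl[OF z]]) simp
    next
      case False
      have "(\<Prod>i\<in>UNIV. ?x i) \<le> (\<Prod>i\<in>(UNIV::'d set). norm (A *v y + e) powr \<theta> (g i))"
        using lower[OF gk, of _ y] \<theta>[OF gk] singular_value_nonneg[OF gk, of A]
        by (intro prod_mono conjI powr_mono2) auto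
      also have "\<dots> = norm (A *v y + e) powr (\<Sum>i\<in>UNIV. \<theta> (g i))"
        using False by (simp add: powr_sum)
      also have "(\<Sum>i\<in>UNIV. \<theta> (g i)) = (\<Sum>k<CARD('d). \<theta> k)" by (rule sum.reindex_bij_betw[OF g])
      finally show ?thesis .
    qed
    then have "inverse (ennreal (norm (A *v y + e) powr (\<Sum>k<CARD('d). \<theta> k))) \<le> inverse (ennreal (\<Prod>i\<in>UNIV. ?x i))"
      by (intro ennreal_inverse_antimono ennreal_leI)
    also have "\<dots> \<le> (\<Prod>i\<in>UNIV. inverse (ennreal (?x i)))"
      by (rule inverse_ennreal_prod_le) auto
    also have "\<dots> = (\<Prod>i\<in>UNIV. F i (f y $ i))"
    proof (rule prod.cong[OF refl])
      fix i
      have "\<bar>y \<bullet> v (g i)\<bar> \<le> R"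
        using Cauchy_Schwarz_ineq2[of y "v (g i)"] norm_singular_basis(1)[OF v gk, of i] True by simp
      then show "inverse (ennreal (?x i)) = F i (f y $ i)" by (simp add: F_def f_def abs_le_iff)
    qed
    finally show ?thesis using True by simp
  qed simp
  have "(\<integral>\<^sup>+y. indicator (cball 0 R) y * inverse (ennreal (norm (A *v y + e) powr (\<Sum>k<CARD('d). \<theta> k))) \<partial>lborel)
      \<le> (\<integral>\<^sup>+y. (\<Prod>i\<in>UNIV. F i (f y $ i)) \<partial>lborel)"
    by (rule nn_integral_mono) (rule pointwise)
  also have "\<dots> = (\<integral>\<^sup>+z. (\<Prod>i\<in>UNIV. F i (z $ i)) \<partial>distr lborel borel f)"
  proof (rule nn_integral_distr[symmetric])
    show "f \<in> lborel \<rightarrow>\<^sub>M borel"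
      using f_orth by (auto simp: orthogonal_transformation intro!: borel_measurable_continuous_onI
          linear_continuous_on linear_conv_bounded_linear[THEN iffD1])
  qed measurable
  also have "\<dots> = (\<integral>\<^sup>+z. (\<Prod>i\<in>UNIV. F i (z $ i)) \<partial>lborel)"
    by (simp add: lborel_distr_orthogonal[OF f_orth])
  also have "\<dots> = (\<integral>\<^sup>+z. (\<Prod>b\<in>(Basis :: (real^'d) set). F (axis_index b) (z \<bullet> b)) \<partial>lborel)"
  proof (rule nn_integral_cong)
    fix z :: "real^'d"
    have B: "bij_betw (\<lambda>i. axis i (1::real)) UNIV (Basis :: (real^'d) set)"
      by (auto simp: bij_betw_def inj_on_def Basis_vec_def axis_eq_axis)
    show "(\<Prod>i\<in>UNIV. F i (z $ i)) = (\<Prod>b\<in>(Basis :: (real^'d) set). F (axis_index b) (z \<bullet> b))"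
      by (subst prod.reindex_bij_betw[OF B, symmetric]) (simp add: axis_index_axis inner_axis)
  qed
  also have "\<dots> = (\<Prod>b\<in>(Basis :: (real^'d) set). \<integral>\<^sup>+x. F (axis_index b) x \<partial>lborel)"
    by (rule nn_integral_lborel_prod) auto
  also have "\<dots> = (\<Prod>i\<in>UNIV. \<integral>\<^sup>+x. F i x \<partial>lborel)"
  proof -
    have B: "bij_betw (\<lambda>i. axis i (1::real)) UNIV (Basis :: (real^'d) set)"
      by (auto simp: bij_betw_def inj_on_def Basis_vec_def axis_eq_axis)
    show ?thesis
      by (subst prod.reindex_bij_betw[OF B, symmetric]) (simp add: axis_index_axis)
  qed
  also have "\<dots> \<le> (\<Prod>i\<in>UNIV. ennreal ((2 / (1 - \<theta> (g i)) + 2 * R) * ?\<gamma> (g i) powr (- \<theta> (g i))))"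
    unfolding F_def using \<theta>[OF gk] R singular_value_pos[OF A gk]
    by (intro prod_mono_ennreal nn_integral_power_singularity) auto
  also have "\<dots> = (\<Prod>k<CARD('d). ennreal ((2 / (1 - \<theta> k) + 2 * R) * ?\<gamma> k powr (- \<theta> k)))"
    by (rule prod.reindex_bij_betw[OF g])
  also have "\<dots> = ennreal (\<Prod>k<CARD('d). (2 / (1 - \<theta> k) + 2 * R) * ?\<gamma> k powr (- \<theta> k))"
  proof (rule prod_ennreal)
    fix k assume "k \<in> {..<CARD('d)}"
    then show "0 \<le> (2 / (1 - \<theta> k) + 2 * R) * ?\<gamma> k powr (- \<theta> k)"
      using \<theta>[of k] R by (intro mult_nonneg_nonneg add_nonneg_nonneg divide_nonneg_nonneg) auto
  qed
  finally show ?thesis .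
qed

section \<open>The projection and its dependence on a single translation\<close>

lemma word_matrix_Nil: "word_matrix T [] = mat 1"
  by (simp add: word_matrix_def)

lemma word_matrix_Cons: "word_matrix T (i # w) = T i ** word_matrix T w"
  by (simp add: word_matrix_def)

lemma word_matrix_append: "word_matrix T (u @ w) = word_matrix T u ** word_matrix T w"
  by (induction u) (simp_all add: word_matrix_Nil word_matrix_Cons matrix_mul_assoc)

lemma invertible_word_matrix:
  assumes "\<And>i. invertible (T i)"
  shows "invertible (word_matrix T w)"
proof (induction w)
  case Nil
  show ?case by (auto simp: word_matrix_Nil invertible_def intro: exI[of _ "mat 1"])
next
  case (Cons i w)
  then show ?case by (simp add: word_matrix_Cons invertible_mult assms)
qed

lemma norm_word_matrix_le:
  fixes T :: "nat \<Rightarrow> real^'d^'d"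
  assumes \<alpha>: "0 \<le> \<alpha>" "\<And>i x. norm (T i *v x) \<le> \<alpha> * norm x"
  shows "norm (word_matrix T w *v x) \<le> \<alpha> ^ length w * norm x"
proof (induction w)
  case (Cons i w)
  have "norm (word_matrix T (i # w) *v x) = norm (T i *v (word_matrix T w *v x))"
    by (simp add: word_matrix_Cons matrix_vector_mul_assoc)
  also have "\<dots> \<le> \<alpha> * norm (word_matrix T w *v x)" by (rule \<alpha>(2))
  also have "\<dots> \<le> \<alpha> * (\<alpha> ^ length w * norm x)" using Cons \<alpha>(1) by (rule mult_left_mono)
  finally show ?case by (simp add: mult.assoc)
qed (simp add: word_matrix_Nil)

lemma projection_term_le:
  fixes T :: "nat \<Rightarrow> real^'d^'d"
  assumes \<alpha>: "0 \<le> \<alpha>" "\<And>i x. norm (T i *v x) \<le> \<alpha> * norm x" and a: "\<And>i. norm (a i) \<le> B"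
  shows "norm (word_matrix T (map \<omega> [0..<j]) *v a (\<omega> j)) \<le> \<alpha> ^ j * B"
proof -
  have "norm (word_matrix T (map \<omega> [0..<j]) *v a (\<omega> j)) \<le> \<alpha> ^ length (map \<omega> [0..<j]) * norm (a (\<omega> j))"
    by (rule norm_word_matrix_le[OF \<alpha>])
  also have "\<dots> \<le> \<alpha> ^ j * B" using a[of "\<omega> j"] \<alpha>(1) by (simp add: mult_left_mono)
  finally show ?thesis .
qed

lemma projection_summable:
  fixes T :: "nat \<Rightarrow> real^'d^'d"
  assumes \<alpha>: "0 \<le> \<alpha>" "\<alpha> < 1" "\<And>i x. norm (T i *v x) \<le> \<alpha> * norm x" and a: "\<And>i. norm (a i) \<le> B"
  shows "summable (\<lambda>j. word_matrix T (map \<omega> [0..<j]) *v a (\<omega> j))"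
proof (rule summable_comparison_test'[where N=0])
  show "summable (\<lambda>j. \<alpha> ^ j * B)" using \<alpha> by (intro summable_mult2 summable_geometric) simp
  show "norm (word_matrix T (map \<omega> [0..<j]) *v a (\<omega> j)) \<le> \<alpha> ^ j * B" for j
    by (rule projection_term_le[OF \<alpha>(1,3) a])
qed

lemma norm_projection_le:
  fixes T :: "nat \<Rightarrow> real^'d^'d"
  assumes \<alpha>: "0 \<le> \<alpha>" "\<alpha> < 1" "\<And>i x. norm (T i *v x) \<le> \<alpha> * norm x" and a: "\<And>i. norm (a i) \<le> B"
  shows "norm (projection T a \<omega>) \<le> B / (1 - \<alpha>)"
proof -
  have sums: "(\<lambda>j. \<alpha> ^ j * B) sums (1 / (1 - \<alpha>) * B)"
    using \<alpha> by (intro sums_mult2 geometric_sums) simp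
  have "norm (projection T a \<omega>) \<le> (\<Sum>j. \<alpha> ^ j * B)"
    unfolding projection_def
  proof (rule norm_suminf_le)
    show "norm (word_matrix T (map \<omega> [0..<j]) *v a (\<omega> j)) \<le> \<alpha> ^ j * B" for j
      by (rule projection_term_le[OF \<alpha>(1,3) a])
    show "summable (\<lambda>j. \<alpha> ^ j * B)" using sums by (rule sums_summable)
  qed
  then show ?thesis using sums by (simp add: sums_iff)
qed

lemma map_upt_add: "map \<omega> [0..<n + j] = map \<omega> [0..<n] @ map (\<lambda>k. \<omega> (n + k)) [0..<j]"
  by (rule nth_equalityI) (auto simp: nth_append simp del: upt_Suc)

text \<open>
  The projection of \<open>\<omega>\<close> is an affine image, with linear part \<open>T\<^bsub>\<omega>|n\<^esub>\<close>, of the projection of the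
  \<open>n\<close>-fold shift of \<open>\<omega>\<close>.
\<close>

lemma projection_split:
  fixes T :: "nat \<Rightarrow> real^'d^'d"
  assumes \<alpha>: "0 \<le> \<alpha>" "\<alpha> < 1" "\<And>i x. norm (T i *v x) \<le> \<alpha> * norm x" and a: "\<And>i. norm (a i) \<le> B"
  shows "projection T a \<omega> = (\<Sum>j<n. word_matrix T (map \<omega> [0..<j]) *v a (\<omega> j))
    + word_matrix T (map \<omega> [0..<n]) *v projection T a (\<lambda>k. \<omega> (n + k))"
proof -
  have s: "summable (\<lambda>j. word_matrix T (map \<omega> [0..<j]) *v a (\<omega> j))" for \<omega>
    by (rule projection_summable[OF \<alpha> a])
  have "projection T a \<omega> = (\<Sum>j. word_matrix T (map \<omega> [0..<j + n]) *v a (\<omega> (j + n)))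
      + (\<Sum>j<n. word_matrix T (map \<omega> [0..<j]) *v a (\<omega> j))"
    unfolding projection_def by (rule suminf_split_initial_segment[OF s])
  also have "(\<Sum>j. word_matrix T (map \<omega> [0..<j + n]) *v a (\<omega> (j + n)))
      = (\<Sum>j. word_matrix T (map \<omega> [0..<n]) *v (word_matrix T (map (\<lambda>k. \<omega> (n + k)) [0..<j]) *v a (\<omega> (n + j))))"
    by (simp only: add.commute[of _ n] map_upt_add word_matrix_append matrix_vector_mul_assoc)
  also have "\<dots> = word_matrix T (map \<omega> [0..<n]) *v projection T a (\<lambda>k. \<omega> (n + k))"
    unfolding projection_def
    by (rule bounded_linear.suminf[OF matrix_vector_mul_bounded_linear s, symmetric])
  finally show ?thesis by (simp add: add.commute)
qed

lemma projection_diff_common_prefix: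
  fixes T :: "nat \<Rightarrow> real^'d^'d"
  assumes \<alpha>: "0 \<le> \<alpha>" "\<alpha> < 1" "\<And>i x. norm (T i *v x) \<le> \<alpha> * norm x" and a: "\<And>i. norm (a i) \<le> B"
    and eq: "\<And>k. k < n \<Longrightarrow> \<omega> k = \<tau> k"
  shows "projection T a \<omega> - projection T a \<tau> = word_matrix T (map \<omega> [0..<n]) *v
    (projection T a (\<lambda>k. \<omega> (n + k)) - projection T a (\<lambda>k. \<tau> (n + k)))"
proof -
  have m: "map \<omega> [0..<j] = map \<tau> [0..<j]" if "j \<le> n" for j
    using that eq by auto
  have "(\<Sum>j<n. word_matrix T (map \<omega> [0..<j]) *v a (\<omega> j)) = (\<Sum>j<n. word_matrix T (map \<tau> [0..<j]) *v a (\<tau> j))"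
  proof (intro sum.cong refl)
    fix j assume "j \<in> {..<n}"
    then have "map \<omega> [0..<j] = map \<tau> [0..<j]" "\<omega> j = \<tau> j" using m[of j] eq[of j] by simp_all
    then show "word_matrix T (map \<omega> [0..<j]) *v a (\<omega> j) = word_matrix T (map \<tau> [0..<j]) *v a (\<tau> j)"
      by (simp only:)
  qed
  then show ?thesis
    using projection_split[where T=T and a=a and \<omega>=\<omega> and n=n, OF \<alpha> a]
      projection_split[where T=T and a=a and \<omega>=\<tau> and n=n, OF \<alpha> a]
    by (simp only: matrix_vector_mult_diff_distrib m[OF order_refl]) simp
qed

text \<open>
  The translations \<open>a\<close> with \<open>a\<^sub>i = y\<close> and all others zero. As the projection is linear in \<open>a\<close>, they
  isolate its dependence on \<open>a\<^sub>i\<close>.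
\<close>

definition letter_vector :: "nat \<Rightarrow> 'a \<Rightarrow> nat \<Rightarrow> 'a::zero" where
  "letter_vector i y k = (if k = i then y else 0)"

lemma projection_update:
  fixes T :: "nat \<Rightarrow> real^'d^'d"
  assumes \<alpha>: "0 \<le> \<alpha>" "\<alpha> < 1" "\<And>i x. norm (T i *v x) \<le> \<alpha> * norm x"
    and a: "\<And>k. k \<noteq> i \<Longrightarrow> norm (a k) \<le> B"
  shows "projection T (a(i := y)) \<omega> = projection T (letter_vector i y) \<omega> + projection T (a(i := 0)) \<omega>"
proof -
  have B: "norm ((a(i := 0)) k) \<le> max B 0" for k using a[of k] by auto
  have l: "norm (letter_vector i y k) \<le> norm y" for k by (simp add: letter_vector_def)
  have "projection T (letter_vector i y) \<omega> + projection T (a(i := 0)) \<omega>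
    = (\<Sum>j. word_matrix T (map \<omega> [0..<j]) *v letter_vector i y (\<omega> j) + word_matrix T (map \<omega> [0..<j]) *v (a(i := 0)) (\<omega> j))"
    unfolding projection_def
    by (rule suminf_add[OF projection_summable[OF \<alpha> l] projection_summable[OF \<alpha> B]])
  also have "\<dots> = projection T (a(i := y)) \<omega>"
    unfolding projection_def
    by (rule arg_cong[of _ _ suminf]) (auto simp: fun_eq_iff letter_vector_def)
  finally show ?thesis by simp
qed

lemma linear_projection_letter_vector:
  fixes T :: "nat \<Rightarrow> real^'d^'d"
  assumes \<alpha>: "0 \<le> \<alpha>" "\<alpha> < 1" "\<And>i x. norm (T i *v x) \<le> \<alpha> * norm x"
  shows "linear (\<lambda>y. projection T (letter_vector i y) \<omega>)"
proof -
  have l: "norm (letter_vector i y k) \<le> norm y" for k and y :: "real^'d" by (simp add: letter_vector_def)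
  note s = projection_summable[OF \<alpha> l]
  show ?thesis
  proof (rule linearI)
    fix x y :: "real^'d" and c :: real
    have "projection T (letter_vector i x) \<omega> + projection T (letter_vector i y) \<omega>
      = (\<Sum>j. word_matrix T (map \<omega> [0..<j]) *v letter_vector i x (\<omega> j) + word_matrix T (map \<omega> [0..<j]) *v letter_vector i y (\<omega> j))"
      unfolding projection_def by (rule suminf_add[OF s s])
    also have "\<dots> = projection T (letter_vector i (x + y)) \<omega>"
      unfolding projection_def
      by (rule arg_cong[of _ _ suminf]) (auto simp: fun_eq_iff letter_vector_def matrix_vector_right_distrib)
    finally show "projection T (letter_vector i (x + y)) \<omega> = projection T (letter_vector i x) \<omega> + projection T (letter_vector i y) \<omega>"
      by simp
    have "c *\<^sub>R projection T (letter_vector i x) \<omega>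
      = (\<Sum>j. c *\<^sub>R (word_matrix T (map \<omega> [0..<j]) *v letter_vector i x (\<omega> j)))"
      unfolding projection_def by (rule suminf_scaleR_right[OF s])
    also have "\<dots> = projection T (letter_vector i (c *\<^sub>R x)) \<omega>"
      unfolding projection_def
      by (rule arg_cong[of _ _ suminf]) (auto simp: fun_eq_iff letter_vector_def matrix_vector_mult_scaleR)
    finally show "projection T (letter_vector i (c *\<^sub>R x)) \<omega> = c *\<^sub>R projection T (letter_vector i x) \<omega>"
      by simp
  qed
qed

text \<open>
  An upper bound for the contribution of the occurrences of \<open>i\<close> in \<open>\<omega>\<close>, the initial position
  excepted, to the coefficient of \<open>a\<^sub>i\<close> in the projection of \<open>\<omega>\<close>.
\<close>

definition letter_weight :: "real \<Rightarrow> nat \<Rightarrow> (nat \<Rightarrow> nat) \<Rightarrow> real" where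
  "letter_weight \<alpha> i \<omega> = (\<Sum>k. if \<omega> (Suc k) = i then \<alpha> ^ Suc k else 0)"

lemma letter_weight_summable:
  assumes "0 \<le> \<alpha>" "\<alpha> < 1"
  shows "summable (\<lambda>k. if \<omega> (Suc k) = i then \<alpha> ^ Suc k else (0::real))"
proof (rule summable_comparison_test'[where N=0])
  show "summable (\<lambda>k. \<alpha> ^ Suc k)"
    using assms by (subst summable_Suc_iff) (intro summable_geometric, simp)
qed (use assms in auto)

text \<open>A position of \<open>\<omega>\<close> is occupied by at most one of the letters \<open>i\<close> and \<open>j\<close>.\<close>

lemma letter_weight_add_le:
  assumes \<alpha>: "0 \<le> \<alpha>" "\<alpha> < 1" and ij: "i \<noteq> j"
  shows "letter_weight \<alpha> i \<omega> + letter_weight \<alpha> j \<omega> \<le> \<alpha> / (1 - \<alpha>)"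
proof -
  note s = letter_weight_summable[OF \<alpha>, where \<omega>=\<omega>]
  have sums: "(\<lambda>k. \<alpha> * \<alpha> ^ k) sums (\<alpha> * (1 / (1 - \<alpha>)))"
    using \<alpha> by (intro sums_mult geometric_sums) simp
  have "letter_weight \<alpha> i \<omega> + letter_weight \<alpha> j \<omega>
    = (\<Sum>k. (if \<omega> (Suc k) = i then \<alpha> ^ Suc k else 0) + (if \<omega> (Suc k) = j then \<alpha> ^ Suc k else 0))"
    unfolding letter_weight_def by (rule suminf_add[OF s s])
  also have "\<dots> \<le> (\<Sum>k. \<alpha> * \<alpha> ^ k)"
    using sums ij \<alpha>(1) by (intro suminf_le summable_add s) (auto simp: sums_iff)
  also have "\<dots> = \<alpha> / (1 - \<alpha>)" using sums by (simp add: sums_iff)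
  finally show ?thesis .
qed

lemma norm_projection_letter_vector:
  fixes T :: "nat \<Rightarrow> real^'d^'d"
  assumes \<alpha>: "0 \<le> \<alpha>" "\<alpha> < 1" "\<And>i x. norm (T i *v x) \<le> \<alpha> * norm x"
  shows "norm (projection T (letter_vector i y) \<omega> - (if \<omega> 0 = i then y else 0)) \<le> letter_weight \<alpha> i \<omega> * norm y"
proof -
  have l: "norm (letter_vector i y k) \<le> norm y" for k by (simp add: letter_vector_def)
  let ?f = "\<lambda>j. word_matrix T (map \<omega> [0..<j]) *v letter_vector i y (\<omega> j)"
  have s: "summable ?f" by (rule projection_summable[OF \<alpha> l])
  note sw = letter_weight_summable[OF \<alpha>(1,2), where \<omega>=\<omega> and i=i]
  have "projection T (letter_vector i y) \<omega> = ?f 0 + (\<Sum>j. ?f (Suc j))"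
    unfolding projection_def using suminf_split_head[OF s] by (simp add: algebra_simps)
  moreover have "?f 0 = (if \<omega> 0 = i then y else 0)"
    by (simp add: letter_vector_def word_matrix_Nil)
  ultimately have "norm (projection T (letter_vector i y) \<omega> - (if \<omega> 0 = i then y else 0)) = norm (\<Sum>j. ?f (Suc j))"
    by simp
  also have "\<dots> \<le> (\<Sum>k. (if \<omega> (Suc k) = i then \<alpha> ^ Suc k else 0) * norm y)"
  proof (rule norm_suminf_le)
    show "summable (\<lambda>k. (if \<omega> (Suc k) = i then \<alpha> ^ Suc k else 0) * norm y)"
      by (rule summable_mult2[OF sw])
    fix k
    show "norm (?f (Suc k)) \<le> (if \<omega> (Suc k) = i then \<alpha> ^ Suc k else 0) * norm y"
      using norm_word_matrix_le[where T=T and w="map \<omega> [0..<Suc k]" and x=y, OF \<alpha>(1,3)]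
      by (simp add: letter_vector_def del: upt_Suc)
  qed
  also have "\<dots> = letter_weight \<alpha> i \<omega> * norm y"
    unfolding letter_weight_def by (rule suminf_mult2[OF sw, symmetric])
  finally show ?thesis .
qed

text \<open>
  The four weights sum up to at most \<open>2 \<alpha>/(1-\<alpha>)\<close>, so one of the letters gets at most half of that.
  This choice of the letter, due to Solomyak, is what admits norms up to \<open>1/2\<close>: the trivial bound for
  a prescribed letter is \<open>2 \<alpha>/(1-\<alpha>)\<close>, which is smaller than \<open>1\<close> only for \<open>\<alpha> < 1/3\<close>.
\<close>

lemma letter_weight_choice:
  assumes \<alpha>: "0 \<le> \<alpha>" "\<alpha> < 1" and ij: "i \<noteq> j"
  shows "letter_weight \<alpha> i \<omega> + letter_weight \<alpha> i \<tau> \<le> \<alpha> / (1 - \<alpha>) \<or>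
    letter_weight \<alpha> j \<omega> + letter_weight \<alpha> j \<tau> \<le> \<alpha> / (1 - \<alpha>)"
  using letter_weight_add_le[OF \<alpha> ij, where \<omega>=\<omega>] letter_weight_add_le[OF \<alpha> ij, where \<omega>=\<tau>] by linarith

text \<open>The difference is \<open>y\<close>, from the initial letter of \<open>\<omega>\<close>, up to an error controlled by the weights.\<close>

lemma norm_letter_difference_ge:
  fixes T :: "nat \<Rightarrow> real^'d^'d"
  assumes \<alpha>: "0 \<le> \<alpha>" "\<alpha> < 1" "\<And>i x. norm (T i *v x) \<le> \<alpha> * norm x"
    and weight: "letter_weight \<alpha> i \<omega> + letter_weight \<alpha> i \<tau> \<le> \<beta>" and i: "\<omega> 0 = i" "\<tau> 0 \<noteq> i"
  shows "(1 - \<beta>) * norm y \<le> norm (projection T (letter_vector i y) \<omega> - projection T (letter_vector i y) \<tau>)"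
proof -
  let ?p = "projection T (letter_vector i y)"
  have 1: "norm (?p \<omega> - y) \<le> letter_weight \<alpha> i \<omega> * norm y"
    using norm_projection_letter_vector[where T=T and i=i and y=y and \<omega>=\<omega>, OF \<alpha>] i by simp
  have 2: "norm (?p \<tau>) \<le> letter_weight \<alpha> i \<tau> * norm y"
    using norm_projection_letter_vector[where T=T and i=i and y=y and \<omega>=\<tau>, OF \<alpha>] i by simp
  have "norm y = norm ((?p \<omega> - ?p \<tau>) - (?p \<omega> - y) + ?p \<tau>)" by simp
  also have "\<dots> \<le> norm (?p \<omega> - ?p \<tau>) + norm (?p \<omega> - y) + norm (?p \<tau>)"
    by (meson norm_triangle_ineq norm_triangle_ineq4 order_trans add_right_mono)
  also have "\<dots> \<le> norm (?p \<omega> - ?p \<tau>) + (letter_weight \<alpha> i \<omega> + letter_weight \<alpha> i \<tau>) * norm y"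
    using 1 2 by (simp add: distrib_right)
  also have "\<dots> \<le> norm (?p \<omega> - ?p \<tau>) + \<beta> * norm y"
    using weight by (intro add_left_mono mult_right_mono) auto
  finally show ?thesis by (simp add: algebra_simps)
qed

lemma uniform_contraction:
  fixes T :: "nat \<Rightarrow> real^'d^'d"
  assumes "(SUP i. ereal (onorm (\<lambda>x. T i *v x))) < ereal (1/2)"
  shows "\<exists>\<alpha>. 0 < \<alpha> \<and> \<alpha> < 1/2 \<and> (\<forall>i x. norm (T i *v x) \<le> \<alpha> * norm x)"
proof -
  obtain \<alpha> where \<alpha>: "(SUP i. ereal (onorm (\<lambda>x. T i *v x))) < ereal \<alpha>" "ereal \<alpha> < ereal (1/2)"
    using ereal_dense2[OF assms] by blast
  have le: "onorm (\<lambda>x. T i *v x) < \<alpha>" for i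
  proof -
    have "ereal (onorm (\<lambda>x. T i *v x)) \<le> (SUP i. ereal (onorm (\<lambda>x. T i *v x)))" by (rule SUP_upper) simp
    then have "ereal (onorm (\<lambda>x. T i *v x)) < ereal \<alpha>" using \<alpha>(1) by (rule le_less_trans)
    then show ?thesis by simp
  qed
  have "0 \<le> onorm (\<lambda>x. T 0 *v x)" by (rule onorm_pos_le) simp
  then have "0 < \<alpha>" using le[of 0] by linarith
  moreover have "norm (T i *v x) \<le> \<alpha> * norm x" for i x
  proof -
    have "norm (T i *v x) \<le> onorm (\<lambda>x. T i *v x) * norm x" by (rule onorm) simp
    also have "\<dots> \<le> \<alpha> * norm x" using le[of i] by (intro mult_right_mono) auto
    finally show ?thesis .
  qed
  ultimately show ?thesis using \<alpha>(2) by auto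
qed

lemma sv_potential_pos:
  fixes T :: "nat \<Rightarrow> real^'d^'d"
  assumes "\<And>i. invertible (T i)" "0 \<le> s" "s \<le> real CARD('d)"
  shows "0 < sv_potential T s w"
  unfolding sv_potential_def
  by (rule singular_value_function_pos[OF invertible_word_matrix assms(2,3)]) (rule assms(1))

lemma sv_potential_Nil:
  fixes T :: "nat \<Rightarrow> real^'d^'d"
  assumes "0 \<le> s" "s \<le> real CARD('d)"
  shows "sv_potential T s [] = 1"
  by (simp add: sv_potential_def word_matrix_Nil singular_value_function_mat_1 assms)

lemma sv_potential_append_ge:
  fixes T :: "nat \<Rightarrow> real^'d^'d"
  assumes T: "\<And>i. invertible (T i)" and s: "0 \<le> s" "s \<le> real CARD('d)"
  shows "\<exists>b>0. \<forall>u. sv_potential T s u * b \<le> sv_potential T s (u @ w)"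
proof -
  have inv: "invertible (word_matrix T w)" for w by (rule invertible_word_matrix) (rule T)
  have "inj ((*v) (word_matrix T w))"
    using inv[of w] by (simp add: invertible_left_inverse matrix_left_invertible_injective)
  then obtain b where b: "0 < b" "\<And>x. b * norm x \<le> norm (word_matrix T w *v x)"
    using linear_inj_bounded_below_pos[of "(*v) (word_matrix T w)"] by auto
  have "sv_potential T s u * b powr s \<le> sv_potential T s (u @ w)" for u
    unfolding sv_potential_def word_matrix_append
    by (rule singular_value_function_mult_ge[OF inv inv b s])
  moreover have "0 < b powr s" using b(1) by simp
  ultimately show ?thesis by blast
qed

lemma sv_potential_antimono:
  fixes T :: "nat \<Rightarrow> real^'d^'d"
  assumes T: "\<And>i. invertible (T i)" and \<alpha>: "0 < \<alpha>" "\<And>i x. norm (T i *v x) \<le> \<alpha> * norm x"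
    and s: "0 \<le> s" "s \<le> t" "t \<le> real CARD('d)"
  shows "sv_potential T t w \<le> sv_potential T s w * (\<alpha> ^ length w) powr (t - s)"
  unfolding sv_potential_def
proof (rule singular_value_function_antimono[OF _ _ s])
  show "invertible (word_matrix T w)" by (rule invertible_word_matrix) (rule T)
  show "norm (word_matrix T w *v x) \<le> \<alpha> ^ length w * norm x" for x
    by (rule norm_word_matrix_le) (use \<alpha> in auto)
qed

lemma sv_potential_pressure_dichotomy:
  fixes T :: "nat \<Rightarrow> real^'d^'d"
  assumes T: "\<And>i. invertible (T i)" and s: "0 \<le> s" "s \<le> real CARD('d)"
    and q: "quasi_multiplicative (sv_potential T s)"
  shows "(pressure (sv_potential T s) \<le> 0 \<and> (\<exists>K. \<forall>n\<ge>1. word_sum (sv_potential T s) n \<le> ennreal K)) \<or>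
    (\<not> pressure (sv_potential T s) \<le> 0 \<and> (\<forall>K. \<exists>n\<ge>1. ennreal K < word_sum (sv_potential T s) n))"
proof -
  obtain b where b: "0 < b" "\<And>u. sv_potential T s u * b \<le> sv_potential T s (u @ [0])"
    using sv_potential_append_ge[where T=T and w="[0]", OF T s] by blast
  show ?thesis
    by (rule pressure_dichotomy[OF q sv_potential_pos[where T=T, OF T s] b])
qed

lemma norm_letter_choice:
  fixes T :: "nat \<Rightarrow> real^'d^'d"
  assumes \<alpha>: "0 \<le> \<alpha>" "\<alpha> < 1" "\<And>i x. norm (T i *v x) \<le> \<alpha> * norm x" and ne: "\<omega> 0 \<noteq> \<tau> 0"
  shows "\<exists>l. \<forall>y. (1 - \<alpha> / (1 - \<alpha>)) * norm y
    \<le> norm (projection T (letter_vector l y) \<omega> - projection T (letter_vector l y) \<tau>)"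
  using letter_weight_choice[OF \<alpha>(1,2) ne, of \<omega> \<tau>]
proof
  assume w: "letter_weight \<alpha> (\<omega> 0) \<omega> + letter_weight \<alpha> (\<omega> 0) \<tau> \<le> \<alpha> / (1 - \<alpha>)"
  show ?thesis
    using norm_letter_difference_ge[where T=T, OF \<alpha> w refl ne[symmetric]] by blast
next
  assume "letter_weight \<alpha> (\<tau> 0) \<omega> + letter_weight \<alpha> (\<tau> 0) \<tau> \<le> \<alpha> / (1 - \<alpha>)"
  then have w: "letter_weight \<alpha> (\<tau> 0) \<tau> + letter_weight \<alpha> (\<tau> 0) \<omega> \<le> \<alpha> / (1 - \<alpha>)" by simp
  have "(1 - \<alpha> / (1 - \<alpha>)) * norm y
      \<le> norm (projection T (letter_vector (\<tau> 0) y) \<omega> - projection T (letter_vector (\<tau> 0) y) \<tau>)" for y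
    using norm_letter_difference_ge[where T=T and y=y, OF \<alpha> w refl ne] by (simp add: norm_minus_commute)
  then show ?thesis by blast
qed

abbreviation unit_cube :: "(real^'d) set" where
  "unit_cube \<equiv> {x. \<forall>k. 0 \<le> x $ k \<and> x $ k \<le> 1}"

lemma unit_cube_eq_cbox: "(unit_cube :: (real^'d) set) = cbox 0 (\<chi> i. 1)"
  by (auto simp: mem_box_cart)

lemma norm_unit_cube_le: "x \<in> unit_cube \<Longrightarrow> norm (x :: real^'d) \<le> real CARD('d)"
proof -
  assume x: "x \<in> unit_cube"
  have "norm x \<le> (\<Sum>k\<in>UNIV. \<bar>x $ k\<bar>)" by (rule norm_le_l1_cart)
  also have "\<dots> \<le> (\<Sum>k\<in>(UNIV::'d set). 1)" using x by (intro sum_mono) auto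
  finally show ?thesis by simp
qed

abbreviation cube_measure :: "(real^'d) measure" where
  "cube_measure \<equiv> restrict_space lborel unit_cube"

lemma unit_cube_sets: "(unit_cube :: (real^'d) set) \<in> sets lborel"
  by (simp add: unit_cube_eq_cbox)

lemma prob_space_cube_measure: "prob_space (cube_measure :: (real^'d) measure)"
proof (rule prob_spaceI)
  have one: "(\<chi> i. 1) \<bullet> b = 1" if "b \<in> Basis" for b :: "real^'d"
    using that by (auto simp: Basis_vec_def inner_axis)
  have "emeasure lborel (cbox (0::real^'d) (\<chi> i. 1)) = 1"
    by (subst emeasure_lborel_cbox) (auto simp: one)
  then show "emeasure cube_measure (space (cube_measure :: (real^'d) measure)) = 1"
    using unit_cube_sets by (simp add: emeasure_restrict_space space_restrict_space unit_cube_eq_cbox)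
qed

lemma space_translation_measure:
  "space (translation_measure :: (nat \<Rightarrow> real^'d) measure) = {a. \<forall>i. a i \<in> unit_cube}"
  by (auto simp: translation_measure_def space_PiM space_restrict_space PiE_iff)

lemma prob_space_translation_measure: "prob_space (translation_measure :: (nat \<Rightarrow> real^'d) measure)"
  unfolding translation_measure_def by (rule prob_space_PiM) (rule prob_space_cube_measure)

lemma measurable_translation_component:
  "(\<lambda>a. a i) \<in> borel_measurable (translation_measure :: (nat \<Rightarrow> real^'d) measure)"
proof -
  have "(\<lambda>x. x) \<in> borel_measurable (cube_measure :: (real^'d) measure)"
    by (rule measurable_restrict_space1) simp
  then show ?thesis
    unfolding translation_measure_def
    by (rule measurable_compose[OF measurable_component_singleton, rotated]) simp
qed

abbreviation word_space :: "(nat \<Rightarrow> nat) measure" where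
  "word_space \<equiv> PiM UNIV (\<lambda>_. count_space UNIV)"

lemma measurable_prefix: "(\<lambda>\<omega>. map \<omega> [0..<k]) \<in> measurable word_space (count_space UNIV)"
proof (induction k)
  case (Suc k)
  have "(\<lambda>\<omega>. map \<omega> [0..<k] @ [\<omega> k]) \<in> measurable word_space (count_space UNIV)"
  proof (rule measurable_compose_countable[OF _ Suc, of "\<lambda>l \<omega>. l @ [\<omega> k]"])
    fix l :: "nat list"
    have "(\<lambda>i. l @ [i]) \<in> measurable (count_space UNIV) (count_space UNIV)" by simp
    then show "(\<lambda>\<omega>. l @ [\<omega> k]) \<in> measurable word_space (count_space UNIV)"
      by (rule measurable_compose[OF measurable_component_singleton, rotated]) simp
  qed
  then show ?case by simp
qed simp

text \<open>A partial sum depends on \<open>\<omega>\<close> only through a prefix, which takes countably many values. On the space of the measure the translations are bounded, so the sum converges.\<close>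

lemma borel_measurable_projection:
  fixes T :: "nat \<Rightarrow> real^'d^'d"
  assumes \<alpha>: "0 \<le> \<alpha>" "\<alpha> < 1" "\<And>i x. norm (T i *v x) \<le> \<alpha> * norm x" and \<mu>: "sets \<mu> = sets word_space"
  shows "(\<lambda>(a, \<omega>). projection T a \<omega>) \<in> borel_measurable (translation_measure \<Otimes>\<^sub>M \<mu>)"
proof -
  let ?M = "(translation_measure :: (nat \<Rightarrow> real^'d) measure) \<Otimes>\<^sub>M \<mu>"
  let ?t = "\<lambda>j x. word_matrix T (map (snd x) [0..<j]) *v fst x (snd x j)"
  have pre: "(\<lambda>x. map (snd x) [0..<k]) \<in> measurable ?M (count_space UNIV)" for k
  proof (rule measurable_compose[OF measurable_snd])
    show "(\<lambda>\<omega>. map \<omega> [0..<k]) \<in> measurable \<mu> (count_space UNIV)"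
      using measurable_prefix[of k] by (simp only: measurable_cong_sets[OF \<mu> refl])
  qed
  have t: "?t j \<in> borel_measurable ?M" for j
  proof -
    have "(\<lambda>x. (\<lambda>w x. word_matrix T (take j w) *v fst x (w ! j)) (map (snd x) [0..<Suc j]) x) \<in> borel_measurable ?M"
    proof (rule measurable_compose_countable[OF _ pre])
      fix w :: "nat list"
      have "(\<lambda>x. fst x (w ! j)) \<in> borel_measurable ?M"
        by (rule measurable_compose[OF measurable_fst measurable_translation_component])
      moreover have "(*v) (word_matrix T (take j w)) \<in> borel_measurable borel"
        by (intro borel_measurable_continuous_onI linear_continuous_on matrix_vector_mul_bounded_linear)
      ultimately show "(\<lambda>x. word_matrix T (take j w) *v fst x (w ! j)) \<in> borel_measurable ?M"
        by (rule measurable_compose)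
    qed
    moreover have "word_matrix T (take j (map (snd x) [0..<Suc j])) *v fst x (map (snd x) [0..<Suc j] ! j) = ?t j x" for x :: "(nat \<Rightarrow> real^'d) \<times> (nat \<Rightarrow> nat)"
      by (simp add: nth_append)
    ultimately show ?thesis by simp
  qed
  have "(\<lambda>x. projection T (fst x) (snd x)) \<in> borel_measurable ?M"
  proof (rule borel_measurable_LIMSEQ_metric)
    show "(\<lambda>x. \<Sum>j<n. ?t j x) \<in> borel_measurable ?M" for n
      by (intro borel_measurable_sum t)
    fix x assume "x \<in> space ?M"
    then have "norm (fst x i) \<le> real CARD('d)" for i
      by (auto simp: space_pair_measure space_translation_measure intro!: norm_unit_cube_le)
    from projection_summable[where T=T and a="fst x" and \<omega>="snd x", OF \<alpha> this]
    show "(\<lambda>n. \<Sum>j<n. ?t j x) \<longlonglongrightarrow> projection T (fst x) (snd x)"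
      unfolding projection_def by (rule summable_LIMSEQ)
  qed
  then show ?thesis by (simp add: split_beta')
qed

section \<open>Transversality\<close>

text \<open>Integrate over the translation of the letter \<open>l\<close> first and average over the others.\<close>

lemma nn_integral_translation_fix_coordinate:
  fixes f :: "(nat \<Rightarrow> real^'d) \<Rightarrow> ennreal"
  assumes f: "f \<in> borel_measurable translation_measure"
    and le: "\<And>X. (\<And>k. k \<noteq> l \<Longrightarrow> X k \<in> unit_cube) \<Longrightarrow> (\<integral>\<^sup>+y. f (X(l := y)) \<partial>cube_measure) \<le> B"
  shows "(\<integral>\<^sup>+a. f a \<partial>translation_measure) \<le> B"
proof -
  let ?C = "cube_measure :: (real^'d) measure"
  let ?R = "PiM (UNIV - {l}) (\<lambda>_::nat. ?C)"
  let ?h = "\<lambda>(y, X). X(l := y) :: nat \<Rightarrow> real^'d"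
  interpret C: prob_space ?C by (rule prob_space_cube_measure)
  interpret R: prob_space ?R by (rule prob_space_PiM) (rule prob_space_cube_measure)
  interpret P: pair_sigma_finite ?C ?R by standard
  have TM: "translation_measure = PiM UNIV (\<lambda>_. ?C)" by (simp add: translation_measure_def)
  have ins: "insert l (UNIV - {l}) = UNIV" by auto
  (* The product measure is the product of the factor with index l and all the others. *)
  have eq: "distr (?C \<Otimes>\<^sub>M ?R) translation_measure ?h = translation_measure"
    using distr_pair_PiM_eq_PiM[of "UNIV - {l}" "\<lambda>_. ?C" l] prob_space_cube_measure
    unfolding TM ins by simp
  have h: "?h \<in> measurable (?C \<Otimes>\<^sub>M ?R) translation_measure"
  proof -
    have "(\<lambda>(y, X). X(l := y)) \<in> measurable (?C \<Otimes>\<^sub>M ?R) (PiM (insert l (UNIV - {l})) (\<lambda>_. ?C))"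
      unfolding split_beta' by (rule measurable_fun_upd[where J="UNIV - {l}"]) auto
    then show ?thesis unfolding TM ins .
  qed
  have "(\<integral>\<^sup>+a. f a \<partial>translation_measure) = (\<integral>\<^sup>+a. f a \<partial>distr (?C \<Otimes>\<^sub>M ?R) translation_measure ?h)"
    by (simp only: eq)
  also have "\<dots> = (\<integral>\<^sup>+z. f (?h z) \<partial>(?C \<Otimes>\<^sub>M ?R))"
    by (rule nn_integral_distr[OF h]) (use f in simp)
  also have "\<dots> = (\<integral>\<^sup>+X. \<integral>\<^sup>+y. f (?h (y, X)) \<partial>?C \<partial>?R)"
    by (rule P.nn_integral_snd[symmetric]) (rule measurable_compose[OF h f])
  also have "\<dots> \<le> (\<integral>\<^sup>+X. B \<partial>?R)"
  proof (rule nn_integral_mono)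
    fix X assume "X \<in> space ?R"
    then have "X k \<in> unit_cube" if "k \<noteq> l" for k
      using that by (auto simp: space_PiM PiE_iff space_restrict_space)
    then show "(\<integral>\<^sup>+y. f (?h (y, X)) \<partial>?C) \<le> B" using le[of X] by simp
  qed
  also have "\<dots> = B" by (simp add: R.emeasure_space_1)
  finally show ?thesis .
qed

text \<open>
  The exponents \<open>(1 - \<epsilon>) * sv_exponent t k\<close> are smaller than \<open>1\<close>, which makes the constant finite.
  The number \<open>b\<close> is a lower bound for how much the linear part of the parametrisation by the chosen
  translation stretches vectors.
\<close>

definition transversality_const :: "nat \<Rightarrow> real \<Rightarrow> real \<Rightarrow> real \<Rightarrow> real" where
  "transversality_const d b t \<epsilon> = (\<Prod>k<d.
     (2 / (1 - (1 - \<epsilon>) * sv_exponent t k) + 2 * real d) * b powr (- ((1 - \<epsilon>) * sv_exponent t k)))"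

lemma scaled_exponent_bounds:
  assumes "0 < \<epsilon>" "\<epsilon> < 1"
  shows "0 \<le> (1 - \<epsilon>) * sv_exponent t k" "(1 - \<epsilon>) * sv_exponent t k < 1"
proof -
  show "0 \<le> (1 - \<epsilon>) * sv_exponent t k" using assms sv_exponent_bounds[of t k] by simp
  have "(1 - \<epsilon>) * sv_exponent t k \<le> (1 - \<epsilon>) * 1"
    using assms sv_exponent_bounds[of t k] by (intro mult_left_mono) auto
  also have "\<dots> < 1" using assms(1) by simp
  finally show "(1 - \<epsilon>) * sv_exponent t k < 1" .
qed

lemma transversality_const_pos:
  assumes "0 < b" "0 < \<epsilon>" "\<epsilon> < 1"
  shows "0 < transversality_const d b t \<epsilon>"
  unfolding transversality_const_def
proof (rule prod_pos)
  fix k assume "k \<in> {..<d}"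
  have "0 < 2 / (1 - (1 - \<epsilon>) * sv_exponent t k)"
    using scaled_exponent_bounds[OF assms(2,3), of t k] by simp
  then show "0 < (2 / (1 - (1 - \<epsilon>) * sv_exponent t k) + 2 * real d) * b powr (- ((1 - \<epsilon>) * sv_exponent t k))"
    using assms(1) by (intro mult_pos_pos add_pos_nonneg) auto
qed

text \<open>
  The singular values of the composition of \<open>A\<close> and \<open>D\<close> are at least \<open>b\<close> times those of \<open>A\<close>, and
  multiplying all exponents in \<open>\<phi>\<^sup>t(A)\<close> by \<open>-(1-\<epsilon>)\<close> gives \<open>\<phi>\<^sup>t(A)\<^bsup>-(1-\<epsilon>)\<^esup>\<close>.
\<close>

lemma nn_integral_cube_affine_singularity:
  fixes A :: "real^'d^'d" and D :: "real^'d \<Rightarrow> real^'d" and e :: "real^'d"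
  assumes A: "invertible A" and D: "linear D" and b: "0 < b" "\<And>y. b * norm y \<le> norm (D y)"
    and t: "0 \<le> t" "t \<le> real CARD('d)" and \<epsilon>: "0 < \<epsilon>" "\<epsilon> < 1"
  shows "(\<integral>\<^sup>+y. inverse (ennreal (norm (A *v (D y + e)) powr ((1 - \<epsilon>) * t))) \<partial>cube_measure)
    \<le> ennreal (transversality_const CARD('d) b t \<epsilon> * singular_value_function t A powr (- (1 - \<epsilon>)))"
proof -
  let ?d = "real CARD('d)"
  let ?\<theta> = "\<lambda>k. (1 - \<epsilon>) * sv_exponent t k"
  define M where "M = matrix D"
  have MD: "M *v y = D y" for y by (simp add: M_def matrix_works D)
  have "inj ((*v) M)"
  proof (rule injI)
    fix x y assume "M *v x = M *v y"
    then have "norm (D (x - y)) = 0" by (simp add: MD linear_diff[OF D])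
    then have "b * norm (x - y) \<le> 0" using b(2)[of "x - y"] by simp
    then show "x = y" using b(1) by (simp add: mult_le_0_iff)
  qed
  then have M: "invertible M" by (simp add: invertible_left_inverse matrix_left_invertible_injective)
  have AM: "invertible (A ** M)" by (rule invertible_mult[OF A M])
  have sum_\<theta>: "(\<Sum>k<CARD('d). ?\<theta> k) = (1 - \<epsilon>) * t"
    by (simp add: sum_sv_exponent t flip: sum_distrib_left)
  have eq: "A *v (D y + e) = (A ** M) *v y + A *v e" for y
    by (simp add: matrix_vector_right_distrib MD flip: matrix_vector_mul_assoc)
  have "(\<integral>\<^sup>+y. inverse (ennreal (norm (A *v (D y + e)) powr ((1 - \<epsilon>) * t))) \<partial>cube_measure)
      = (\<integral>\<^sup>+y. inverse (ennreal (norm ((A ** M) *v y + A *v e) powr (\<Sum>k<CARD('d). ?\<theta> k))) * indicator unit_cube y \<partial>lborel)"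
    using unit_cube_sets by (subst nn_integral_restrict_space) (simp_all add: eq sum_\<theta>)
  also have "\<dots> \<le> (\<integral>\<^sup>+y. indicator (cball 0 ?d) y * inverse (ennreal (norm ((A ** M) *v y + A *v e) powr (\<Sum>k<CARD('d). ?\<theta> k))) \<partial>lborel)"
  proof (rule nn_integral_mono)
    fix y :: "real^'d"
    show "inverse (ennreal (norm ((A ** M) *v y + A *v e) powr (\<Sum>k<CARD('d). ?\<theta> k))) * indicator unit_cube y
      \<le> indicator (cball 0 ?d) y * inverse (ennreal (norm ((A ** M) *v y + A *v e) powr (\<Sum>k<CARD('d). ?\<theta> k)))"
    proof (cases "y \<in> unit_cube")
      case True
      then have "y \<in> cball 0 ?d" using norm_unit_cube_le by simp
      then have "indicator unit_cube y = (1 :: ennreal)" "indicator (cball 0 ?d) y = (1 :: ennreal)"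
        using True by (simp_all add: indicator_def)
      then show ?thesis by (simp only: mult_1_left mult_1_right order_refl)
    qed simp
  qed
  also have "\<dots> \<le> ennreal (\<Prod>k<CARD('d). (2 / (1 - ?\<theta> k) + 2 * ?d) * (singular_values (A ** M) ! k) powr (- ?\<theta> k))"
    by (rule nn_integral_matrix_singularity[OF AM]) (use scaled_exponent_bounds[OF \<epsilon>] in auto)
  also have "\<dots> \<le> ennreal (transversality_const CARD('d) b t \<epsilon> * singular_value_function t A powr (- (1 - \<epsilon>)))"
  proof (rule ennreal_leI)
    have "(\<Prod>k<CARD('d). (2 / (1 - ?\<theta> k) + 2 * ?d) * (singular_values (A ** M) ! k) powr (- ?\<theta> k))
      \<le> (\<Prod>k<CARD('d). ((2 / (1 - ?\<theta> k) + 2 * ?d) * b powr (- ?\<theta> k)) * ((singular_values A ! k) powr sv_exponent t k) powr (- (1 - \<epsilon>)))"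
    proof (rule prod_mono)
      fix k assume "k \<in> {..<CARD('d)}"
      then have k: "k < CARD('d)" by simp
      have \<theta>: "0 \<le> ?\<theta> k" "?\<theta> k < 1" by (rule scaled_exponent_bounds[OF \<epsilon>])+
      have c: "0 \<le> 2 / (1 - ?\<theta> k) + 2 * ?d" using \<theta> by (intro add_nonneg_nonneg divide_nonneg_nonneg) auto
      have g: "0 < singular_values A ! k" by (rule singular_value_pos[OF A k])
      have "singular_values A ! k * b \<le> singular_values (A ** M) ! k"
        by (rule singular_value_mult_ge[OF M _ k]) (simp add: MD b)
      then have "(singular_values (A ** M) ! k) powr (- ?\<theta> k) \<le> (singular_values A ! k * b) powr (- ?\<theta> k)"
        using g b(1) \<theta> by (intro powr_mono2') auto
      also have "\<dots> = b powr (- ?\<theta> k) * ((singular_values A ! k) powr sv_exponent t k) powr (- (1 - \<epsilon>))"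
      proof -
        have "sv_exponent t k * - (1 - \<epsilon>) = - ?\<theta> k" by (simp add: algebra_simps)
        then show ?thesis using g b(1) by (simp only: powr_mult powr_powr mult.commute)
      qed
      finally have "(2 / (1 - ?\<theta> k) + 2 * ?d) * (singular_values (A ** M) ! k) powr (- ?\<theta> k)
        \<le> (2 / (1 - ?\<theta> k) + 2 * ?d) * (b powr (- ?\<theta> k) * ((singular_values A ! k) powr sv_exponent t k) powr (- (1 - \<epsilon>)))"
        using c by (rule mult_left_mono)
      then show "0 \<le> (2 / (1 - ?\<theta> k) + 2 * ?d) * (singular_values (A ** M) ! k) powr (- ?\<theta> k) \<and>
        (2 / (1 - ?\<theta> k) + 2 * ?d) * (singular_values (A ** M) ! k) powr (- ?\<theta> k)
        \<le> ((2 / (1 - ?\<theta> k) + 2 * ?d) * b powr (- ?\<theta> k)) * ((singular_values A ! k) powr sv_exponent t k) powr (- (1 - \<epsilon>))"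
        using c by (simp only: mult.assoc) (intro conjI mult_nonneg_nonneg; simp)
    qed
    also have "\<dots> = transversality_const CARD('d) b t \<epsilon>
        * (\<Prod>k<CARD('d). ((singular_values A ! k) powr sv_exponent t k) powr (- (1 - \<epsilon>)))"
      unfolding transversality_const_def by (rule prod.distrib)
    also have "(\<Prod>k<CARD('d). ((singular_values A ! k) powr sv_exponent t k) powr (- (1 - \<epsilon>)))
        = (\<Prod>k<CARD('d). (singular_values A ! k) powr sv_exponent t k) powr (- (1 - \<epsilon>))"
      by (rule prod_powr_distrib[symmetric])
    also have "(\<Prod>k<CARD('d). (singular_values A ! k) powr sv_exponent t k) = singular_value_function t A"
      by (rule singular_value_function_eq_prod[OF A t, symmetric])
    finally show "(\<Prod>k<CARD('d). (2 / (1 - ?\<theta> k) + 2 * ?d) * (singular_values (A ** M) ! k) powr (- ?\<theta> k))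
      \<le> transversality_const CARD('d) b t \<epsilon> * singular_value_function t A powr (- (1 - \<epsilon>))" .
  qed
  finally show ?thesis .
qed

text \<open>
  Here \<open>n\<close> is the length of the common prefix. The difference of the projections is the prefix matrix
  applied to a difference of projections of words with different initial letters, and the latter is,
  as a function of the translation of the letter from \<open>norm_letter_choice\<close> alone, affine with linear
  part bounded from below.
\<close>

lemma transversality:
  fixes T :: "nat \<Rightarrow> real^'d^'d"
  assumes T: "\<And>i. invertible (T i)" and \<alpha>: "0 < \<alpha>" "\<alpha> < 1/2" "\<And>i x. norm (T i *v x) \<le> \<alpha> * norm x"
    and t: "0 \<le> t" "t \<le> real CARD('d)" and \<epsilon>: "0 < \<epsilon>" "\<epsilon> < 1"
    and eq: "\<And>k. k < n \<Longrightarrow> \<omega> k = \<tau> k" and ne: "\<omega> n \<noteq> \<tau> n"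
  shows "(\<integral>\<^sup>+a. inverse (ennreal (dist (projection T a \<omega>) (projection T a \<tau>) powr ((1 - \<epsilon>) * t))) \<partial>translation_measure)
    \<le> ennreal (transversality_const CARD('d) (1 - \<alpha> / (1 - \<alpha>)) t \<epsilon>
        * sv_potential T t (map \<omega> [0..<n]) powr (- (1 - \<epsilon>)))"
proof -
  have \<alpha>1: "0 \<le> \<alpha>" "\<alpha> < 1" using \<alpha> by auto
  let ?\<omega> = "\<lambda>k. \<omega> (n + k)" and ?\<tau> = "\<lambda>k. \<tau> (n + k)"
  let ?A = "word_matrix T (map \<omega> [0..<n])"
  have A: "invertible ?A" by (rule invertible_word_matrix) (rule T)
  have b: "0 < 1 - \<alpha> / (1 - \<alpha>)" using \<alpha> by (simp add: field_simps)
  have "?\<omega> 0 \<noteq> ?\<tau> 0" using ne by simp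
  from norm_letter_choice[where T=T and \<omega>="?\<omega>" and \<tau>="?\<tau>", OF \<alpha>1 \<alpha>(3) this] obtain l where
    l: "\<And>y. (1 - \<alpha> / (1 - \<alpha>)) * norm y \<le> norm (projection T (letter_vector l y) ?\<omega> - projection T (letter_vector l y) ?\<tau>)"
    by blast
  define D where "D y = projection T (letter_vector l y) ?\<omega> - projection T (letter_vector l y) ?\<tau>" for y
  have D: "linear D"
    unfolding D_def by (intro linear_compose_sub linear_projection_letter_vector[where T=T, OF \<alpha>1 \<alpha>(3)])
  have meas: "(\<lambda>a. projection T a \<omega>) \<in> borel_measurable translation_measure" for \<omega>
  proof -
    have "(\<lambda>a. (a, \<omega>)) \<in> measurable translation_measure (translation_measure \<Otimes>\<^sub>M word_space)"
      by (rule measurable_Pair2') (simp add: space_PiM)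
    from measurable_compose[OF this borel_measurable_projection[where T=T, OF \<alpha>1 \<alpha>(3) refl]]
    show ?thesis by simp
  qed
  show ?thesis
  proof (rule nn_integral_translation_fix_coordinate[where l=l])
    note [measurable] = meas
    show "(\<lambda>a. inverse (ennreal (dist (projection T a \<omega>) (projection T a \<tau>) powr ((1 - \<epsilon>) * t)))) \<in> borel_measurable translation_measure"
      by measurable
  next
    fix X :: "nat \<Rightarrow> real^'d" assume X: "\<And>k. k \<noteq> l \<Longrightarrow> X k \<in> unit_cube"
    have XB: "norm (X k) \<le> real CARD('d)" if "k \<noteq> l" for k using norm_unit_cube_le X[OF that] by blast
    define e where "e = projection T (X(l := 0)) ?\<omega> - projection T (X(l := 0)) ?\<tau>"
    have "projection T (X(l := y)) \<omega> - projection T (X(l := y)) \<tau> = ?A *v (D y + e)" for y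
    proof -
      have B: "norm ((X(l := y)) k) \<le> max (real CARD('d)) (norm y)" for k
        using XB[of k] by (cases "k = l") auto
      have "projection T (X(l := y)) \<omega> - projection T (X(l := y)) \<tau>
        = ?A *v (projection T (X(l := y)) ?\<omega> - projection T (X(l := y)) ?\<tau>)"
        by (rule projection_diff_common_prefix[where T=T and a="X(l := y)", OF \<alpha>1 \<alpha>(3) B eq])
      moreover have "projection T (X(l := y)) \<rho> = projection T (letter_vector l y) \<rho> + projection T (X(l := 0)) \<rho>" for \<rho>
        by (rule projection_update[where T=T and a=X, OF \<alpha>1 \<alpha>(3) XB])
      ultimately show ?thesis by (simp add: D_def e_def algebra_simps)
    qed
    then have "(\<integral>\<^sup>+y. inverse (ennreal (dist (projection T (X(l := y)) \<omega>) (projection T (X(l := y)) \<tau>) powr ((1 - \<epsilon>) * t))) \<partial>cube_measure)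
      = (\<integral>\<^sup>+y. inverse (ennreal (norm (?A *v (D y + e)) powr ((1 - \<epsilon>) * t))) \<partial>cube_measure)"
      by (simp add: dist_norm)
    also have "\<dots> \<le> ennreal (transversality_const CARD('d) (1 - \<alpha> / (1 - \<alpha>)) t \<epsilon> * singular_value_function t ?A powr (- (1 - \<epsilon>)))"
      by (rule nn_integral_cube_affine_singularity[OF A D b _ t \<epsilon>]) (simp only: D_def l)
    finally show "(\<integral>\<^sup>+y. inverse (ennreal (dist (projection T (X(l := y)) \<omega>) (projection T (X(l := y)) \<tau>) powr ((1 - \<epsilon>) * t))) \<partial>cube_measure)
      \<le> ennreal (transversality_const CARD('d) (1 - \<alpha> / (1 - \<alpha>)) t \<epsilon> * sv_potential T t (map \<omega> [0..<n]) powr (- (1 - \<epsilon>)))"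
      by (simp only: sv_potential_def)
  qed
qed

section \<open>Dimension of the self-affine set\<close>

text \<open>
  For fixed \<open>\<omega>\<close> and \<open>\<tau>\<close>, transversality bounds the average kernel by \<open>G \<omega> \<tau>\<close>, the sum of
  \<open>C\<^sub>1 \<phi>\<^sup>t(\<omega>|\<^sub>n)\<^bsup>-(1-\<epsilon>)\<^esup>\<close> over all common prefixes (for \<open>\<omega> \<noteq> \<tau>\<close> the term of the
  longest one suffices; on the diagonal the sum diverges). Since the cylinder of \<open>\<omega>|\<^sub>n\<close> has mass at most \<open>C \<phi>\<^sup>t(\<omega>|\<^sub>n)\<close>, the integral of
  \<open>G \<omega>\<close> is at most a constant times the sum of \<open>\<phi>\<^sup>t(\<omega>|\<^sub>n)\<^sup>\<epsilon>\<close>, which is bounded uniformly in \<open>\<omega>\<close>.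
\<close>

lemma AE_hausdorff_dim_finite_alphabet_ge:
  fixes T :: "nat \<Rightarrow> real^'d^'d"
  assumes T: "\<And>i. invertible (T i)" and \<alpha>: "0 < \<alpha>" "\<alpha> < 1/2" "\<And>i x. norm (T i *v x) \<le> \<alpha> * norm x"
    and t: "0 < t" "t \<le> real CARD('d)" and \<epsilon>: "0 < \<epsilon>" "\<epsilon> < 1"
    and quasi: "quasi_multiplicative (sv_potential T t)" and press: "\<not> pressure (sv_potential T t) \<le> 0"
  shows "\<exists>I. finite I \<and> (AE a in translation_measure.
    ereal ((1 - \<epsilon>) * t) \<le> hausdorff_dim (projection T a ` {\<omega>. range \<omega> \<subseteq> I}))"
proof -
  have \<alpha>1: "0 \<le> \<alpha>" "\<alpha> < 1" using \<alpha> by auto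
  have t0: "0 \<le> t" using t by simp
  let ?\<phi> = "sv_potential T t"
  have pos: "0 < ?\<phi> w" for w by (rule sv_potential_pos[where T=T, OF T t0 t(2)])
  have large: "\<exists>n\<ge>1. ennreal K < word_sum ?\<phi> n" for K
    using sv_potential_pressure_dichotomy[where T=T, OF T t0 t(2) quasi] press by blast
  have ext: "\<exists>b>0. \<forall>u. ?\<phi> u * b \<le> ?\<phi> (u @ w)" for w
    by (rule sv_potential_append_ge[where T=T, OF T t0 t(2)])
  obtain I \<mu> C where I: "finite I" and "prob_space \<mu>" and sets_\<mu>: "sets \<mu> = sets word_space"
    and range: "AE \<omega> in \<mu>. range \<omega> \<subseteq> I" and C: "0 < C"
    and frost: "\<And>v. emeasure \<mu> {\<omega>. map \<omega> [0..<length v] = v} \<le> ennreal (C * ?\<phi> v)"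
    using exists_word_measure[OF quasi pos sv_potential_Nil[where T=T, OF t0 t(2)] ext large] by metis
  interpret \<mu>: prob_space \<mu> by fact
  interpret TM: prob_space "translation_measure :: (nat \<Rightarrow> real^'d) measure"
    by (rule prob_space_translation_measure)
  interpret P: pair_sigma_finite "translation_measure :: (nat \<Rightarrow> real^'d) measure" \<mu> by standard
  have space_\<mu>: "space \<mu> = UNIV" using sets_eq_imp_space_eq[OF sets_\<mu>] by (simp add: space_PiM)
  define s where "s = (1 - \<epsilon>) * t"
  have s: "0 < s" using t \<epsilon> by (simp add: s_def)
  define C1 where "C1 = transversality_const CARD('d) (1 - \<alpha> / (1 - \<alpha>)) t \<epsilon>"
  have C1: "0 < C1"
    unfolding C1_def by (rule transversality_const_pos) (use \<alpha> \<epsilon> in \<open>auto simp: field_simps\<close>)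
  define h where "h a \<omega> \<tau> = inverse (ennreal (dist (projection T a \<omega>) (projection T a \<tau>) powr s))"
    for a :: "nat \<Rightarrow> real^'d" and \<omega> \<tau>
  have proj: "(\<lambda>(a, \<omega>). projection T a \<omega>) \<in> borel_measurable (translation_measure \<Otimes>\<^sub>M \<mu>)"
    by (rule borel_measurable_projection[where T=T, OF \<alpha>1 \<alpha>(3) sets_\<mu>])
  have proj1: "(\<lambda>x. projection T (f x) (g x)) \<in> borel_measurable N"
    if "f \<in> measurable N translation_measure" "g \<in> measurable N \<mu>" for f g and N :: "'z measure"
    using measurable_compose[OF measurable_Pair[OF that] proj] by simp
  (* The ratio of the geometric series that dominates the energy. *)
  define q where "q = \<alpha> powr (t * \<epsilon>)"
  have q: "0 \<le> q" "q < 1" using \<alpha> t \<epsilon> by (auto simp: q_def powr01_less_one)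
  have \<phi>_small: "?\<phi> w powr \<epsilon> \<le> q ^ length w" for w
  proof -
    have "?\<phi> w \<le> sv_potential T 0 w * (\<alpha> ^ length w) powr (t - 0)"
      by (rule sv_potential_antimono[where T=T, OF T \<alpha>(1,3)]) (use t in auto)
    then have "?\<phi> w \<le> (\<alpha> ^ length w) powr t"
      by (simp add: sv_potential_def singular_value_function_def)
    then have "?\<phi> w powr \<epsilon> \<le> ((\<alpha> ^ length w) powr t) powr \<epsilon>"
      using pos[of w] \<epsilon> by (intro powr_mono2) auto
    also have "\<dots> = q ^ length w"
      using \<alpha>(1) by (simp add: q_def powr_powr powr_realpow[symmetric] mult_ac)
    finally show ?thesis .
  qed
  define c where "c v = C1 * ?\<phi> v powr (- (1 - \<epsilon>))" for v
  define S where "S n \<omega> = {\<tau> :: nat \<Rightarrow> nat. map \<tau> [0..<n] = map \<omega> [0..<n]}" for n and \<omega> :: "nat \<Rightarrow> nat"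
  have S_sets: "S n \<omega> \<in> sets \<mu>" for n \<omega>
  proof -
    have "(\<lambda>\<tau>. map \<tau> [0..<n]) -` {map \<omega> [0..<n]} \<inter> space word_space \<in> sets word_space"
      by (rule measurable_sets[OF measurable_prefix]) simp
    also have "(\<lambda>\<tau>. map \<tau> [0..<n]) -` {map \<omega> [0..<n]} \<inter> space word_space = S n \<omega>"
      by (auto simp: S_def space_PiM)
    finally show ?thesis by (simp add: sets_\<mu>)
  qed
  define G where "G \<omega> \<tau> = (\<Sum>n. ennreal (c (map \<omega> [0..<n])) * indicator (S n \<omega>) \<tau>)" for \<omega> \<tau>
  have term_le: "ennreal (c (map \<omega> [0..<n])) * indicator (S n \<omega>) \<tau> \<le> G \<omega> \<tau>" for n \<omega> \<tau>
  proof -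
    let ?f = "\<lambda>n. ennreal (c (map \<omega> [0..<n])) * indicator (S n \<omega>) \<tau>"
    have "sum ?f {n} \<le> suminf ?f" by (rule sum_le_suminf) auto
    then show ?thesis
      unfolding G_def by (simp only: sum.insert finite.emptyI empty_iff not_False_eq_True sum.empty add_0_right)
  qed
  have inner: "(\<integral>\<^sup>+a. h a \<omega> \<tau> \<partial>translation_measure) \<le> G \<omega> \<tau>" for \<omega> \<tau>
  proof (cases "\<omega> = \<tau>")
    case True
    (* The kernel is infinite on the diagonal, but so is G, whose terms are at least C1. *)
    have c1: "C1 \<le> c v" for v
    proof -
      have "?\<phi> v powr \<epsilon> \<le> 1" using \<phi>_small[of v] power_le_one[of q "length v"] q by simp
      then have "?\<phi> v \<le> 1" using gr_one_powr[of "?\<phi> v" \<epsilon>] \<epsilon>(1) by (meson not_le)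
      then have "1 \<le> ?\<phi> v powr (- (1 - \<epsilon>))"
        using pos[of v] \<epsilon> powr_mono2'[of "- (1 - \<epsilon>)" "?\<phi> v" 1] by simp
      then show ?thesis using C1 by (simp add: c_def)
    qed
    have "G \<omega> \<tau> = \<infinity>"
    proof (rule ccontr)
      assume "G \<omega> \<tau> \<noteq> \<infinity>"
      then obtain m :: nat where m: "G \<omega> \<tau> < of_nat m"
        using ennreal_Ex_less_of_nat[of "G \<omega> \<tau>"] by (auto simp: less_top)
      obtain N :: nat where N: "real m < real N * C1" using ex_less_of_nat_mult[OF C1] by blast
      have "ennreal (real N * C1) = (\<Sum>n<N. ennreal C1)"
        using C1 by (simp add: ennreal_mult' ennreal_of_nat_eq_real_of_nat)
      also have "\<dots> \<le> (\<Sum>n<N. ennreal (c (map \<omega> [0..<n])) * indicator (S n \<omega>) \<tau>)"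
        using c1 True by (intro sum_mono) (simp add: S_def ennreal_leI)
      also have "\<dots> \<le> G \<omega> \<tau>" unfolding G_def by (rule sum_le_suminf) auto
      finally have "ennreal (real N * C1) \<le> G \<omega> \<tau>" .
      also note m
      finally have "ennreal (real N * C1) < ennreal (real m)" by (simp add: ennreal_of_nat_eq_real_of_nat)
      then show False using N C1 by (simp add: ennreal_less_iff)
    qed
    then show ?thesis by simp
  next
    case False
    then obtain k where "\<omega> k \<noteq> \<tau> k" by auto
    define n where "n = (LEAST k. \<omega> k \<noteq> \<tau> k)"
    have ne: "\<omega> n \<noteq> \<tau> n" unfolding n_def by (rule LeastI) fact
    have eq: "\<omega> k = \<tau> k" if "k < n" for k using not_less_Least that unfolding n_def by blast
    have "(\<integral>\<^sup>+a. h a \<omega> \<tau> \<partial>translation_measure) \<le> ennreal (c (map \<omega> [0..<n]))"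
      unfolding h_def c_def C1_def s_def
      by (rule transversality[where T=T and \<omega>=\<omega> and \<tau>=\<tau> and n=n, OF T \<alpha> t0 t(2) \<epsilon> _ ne]) (rule eq)
    also have "\<dots> = ennreal (c (map \<omega> [0..<n])) * indicator (S n \<omega>) \<tau>"
      using eq by (simp add: S_def)
    also have "\<dots> \<le> G \<omega> \<tau>" by (rule term_le)
    finally show ?thesis .
  qed
  have outer: "(\<integral>\<^sup>+\<tau>. G \<omega> \<tau> \<partial>\<mu>) \<le> ennreal (C1 * C * (1 / (1 - q)))" for \<omega>
  proof -
    have "(\<integral>\<^sup>+\<tau>. G \<omega> \<tau> \<partial>\<mu>) = (\<Sum>n. \<integral>\<^sup>+\<tau>. ennreal (c (map \<omega> [0..<n])) * indicator (S n \<omega>) \<tau> \<partial>\<mu>)"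
      unfolding G_def using S_sets by (intro nn_integral_suminf borel_measurable_times_ennreal) auto
    also have "\<dots> = (\<Sum>n. ennreal (c (map \<omega> [0..<n])) * emeasure \<mu> (S n \<omega>))"
      using S_sets by (simp add: nn_integral_cmult_indicator)
    also have "\<dots> \<le> (\<Sum>n. ennreal (C1 * C * q ^ n))"
    proof (intro suminf_le summableI)
      fix n
      let ?v = "map \<omega> [0..<n]"
      have "emeasure \<mu> (S n \<omega>) \<le> ennreal (C * ?\<phi> ?v)"
        using frost[of ?v] by (simp add: S_def)
      then have "ennreal (c ?v) * emeasure \<mu> (S n \<omega>) \<le> ennreal (c ?v) * ennreal (C * ?\<phi> ?v)"
        by (rule mult_left_mono) simp
      also have "\<dots> = ennreal (C1 * C * ?\<phi> ?v powr \<epsilon>)"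
      proof -
        have "?\<phi> ?v powr (- (1 - \<epsilon>)) * ?\<phi> ?v = ?\<phi> ?v powr \<epsilon>"
          using pos[of ?v] powr_add[of "?\<phi> ?v" "- (1 - \<epsilon>)" 1] by simp
        then have "c ?v * (C * ?\<phi> ?v) = C1 * C * ?\<phi> ?v powr \<epsilon>"
          unfolding c_def by (simp only: mult_ac)
        moreover have "0 \<le> c ?v" using C1 by (simp add: c_def)
        ultimately show ?thesis by (simp only: ennreal_mult'[symmetric])
      qed
      also have "\<dots> \<le> ennreal (C1 * C * q ^ n)"
        using \<phi>_small[of ?v] C C1 by (intro ennreal_leI mult_left_mono) auto
      finally show "ennreal (c ?v) * emeasure \<mu> (S n \<omega>) \<le> ennreal (C1 * C * q ^ n)" .
    qed
    also have "\<dots> = ennreal (C1 * C * (1 / (1 - q)))"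
    proof (rule suminf_ennreal_eq)
      show "(\<lambda>n. C1 * C * q ^ n) sums (C1 * C * (1 / (1 - q)))"
        using q by (intro sums_mult geometric_sums) simp
      show "0 \<le> C1 * C * q ^ n" for n using C C1 q by simp
    qed
    finally show ?thesis .
  qed
  have h3: "(\<lambda>x. h (f x) (g x) (k x)) \<in> borel_measurable N"
    if f: "f \<in> measurable N translation_measure" and g: "g \<in> measurable N \<mu>" and k: "k \<in> measurable N \<mu>"
    for f g k and N :: "'z measure"
  proof -
    note [measurable] = proj1[OF f g] proj1[OF f k]
    show ?thesis unfolding h_def by measurable
  qed
  have "(\<integral>\<^sup>+a. \<integral>\<^sup>+\<omega>. \<integral>\<^sup>+\<tau>. h a \<omega> \<tau> \<partial>\<mu> \<partial>\<mu> \<partial>translation_measure)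
      = (\<integral>\<^sup>+\<omega>. \<integral>\<^sup>+a. \<integral>\<^sup>+\<tau>. h a \<omega> \<tau> \<partial>\<mu> \<partial>translation_measure \<partial>\<mu>)"
  proof (rule P.Fubini'[symmetric])
    have "(\<lambda>(x, \<tau>). h (fst x) (snd x) \<tau>) \<in> borel_measurable ((translation_measure \<Otimes>\<^sub>M \<mu>) \<Otimes>\<^sub>M \<mu>)"
      unfolding split_beta' by (rule h3) measurable
    then have "(\<lambda>x. \<integral>\<^sup>+\<tau>. h (fst x) (snd x) \<tau> \<partial>\<mu>) \<in> borel_measurable (translation_measure \<Otimes>\<^sub>M \<mu>)"
      by (rule \<mu>.borel_measurable_nn_integral)
    then show "(\<lambda>(a, \<omega>). \<integral>\<^sup>+\<tau>. h a \<omega> \<tau> \<partial>\<mu>) \<in> borel_measurable (translation_measure \<Otimes>\<^sub>M \<mu>)"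
      by (simp add: split_beta')
  qed
  also have "\<dots> \<le> (\<integral>\<^sup>+\<omega>. ennreal (C1 * C * (1 / (1 - q))) \<partial>\<mu>)"
  proof (rule nn_integral_mono)
    fix \<omega> assume \<omega>: "\<omega> \<in> space \<mu>"
    have "(\<integral>\<^sup>+a. \<integral>\<^sup>+\<tau>. h a \<omega> \<tau> \<partial>\<mu> \<partial>translation_measure) = (\<integral>\<^sup>+\<tau>. \<integral>\<^sup>+a. h a \<omega> \<tau> \<partial>translation_measure \<partial>\<mu>)"
    proof (rule P.Fubini'[symmetric])
      show "(\<lambda>(a, \<tau>). h a \<omega> \<tau>) \<in> borel_measurable (translation_measure \<Otimes>\<^sub>M \<mu>)"
        unfolding split_beta' by (rule h3) (use \<omega> in measurable)
    qed
    also have "\<dots> \<le> (\<integral>\<^sup>+\<tau>. G \<omega> \<tau> \<partial>\<mu>)" by (intro nn_integral_mono inner)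
    also note outer
    finally show "(\<integral>\<^sup>+a. \<integral>\<^sup>+\<tau>. h a \<omega> \<tau> \<partial>\<mu> \<partial>translation_measure) \<le> ennreal (C1 * C * (1 / (1 - q)))" .
  qed
  also have "\<dots> < \<infinity>" by (simp add: \<mu>.emeasure_space_1)
  finally have finite_energy: "(\<integral>\<^sup>+a. \<integral>\<^sup>+\<omega>. \<integral>\<^sup>+\<tau>. h a \<omega> \<tau> \<partial>\<mu> \<partial>\<mu> \<partial>translation_measure) < \<infinity>" .
  have "(\<lambda>a. \<integral>\<^sup>+\<omega>. \<integral>\<^sup>+\<tau>. h a \<omega> \<tau> \<partial>\<mu> \<partial>\<mu>) \<in> borel_measurable translation_measure"
  proof (rule \<mu>.borel_measurable_nn_integral)
    have "(\<lambda>(x, \<tau>). h (fst x) (snd x) \<tau>) \<in> borel_measurable ((translation_measure \<Otimes>\<^sub>M \<mu>) \<Otimes>\<^sub>M \<mu>)"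
      unfolding split_beta' by (rule h3) measurable
    then have "(\<lambda>x. \<integral>\<^sup>+\<tau>. h (fst x) (snd x) \<tau> \<partial>\<mu>) \<in> borel_measurable (translation_measure \<Otimes>\<^sub>M \<mu>)"
      by (rule \<mu>.borel_measurable_nn_integral)
    then show "(\<lambda>(a, \<omega>). \<integral>\<^sup>+\<tau>. h a \<omega> \<tau> \<partial>\<mu>) \<in> borel_measurable (translation_measure \<Otimes>\<^sub>M \<mu>)"
      by (simp add: split_beta')
  qed
  then have "AE a in translation_measure. (\<integral>\<^sup>+\<omega>. \<integral>\<^sup>+\<tau>. h a \<omega> \<tau> \<partial>\<mu> \<partial>\<mu>) \<noteq> \<infinity>"
    using finite_energy by (intro nn_integral_noteq_infinite) auto
  then have "AE a in translation_measure. ereal s \<le> hausdorff_dim (projection T a ` {\<omega>. range \<omega> \<subseteq> I})"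
    using AE_space
  proof eventually_elim
    case (elim a)
    show ?case
    proof (rule hausdorff_dim_ge_energy[OF \<mu>.prob_space_axioms _ s])
      show "projection T a \<in> borel_measurable \<mu>"
        using proj1[of "\<lambda>_. a" \<mu> "\<lambda>\<omega>. \<omega>"] elim(2) by simp
      show "(\<integral>\<^sup>+x. \<integral>\<^sup>+y. inverse (ennreal (dist (projection T a x) (projection T a y) powr s)) \<partial>\<mu> \<partial>\<mu>) < \<infinity>"
        using elim(1) by (simp add: h_def less_top)
      show "AE x in \<mu>. x \<in> {\<omega>. range \<omega> \<subseteq> I}" using range by simp
    qed
  qed
  then show ?thesis using I by (auto simp: s_def)
qed

text \<open>
  The cylinder sets of generation \<open>n\<close> are contained in translates of images of a fixed ball under
  \<open>T\<^sub>w\<close>, so the sums for the natural covers are at most a constant times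
  \<open>Z\<^sub>n(s) \<le> \<alpha>\<^bsup>n(s-s')\<^esup> Z\<^sub>n(s')\<close>.
\<close>

lemma hausdorff_dim_range_projection_le:
  fixes T :: "nat \<Rightarrow> real^'d^'d"
  assumes T: "\<And>i. invertible (T i)" and \<alpha>: "0 < \<alpha>" "\<alpha> < 1" "\<And>i x. norm (T i *v x) \<le> \<alpha> * norm x"
    and s: "0 \<le> s'" "s' < s" "s \<le> real CARD('d)"
    and K: "\<And>n. 1 \<le> n \<Longrightarrow> word_sum (sv_potential T s') n \<le> ennreal K" and a: "\<And>i. norm (a i) \<le> B"
  shows "hausdorff_dim (range (projection T a)) \<le> ereal s"
proof (rule hausdorff_dim_le)
  have s0: "0 < s" using s by linarith
  show "0 \<le> s" using s0 by simp
  fix \<delta> e :: real assume \<delta>: "0 < \<delta>" and e: "0 < e"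
  have \<alpha>0: "0 \<le> \<alpha>" using \<alpha> by simp
  have B0: "0 \<le> B" using a[of 0] norm_ge_zero order_trans by blast
  define R where "R = B / (1 - \<alpha>) + 1"
  have R: "0 < R" using B0 \<alpha>(2) by (simp add: R_def add_nonneg_pos)
  have projR: "norm (projection T a \<omega>) \<le> R" for \<omega>
    using norm_projection_le[where T=T and a=a and \<omega>=\<omega>, OF \<alpha>0 \<alpha>(2,3) a] by (simp add: R_def)
  define L where "L = 2 * R * real CARD('d)"
  define c where "c = 2 ^ CARD('d) * L powr s"
  have c: "0 \<le> c" by (simp add: c_def)
  (* The gain per letter in passing from s' to s. *)
  define r where "r = \<alpha> powr (s - s')"
  have r: "0 \<le> r" "r < 1" using \<alpha> s by (auto simp: r_def powr01_less_one)
  define K' where "K' = max K 0"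
  have "(\<lambda>n. L * \<alpha> ^ n) \<longlonglongrightarrow> L * 0"
    using \<alpha> by (intro tendsto_intros LIMSEQ_power_zero) simp
  moreover have "(\<lambda>n. c * K' * r ^ n) \<longlonglongrightarrow> c * K' * 0"
    using r by (intro tendsto_intros LIMSEQ_power_zero) simp
  ultimately have "\<forall>\<^sub>F n in sequentially. L * \<alpha> ^ n < \<delta> \<and> c * K' * r ^ n < e \<and> 1 \<le> n"
    using \<delta> e by (intro eventually_conj order_tendstoD(2) eventually_ge_at_top) auto
  then obtain n where n: "L * \<alpha> ^ n < \<delta>" "c * K' * r ^ n < e" "1 \<le> n"
    by (auto simp: eventually_sequentially)
  let ?W = "{w :: nat list. length w = n}"
  define p where "p w = (\<Sum>j<n. word_matrix T (take j w) *v a (w ! j))" for w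
  define A where "A w = (\<lambda>y. p w + word_matrix T w *v y) ` cball 0 R" for w
  have cover: "range (projection T a) \<subseteq> (\<Union>w\<in>?W. A w)"
  proof safe
    fix \<omega> :: "nat \<Rightarrow> nat"
    let ?w = "map \<omega> [0..<n]"
    have "(\<Sum>j<n. word_matrix T (map \<omega> [0..<j]) *v a (\<omega> j)) = p ?w"
      unfolding p_def by (intro sum.cong refl) (simp add: take_map)
    then have "projection T a \<omega> = p ?w + word_matrix T ?w *v projection T a (\<lambda>k. \<omega> (n + k))"
      using projection_split[where T=T and a=a and \<omega>=\<omega> and n=n, OF \<alpha>0 \<alpha>(2,3) a] by simp
    moreover have "projection T a (\<lambda>k. \<omega> (n + k)) \<in> cball 0 R" using projR by simp
    ultimately have "projection T a \<omega> \<in> A ?w" unfolding A_def by blast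
    then show "projection T a \<omega> \<in> (\<Union>w\<in>?W. A w)" by (intro UN_I[of ?w]) auto
  qed
  define Q where "Q w \<U> N D \<longleftrightarrow> finite \<U> \<and> real (card \<U>) \<le> N \<and> A w \<subseteq> \<Union>\<U> \<and>
    (\<forall>U\<in>\<U>. bounded U \<and> diameter U \<le> D) \<and> D \<le> L * \<alpha> ^ n \<and> N * D powr s \<le> c * sv_potential T s w"
    for w \<U> N D
  have "\<exists>\<U> N D. Q w \<U> N D" if w: "w \<in> ?W" for w
  proof -
    have inv: "invertible (word_matrix T w)" by (rule invertible_word_matrix) (rule T)
    have le: "norm (word_matrix T w *v x) \<le> \<alpha> ^ n * norm x" for x
      using norm_word_matrix_le[where T=T and w=w and x=x, OF \<alpha>0 \<alpha>(3)] w by simp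
    show ?thesis
      unfolding Q_def A_def L_def c_def sv_potential_def
      by (rule singular_value_function_cover[OF inv R s0 s(3) le])
  qed
  then obtain \<U> N D where D: "\<And>w. w \<in> ?W \<Longrightarrow> Q w (\<U> w) (N w) (D w)" by metis
  have "hausdorff_pre_measure s \<delta> (range (projection T a)) \<le> hausdorff_pre_measure s \<delta> (\<Union>w\<in>?W. A w)"
    by (rule hausdorff_pre_measure_mono[OF cover])
  also have "\<dots> \<le> ennreal e"
  proof (rule hausdorff_pre_measure_le_finite_covers[where \<U>=\<U> and N=N and D=D, OF s0])
    show "0 \<le> \<delta>" using \<delta> by simp
    fix w assume w: "w \<in> ?W"
    note Dw = D[OF w, unfolded Q_def]
    show "finite (\<U> w) \<and> real (card (\<U> w)) \<le> N w" using Dw by simp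
    show "A w \<subseteq> \<Union>(\<U> w)" using Dw by simp
    show "D w \<le> \<delta>" using Dw n(1) by linarith
    show "bounded U \<and> diameter U \<le> D w" if "U \<in> \<U> w" for U using Dw that by simp
  next
    fix F assume F: "finite F" "F \<subseteq> ?W"
    have "(\<Sum>w\<in>F. ennreal (N w * D w powr s)) \<le> (\<Sum>w\<in>F. ennreal (c * r ^ n) * ennreal (sv_potential T s' w))"
    proof (rule sum_mono)
      fix w assume "w \<in> F"
      then have w: "w \<in> ?W" using F by blast
      have "N w * D w powr s \<le> c * sv_potential T s w" using D[OF w] by (simp add: Q_def)
      also have "\<dots> \<le> c * (sv_potential T s' w * (\<alpha> ^ length w) powr (s - s'))"
        by (intro mult_left_mono c sv_potential_antimono[where T=T, OF T \<alpha>(1,3) s(1) less_imp_le[OF s(2)] s(3)])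
      also have "(\<alpha> ^ length w) powr (s - s') = r ^ n"
        using w \<alpha>(1) by (simp add: r_def powr_realpow[symmetric] powr_powr mult.commute)
      also have "c * (sv_potential T s' w * r ^ n) = (c * r ^ n) * sv_potential T s' w" by simp
      finally have "ennreal (N w * D w powr s) \<le> ennreal ((c * r ^ n) * sv_potential T s' w)" by (rule ennreal_leI)
      also have "\<dots> = ennreal (c * r ^ n) * ennreal (sv_potential T s' w)"
        by (rule ennreal_mult') (use c r in simp)
      finally show "ennreal (N w * D w powr s) \<le> ennreal (c * r ^ n) * ennreal (sv_potential T s' w)" .
    qed
    also have "\<dots> = ennreal (c * r ^ n) * (\<Sum>w\<in>F. ennreal (sv_potential T s' w))"
      by (rule sum_distrib_left[symmetric])
    also have "\<dots> \<le> ennreal (c * r ^ n) * ennreal K'"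
    proof (rule mult_left_mono)
      have "(\<Sum>w\<in>F. ennreal (sv_potential T s' w)) \<le> word_sum (sv_potential T s') n"
        by (rule sum_le_word_sum[OF F])
      also have "\<dots> \<le> ennreal K" by (rule K[OF n(3)])
      also have "\<dots> \<le> ennreal K'" by (rule ennreal_leI) (simp add: K'_def)
      finally show "(\<Sum>w\<in>F. ennreal (sv_potential T s' w)) \<le> ennreal K'" .
    qed simp
    also have "\<dots> = ennreal (c * r ^ n * K')"
      by (rule ennreal_mult'[symmetric]) (use c r in simp)
    also have "\<dots> \<le> ennreal e" using n(2) by (intro ennreal_leI) (simp add: mult_ac)
    finally show "(\<Sum>w\<in>F. ennreal (N w * D w powr s)) \<le> ennreal e" .
  qed
  finally show "hausdorff_pre_measure s \<delta> (range (projection T a)) \<le> ennreal e" .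
qed

theorem theorem2:
  fixes T :: "nat \<Rightarrow> real^'d^'d"
  assumes "\<And>i. invertible (T i)"
    and "(SUP i. ereal (onorm (\<lambda>x. T i *v x))) < ereal (1/2)"
    and "\<And>s. 0 \<le> s \<Longrightarrow> s \<le> real CARD('d) \<Longrightarrow> quasi_multiplicative (sv_potential T s)"
  shows "AE a in translation_measure.
    hausdorff_dim (range (projection T a)) =
      min (ereal (real CARD('d))) (INF s\<in>{s. 0 \<le> s \<and> pressure (sv_potential T s) \<le> 0}. ereal s) \<and>
    min (ereal (real CARD('d))) (INF s\<in>{s. 0 \<le> s \<and> pressure (sv_potential T s) \<le> 0}. ereal s) =
      (SUP I\<in>{I. finite I}. hausdorff_dim (projection T a ` {\<omega>. range \<omega> \<subseteq> I}))"
proof -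
  note T = assms(1) and quasi = assms(3)
  obtain \<alpha> where \<alpha>: "0 < \<alpha>" "\<alpha> < 1/2" "\<And>i x. norm (T i *v x) \<le> \<alpha> * norm x"
    using uniform_contraction[OF assms(2)] by blast
  have \<alpha>1: "\<alpha> < 1" using \<alpha> by simp
  let ?S = "{s. 0 \<le> s \<and> pressure (sv_potential T s) \<le> 0}"
  define m where "m = min (ereal (real CARD('d))) (INF s\<in>?S. ereal s)"
  have m0: "0 \<le> m" unfolding m_def by (intro min.boundedI INF_greatest) auto
  have upper: "hausdorff_dim (range (projection T a)) \<le> m" if a: "a \<in> space translation_measure" for a
  proof -
    have aB: "norm (a i) \<le> real CARD('d)" for i
      using a by (intro norm_unit_cube_le) (simp add: space_translation_measure)
    have "bounded (range (projection T a))"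
      using norm_projection_le[where T=T and a=a, OF less_imp_le[OF \<alpha>(1)] \<alpha>1 \<alpha>(3) aB]
      by (intro boundedI[of _ "real CARD('d) / (1 - \<alpha>)"]) blast
    then have d: "hausdorff_dim (range (projection T a)) \<le> ereal (real CARD('d))"
      by (rule hausdorff_dim_bounded_le)
    (* If s' < d, the bound holds for every s with s' < s \<le> d, hence for s' itself. *)
    have "hausdorff_dim (range (projection T a)) \<le> ereal s'" if s': "s' \<in> ?S" for s'
    proof (cases "s' < real CARD('d)")
      case False
      then show ?thesis using d by (meson ereal_less_eq(3) not_le_imp_less order_trans less_imp_le)
    next
      case True
      have s'0: "0 \<le> s'" "pressure (sv_potential T s') \<le> 0" using s' by auto
      obtain K where K: "\<And>n. 1 \<le> n \<Longrightarrow> word_sum (sv_potential T s') n \<le> ennreal K"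
        using sv_potential_pressure_dichotomy[where T=T, OF T s'0(1) less_imp_le[OF True] quasi[OF s'0(1) less_imp_le[OF True]]]
          s'0(2) by blast
      have le: "hausdorff_dim (range (projection T a)) \<le> ereal s" if "s' < s" "s \<le> real CARD('d)" for s
        by (rule hausdorff_dim_range_projection_le[where T=T, OF T \<alpha>(1) \<alpha>1 \<alpha>(3) s'0(1) that K aB])
      show ?thesis
      proof (rule ereal_le_epsilon2)
        fix e :: real assume e: "0 < e"
        have "hausdorff_dim (range (projection T a)) \<le> ereal (min (s' + e) (real CARD('d)))"
          using e True by (intro le) auto
        also have "\<dots> \<le> ereal s' + ereal e" by simp
        finally show "hausdorff_dim (range (projection T a)) \<le> ereal s' + ereal e" .
      qed
    qed
    then show ?thesis using d unfolding m_def by (intro min.boundedI INF_greatest) auto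
  qed
  have lower: "\<exists>I. finite I \<and> (AE a in translation_measure.
      ereal s' \<le> hausdorff_dim (projection T a ` {\<omega>. range \<omega> \<subseteq> I}))" if s': "0 < s'" "ereal s' < m" for s'
  proof -
    (* Leaving room for the loss: s' = (1 - eps) t with eps = 1 - s' / t. *)
    obtain t where t: "ereal s' < ereal t" "ereal t < m" using ereal_dense2[OF s'(2)] by blast
    have t0: "0 < t" "s' < t" using t s'(1) by auto
    have td: "t \<le> real CARD('d)" using t(2) by (simp add: m_def less_imp_le)
    have "\<not> pressure (sv_potential T t) \<le> 0"
    proof
      assume "pressure (sv_potential T t) \<le> 0"
      then have "(INF s\<in>?S. ereal s) \<le> ereal t" using t0 by (intro INF_lower) simp
      moreover have "ereal t < (INF s\<in>?S. ereal s)" using t(2) by (simp add: m_def)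
      ultimately show False by (meson not_le)
    qed
    moreover have "0 < 1 - s' / t" "1 - s' / t < 1" "(1 - (1 - s' / t)) * t = s'"
      using t0 s'(1) by auto
    ultimately show ?thesis
      using AE_hausdorff_dim_finite_alphabet_ge[where T=T and \<epsilon>="1 - s' / t", OF T \<alpha> t0(1) td _ _ quasi[OF less_imp_le[OF t0(1)] td]]
      by simp
  qed
  have "AE a in translation_measure. \<forall>r\<in>{r::rat. 0 < real_of_rat r \<and> ereal (real_of_rat r) < m}.
    \<exists>I. finite I \<and> ereal (real_of_rat r) \<le> hausdorff_dim (projection T a ` {\<omega>. range \<omega> \<subseteq> I})"
  proof (subst AE_ball_countable, simp, intro ballI)
    fix r assume "r \<in> {r::rat. 0 < real_of_rat r \<and> ereal (real_of_rat r) < m}"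
    then obtain I where "finite I" "AE a in translation_measure.
      ereal (real_of_rat r) \<le> hausdorff_dim (projection T a ` {\<omega>. range \<omega> \<subseteq> I})"
      using lower[of "real_of_rat r"] by blast
    then show "AE a in translation_measure. \<exists>I. finite I \<and>
      ereal (real_of_rat r) \<le> hausdorff_dim (projection T a ` {\<omega>. range \<omega> \<subseteq> I})"
      by (auto elim: eventually_mono)
  qed
  then show ?thesis
    using AE_space unfolding m_def[symmetric]
  proof eventually_elim
    case (elim a)
    let ?sup = "SUP I\<in>{I. finite I}. hausdorff_dim (projection T a ` {\<omega>. range \<omega> \<subseteq> I})"
    have m_le: "m \<le> ?sup"
    proof (rule dense_le)
      fix x assume x: "x < m"
      show "x \<le> ?sup"
      proof (cases "x < 0")
        case True
        have "0 \<le> hausdorff_dim (projection T a ` {\<omega>. range \<omega> \<subseteq> {}})" by (rule hausdorff_dim_nonneg)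
        also have "\<dots> \<le> ?sup" by (rule SUP_upper) simp
        finally show ?thesis using True by simp
      next
        case False
        obtain z z' where z: "x < ereal z" "ereal z < ereal z'" "ereal z' < m"
          using ereal_dense2[OF x] ereal_dense2 by blast
        obtain r where r: "z < real_of_rat r" "real_of_rat r < z'" using of_rat_dense z(2) by auto
        have "0 \<le> x" using False by (simp add: not_less)
        also note z(1)
        finally have "0 < z" by simp
        then have "0 < real_of_rat r" using r(1) by linarith
        moreover have "ereal (real_of_rat r) < m" using r(2) z(3) by (meson ereal_less_eq(3) le_less_trans less_imp_le)
        ultimately obtain I where I: "finite I" "ereal (real_of_rat r) \<le> hausdorff_dim (projection T a ` {\<omega>. range \<omega> \<subseteq> I})"
          using elim(1) by blast
        have "x \<le> ereal (real_of_rat r)" using z(1) r(1) by (meson ereal_less_eq(3) less_imp_le order_trans)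
        also note I(2)
        also have "hausdorff_dim (projection T a ` {\<omega>. range \<omega> \<subseteq> I}) \<le> ?sup" using I(1) by (intro SUP_upper) simp
        finally show ?thesis .
      qed
    qed
    have sup_le: "?sup \<le> hausdorff_dim (range (projection T a))"
      by (intro SUP_least hausdorff_dim_mono) auto
    have le_m: "hausdorff_dim (range (projection T a)) \<le> m" by (rule upper[OF elim(2)])
    show ?case
      by (rule conjI[OF order_antisym[OF le_m order_trans[OF m_le sup_le]]
            order_antisym[OF m_le order_trans[OF sup_le le_m]]])
  qed
qed

end
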